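(* Let $n\ge 2$. The (multi-homogeneous) coordinate ring $Q_n=\mathbb{C}\mathbf{X}_n/I(R_n)$ of $R_n$ is isomorphic, as an algebra, to $\bigoplus_{\mathbf m} M_{\mathbf m}^*$, where $\mathbf m=(m_{i,j})_{1\le i\le j\le n-1}$ runs over all collections of non-negative integers.
   Context: Everything is over $\mathbb{C}$; $\mathfrak g=\mathfrak{sl}_n=\mathfrak n\oplus\mathfrak h\oplus\mathfrak n^-$ with Borel subalgebra $\mathfrak b=\mathfrak n\oplus\mathfrak h$. The positive roots are $\alpha_{i,j}=\alpha_i+\dots+\alpha_j$, $1\le i\le j\le n-1$; $f_\beta\in\mathfrak n^-$ is a root vector of weight $-\beta$, and $f_{i,j}=f_{\alpha_{i,j}}$ (the matrix unit sending $w_i$ to $w_{j+1}$). For roots, $\beta\ge\alpha$ means that $\beta-\alpha$ is a non-negative integer combination of simple roots. The degenerate Lie algebra is $\mathfrak g^a=\mathfrak b\oplus\mathfrak g/\mathfrak b$, where $\mathfrak g/\mathfrak b=(\mathfrak n^-)^a$ is an abelian ideal on which $\mathfrak b$ acts by the adjoint action. Its enveloping algebra contains $S(\mathfrak n^-)=\mathbb{C}[f_\beta]_{\beta>0}$; $\circ$ denotes the induced adjoint action (by derivations) of $\mathfrak b$ on $S(\mathfrak n^-)\simeq S(\mathfrak g/\mathfrak b)$. For a positive root $\alpha$, $M_\alpha=\mathbb{C}[f_\beta]_{\beta>0}/I_\alpha$, where $I_\alpha$ is the ideal generated by the subspace $U(\mathfrak b)\circ\langle f_\beta^2\ (\beta\ge\alpha),\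 f_\beta\ (\beta\not\ge\alpha)\rangle$; $v_\alpha$ is the image of $1$. For $\mathbf m=(m_{i,j})$ set $v_{\mathbf m}=\bigotimes_{i\le j}v_{\alpha_{i,j}}^{\otimes m_{i,j}}$ and $M_{\mathbf m}=S(\mathfrak n^-)\cdot v_{\mathbf m}\subset\bigotimes_{i\le j}M_{\alpha_{i,j}}^{\otimes m_{i,j}}$. For any $\mathbf m^1,\mathbf m^2$ there is an equivariant embedding $M_{\mathbf m^1+\mathbf m^2}\subset M_{\mathbf m^1}\otimes M_{\mathbf m^2}$, $v_{\mathbf m^1+\mathbf m^2}\mapsto v_{\mathbf m^1}\otimes v_{\mathbf m^2}$; the dual maps $M_{\mathbf m^1}^*\otimes M_{\mathbf m^2}^*\to M_{\mathbf m^1+\mathbf m^2}^*$ define the multiplication on $\bigoplus_{\mathbf m}M_{\mathbf m}^*$. Let $W$ be an $n$-dimensional space with basis $w_1,\dots,w_n$, let $pr_k:W\to W$ be the projection with $pr_kw_k=0$, $pr_kw_l=w_l$ for $l\ne k$, and let $W_{i,j}=\mathrm{span}(w_1,\dots,w_i,w_{j+1},\dots,w_n)$. The variety $R_n$ consists of collections $(V_{i,j})_{1\le i\le j\le n-1}$ of subspaces with $V_{i,j}\subset W_{i,j}$, $\dim V_{i,j}=i$, $V_{i,j}\subset V_{i+1,j}$ for $1\le i<j\le n-1$, and $pr_{j+1}V_{i,j}\subset V_{i,j+1}$ for $1\le i\le j<n-1$. Via Plücker embeddings $R_n\subset\prod_{1\le i\le j\le n-1}\mathbb{P}(\Lambda^iW_{i,j})$.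 The ring $\mathbb{C}\mathbf X_n$ is the multi-homogeneous coordinate ring of this product: the polynomial ring in the variables $X^{(i,j)}_L$, where $1\le i\le j\le n-1$ and $L=(l_1<\dots<l_i)\subset\{1,\dots,i,j+1,\dots,n\}$, with $X^{(i,j)}_L$ dual to $w_{l_1}\wedge\dots\wedge w_{l_i}$, multigraded by the degree in each group of variables $X^{(i,j)}_\bullet$. $I(R_n)\subset\mathbb{C}\mathbf X_n$ is the ideal of multi-homogeneous polynomials vanishing on $R_n$. *)

theory Defs
  imports
    "HOL-Library.Poly_Mapping"
    "HOL-Library.FuncSet"
    "HOL-Algebra.QuotRing"
    "HOL-Algebra.Module"
    "Jordan_Normal_Form.Determinant"
begin

section \<open>Vector spaces, quotients and tensor products over the complex numbers\<close>

definition cplx :: "(complex, complex) module" where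
  "cplx = \<lparr>carrier = UNIV, monoid.mult = (*), one = 1, zero = 0, add = (+), module.smult = (*)\<rparr>"

abbreviation lookup :: "('b \<Rightarrow>\<^sub>0 'c::zero) \<Rightarrow> 'b \<Rightarrow> 'c" where
  "lookup \<equiv> Poly_Mapping.lookup"

abbreviation keys :: "('b \<Rightarrow>\<^sub>0 'c::zero) \<Rightarrow> 'b set" where
  "keys \<equiv> Poly_Mapping.keys"

abbreviation single :: "'b \<Rightarrow> 'c \<Rightarrow> ('b \<Rightarrow>\<^sub>0 'c::zero)" where
  "single \<equiv> Poly_Mapping.single"

definition scl :: "complex \<Rightarrow> ('b \<Rightarrow>\<^sub>0 complex) \<Rightarrow> ('b \<Rightarrow>\<^sub>0 complex)" where
  "scl c p = Poly_Mapping.map ((*) c) p"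

lemma lookup_scl [simp]: "lookup (scl c p) x = c * lookup p x"
  by (simp add: scl_def Poly_Mapping.map.rep_eq when_def)

global_interpretation pm: vector_space "scl :: complex \<Rightarrow> ('b \<Rightarrow>\<^sub>0 complex) \<Rightarrow> ('b \<Rightarrow>\<^sub>0 complex)"
  by unfold_locales (auto intro!: poly_mapping_eqI simp: lookup_add algebra_simps)

text \<open>As usual for modules in \<^theory>\<open>HOL-Algebra.Module\<close>, the fields \<open>mult\<close> and \<open>one\<close>
  of a mere vector space carry no meaning.\<close>

definition free_space :: "'b set \<Rightarrow> (complex, 'b \<Rightarrow>\<^sub>0 complex) module" where
  "free_space B = \<lparr>carrier = {p. keys p \<subseteq> B}, monoid.mult = undefined, one = undefined,
     zero = 0, add = (+), module.smult = scl\<rparr>"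

text \<open>The ring part of the following is \<open>M Quot N\<close>; on vector spaces it is the quotient
  vector space.\<close>

definition quot :: "(complex, 'v) module \<Rightarrow> 'v set \<Rightarrow> (complex, 'v set) module" where
  "quot M N = \<lparr>carrier = a_rcosets\<^bsub>M\<^esub> N, monoid.mult = rcoset_mult M N, one = N +>\<^bsub>M\<^esub> \<one>\<^bsub>M\<^esub>,
     zero = N, add = set_add M, module.smult = (\<lambda>c X. \<Union>x\<in>X. N +>\<^bsub>M\<^esub> (c \<odot>\<^bsub>M\<^esub> x))\<rparr>"

definition linear_maps ::
  "(complex, 'v, 'r) module_scheme \<Rightarrow> (complex, 'w, 's) module_scheme \<Rightarrow> ('v \<Rightarrow> 'w) set" where
  "linear_maps M N = {g \<in> carrier M \<rightarrow>\<^sub>E carrier N.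
     (\<forall>x\<in>carrier M. \<forall>y\<in>carrier M. g (x \<oplus>\<^bsub>M\<^esub> y) = g x \<oplus>\<^bsub>N\<^esub> g y) \<and>
     (\<forall>c. \<forall>x\<in>carrier M. g (c \<odot>\<^bsub>M\<^esub> x) = c \<odot>\<^bsub>N\<^esub> g x)}"

abbreviation dual :: "(complex, 'v, 'r) module_scheme \<Rightarrow> ('v \<Rightarrow> complex) set" where
  "dual M \<equiv> linear_maps M cplx"

text \<open>A vector space together with operators \<open>act \<beta>\<close>, the actions of the \<open>f\<^sub>\<beta>\<close>, where the
  positive root \<open>\<alpha>\<^sub>i\<^sub>,\<^sub>j\<close> is encoded as the pair \<open>(i, j)\<close>.\<close>

record 'v fmodule = "(complex, 'v) module" +
  act :: "nat \<times> nat \<Rightarrow> 'v \<Rightarrow> 'v"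

text \<open>The tensor product of the spaces \<open>V k\<close>, \<open>k \<in> K\<close> (with \<open>K\<close> finite): the free vector space
  on the product of the carriers modulo the multilinearity relations.\<close>

definition tensor_rels :: "'k set \<Rightarrow> ('k \<Rightarrow> 'v fmodule) \<Rightarrow> (('k \<Rightarrow> 'v) \<Rightarrow>\<^sub>0 complex) set" where
  "tensor_rels K V = pm.span
    ({single (x(k := u \<oplus>\<^bsub>V k\<^esub> v)) 1 - single (x(k := u)) 1 - single (x(k := v)) 1 | x k u v.
        x \<in> (\<Pi>\<^sub>E k\<in>K. carrier (V k)) \<and> k \<in> K \<and> u \<in> carrier (V k) \<and> v \<in> carrier (V k)} \<union>
     {single (x(k := c \<odot>\<^bsub>V k\<^esub> u)) 1 - scl c (single (x(k := u)) 1) | x k c u.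
        x \<in> (\<Pi>\<^sub>E k\<in>K. carrier (V k)) \<and> k \<in> K \<and> u \<in> carrier (V k)})"

text \<open>The Lie algebra elements \<open>f\<^sub>\<beta>\<close> act on a tensor product by the Leibniz rule.\<close>

definition free_act :: "'k set \<Rightarrow> ('k \<Rightarrow> 'v fmodule) \<Rightarrow> nat \<times> nat \<Rightarrow>
    (('k \<Rightarrow> 'v) \<Rightarrow>\<^sub>0 complex) \<Rightarrow> (('k \<Rightarrow> 'v) \<Rightarrow>\<^sub>0 complex)" where
  "free_act K V \<beta> a =
     (\<Sum>x\<in>keys a. \<Sum>k\<in>K. single (x(k := act (V k) \<beta> (x k))) (lookup a x))"

definition tensor :: "'k set \<Rightarrow> ('k \<Rightarrow> 'v fmodule) \<Rightarrow> (('k \<Rightarrow> 'v) \<Rightarrow>\<^sub>0 complex) set fmodule" where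
  "tensor K V =
    (let F = free_space (\<Pi>\<^sub>E k\<in>K. carrier (V k)); N = tensor_rels K V in
     module.extend (quot F N)
       (fmodule.fields (\<lambda>\<beta> X. \<Union>a\<in>X. N +>\<^bsub>F\<^esub> free_act K V \<beta> a)))"

definition pure_tensor ::
  "'k set \<Rightarrow> ('k \<Rightarrow> 'v fmodule) \<Rightarrow> ('k \<Rightarrow> 'v) \<Rightarrow> (('k \<Rightarrow> 'v) \<Rightarrow>\<^sub>0 complex) set" where
  "pure_tensor K V x =
     tensor_rels K V +>\<^bsub>free_space (\<Pi>\<^sub>E k\<in>K. carrier (V k))\<^esub> single (restrict x K) 1"

text \<open>The functional \<open>\<Otimes>\<^sub>k \<phi> k\<close>; all representatives of a coset give the same value when the
  \<open>\<phi> k\<close> are linear.\<close>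

definition tensor_functional ::
  "'k set \<Rightarrow> ('k \<Rightarrow> 'v \<Rightarrow> complex) \<Rightarrow> (('k \<Rightarrow> 'v) \<Rightarrow>\<^sub>0 complex) set \<Rightarrow> complex" where
  "tensor_functional K \<phi> X =
     the_elem ((\<lambda>a. \<Sum>x\<in>keys a. lookup a x * (\<Prod>k\<in>K. \<phi> k (x k))) ` X)"


section \<open>Polynomial algebras\<close>

type_synonym 'x mpoly = "('x \<Rightarrow>\<^sub>0 nat) \<Rightarrow>\<^sub>0 complex"

definition poly_alg :: "'x set \<Rightarrow> (complex, 'x mpoly) module" where
  "poly_alg A = (free_space {t. keys t \<subseteq> A})\<lparr>monoid.mult := (*), one := 1\<rparr>"

definition pvar :: "'x \<Rightarrow> 'x mpoly" where
  "pvar x = single (single x 1) 1"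

definition peval :: "('x \<Rightarrow> complex) \<Rightarrow> 'x mpoly \<Rightarrow> complex" where
  "peval P F = (\<Sum>t\<in>keys F. lookup F t * (\<Prod>x\<in>keys t. P x ^ lookup t x))"

definition pdiff :: "'x \<Rightarrow> 'x mpoly \<Rightarrow> 'x mpoly" where
  "pdiff x p = (\<Sum>t\<in>keys p. single (t - single x 1) (of_nat (lookup t x) * lookup p t))"


section \<open>The modules \<open>M\<^sub>m\<close>\<close>

definition roots :: "nat \<Rightarrow> (nat \<times> nat) set" where
  "roots n = {(i, j). 1 \<le> i \<and> i \<le> j \<and> j \<le> n - 1}"

text \<open>Coordinates of a positive root with respect to the simple roots.\<close>

definition root_coords :: "nat \<times> nat \<Rightarrow> nat \<Rightarrow> int" where
  "root_coords = (\<lambda>(i, j) k. if i \<le> k \<and> k \<le> j then 1 else 0)"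

definition root_ge :: "nat \<times> nat \<Rightarrow> nat \<times> nat \<Rightarrow> bool" where
  "root_ge \<beta> \<alpha> \<longleftrightarrow> (\<forall>k. 0 \<le> root_coords \<beta> k - root_coords \<alpha> k)"

definition borel_sl :: "nat \<Rightarrow> complex mat set" where
  "borel_sl n = {x \<in> carrier_mat n n. upper_triangular x \<and> (\<Sum>a<n. x $$ (a, a)) = 0}"

text \<open>Matrix indices start at 0, so the matrix sending \<open>w\<^sub>i\<close> to \<open>w\<^sub>j\<^sub>+\<^sub>1\<close> has its nonzero
  entry in position \<open>(j, i - 1)\<close>.\<close>

definition f_mat :: "nat \<Rightarrow> nat \<times> nat \<Rightarrow> complex mat" where
  "f_mat n = (\<lambda>(i, j). mat n n (\<lambda>(a, b). if a = j \<and> b = i - 1 then 1 else 0))"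

text \<open>The action of \<open>x \<in> \<bb>\<close> on the class of \<open>f\<^sub>\<beta>\<close> in \<open>\<gg>/\<bb>\<close>, expanded in the basis of
  \<open>\<gg>/\<bb>\<close> formed by the classes of the \<open>f\<^sub>\<gamma>\<close>, and its extension to a derivation of
  the symmetric algebra.\<close>

definition ad_mod_borel :: "nat \<Rightarrow> complex mat \<Rightarrow> nat \<times> nat \<Rightarrow> (nat \<times> nat) mpoly" where
  "ad_mod_borel n x \<beta> =
     (\<Sum>(k, l)\<in>roots n. scl ((x * f_mat n \<beta> - f_mat n \<beta> * x) $$ (l, k - 1)) (pvar (k, l)))"

definition ad_derivation :: "nat \<Rightarrow> complex mat \<Rightarrow> (nat \<times> nat) mpoly \<Rightarrow> (nat \<times> nat) mpoly" where
  "ad_derivation n x p = (\<Sum>\<beta>\<in>roots n. pdiff \<beta> p * ad_mod_borel n x \<beta>)"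

text \<open>\<open>U(\<bb>) \<circ> G\<close> is the smallest \<open>\<bb>\<close>-stable subspace containing \<open>G\<close>.\<close>

definition Ub_span :: "nat \<Rightarrow> (nat \<times> nat) mpoly set \<Rightarrow> (nat \<times> nat) mpoly set" where
  "Ub_span n G =
     (\<lambda>U. pm.subspace U \<and> (\<forall>x\<in>borel_sl n. \<forall>p\<in>U. ad_derivation n x p \<in> U)) hull G"

abbreviation S_alg :: "nat \<Rightarrow> (complex, (nat \<times> nat) mpoly) module" where
  "S_alg n \<equiv> poly_alg (roots n)"

definition I_root :: "nat \<Rightarrow> nat \<times> nat \<Rightarrow> (nat \<times> nat) mpoly set" where
  "I_root n \<alpha> = Idl\<^bsub>S_alg n\<^esub>
     (Ub_span n ({pvar \<beta> ^ 2 | \<beta>. \<beta> \<in> roots n \<and> root_ge \<beta> \<alpha>} \<union>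
                 {pvar \<beta> | \<beta>. \<beta> \<in> roots n \<and> \<not> root_ge \<beta> \<alpha>}))"

definition M_root :: "nat \<Rightarrow> nat \<times> nat \<Rightarrow> (nat \<times> nat) mpoly set fmodule" where
  "M_root n \<alpha> =
    (let Q = quot (S_alg n) (I_root n \<alpha>) in
     module.extend Q (fmodule.fields
       (\<lambda>\<beta> X. (I_root n \<alpha> +>\<^bsub>S_alg n\<^esub> pvar \<beta>) \<otimes>\<^bsub>Q\<^esub> X)))"

text \<open>The submodule \<open>S(\<nn>\<^sup>-) \<cdot> v\<close>.\<close>

definition cyclic_submodule :: "nat \<Rightarrow> 'v fmodule \<Rightarrow> 'v \<Rightarrow> 'v fmodule" where
  "cyclic_submodule n T v = T\<lparr>carrier :=
     (\<lambda>U. submodule U cplx T \<and> (\<forall>\<beta>\<in>roots n. \<forall>x\<in>U. act T \<beta> x \<in> U)) hull {v}\<rparr>"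

text \<open>A collection \<open>(m\<^sub>i\<^sub>,\<^sub>j)\<close> is a finitely supported function on the roots; the third component
  of an element of \<open>factors m\<close> numbers the \<open>m\<^sub>i\<^sub>,\<^sub>j\<close> copies of \<open>M\<^sub>i\<^sub>,\<^sub>j\<close>.\<close>

definition multidegs :: "nat \<Rightarrow> (nat \<times> nat \<Rightarrow>\<^sub>0 nat) set" where
  "multidegs n = {m. keys m \<subseteq> roots n}"

definition factors :: "(nat \<times> nat \<Rightarrow>\<^sub>0 nat) \<Rightarrow> ((nat \<times> nat) \<times> nat) set" where
  "factors m = {(\<alpha>, r). r < lookup m \<alpha>}"

type_synonym M_elem = "(((nat \<times> nat) \<times> nat \<Rightarrow> (nat \<times> nat) mpoly set) \<Rightarrow>\<^sub>0 complex) set"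

definition v_vec :: "nat \<Rightarrow> (nat \<times> nat \<Rightarrow>\<^sub>0 nat) \<Rightarrow> M_elem" where
  "v_vec n m = pure_tensor (factors m) (\<lambda>(\<alpha>, r). M_root n \<alpha>) (\<lambda>(\<alpha>, r). \<one>\<^bsub>M_root n \<alpha>\<^esub>)"

definition M_mod :: "nat \<Rightarrow> (nat \<times> nat \<Rightarrow>\<^sub>0 nat) \<Rightarrow> M_elem fmodule" where
  "M_mod n m = cyclic_submodule n (tensor (factors m) (\<lambda>(\<alpha>, r). M_root n \<alpha>)) (v_vec n m)"


section \<open>The algebra \<open>\<Oplus>\<^sub>m M\<^sub>m\<^sup>*\<close>\<close>

text \<open>A binary tensor product is indexed by the type \<^typ>\<open>bool\<close>, \<open>False\<close> being the first
  factor. Since \<open>M\<^sub>m\<close> is generated by \<open>v\<^sub>m\<close>, the embedding is the only equivariant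
  linear map with the prescribed value on \<open>v\<^sub>m\<close>.\<close>

definition M_embedding :: "nat \<Rightarrow> (nat \<times> nat \<Rightarrow>\<^sub>0 nat) \<Rightarrow> (nat \<times> nat \<Rightarrow>\<^sub>0 nat) \<Rightarrow>
    M_elem \<Rightarrow> ((bool \<Rightarrow> M_elem) \<Rightarrow>\<^sub>0 complex) set" where
  "M_embedding n m1 m2 =
    (let V = case_bool (M_mod n m2) (M_mod n m1);
         T = tensor UNIV V
     in THE g. g \<in> linear_maps (M_mod n (m1 + m2)) T \<and>
          (\<forall>\<beta>\<in>roots n. \<forall>x\<in>carrier (M_mod n (m1 + m2)).
             g (act (M_mod n (m1 + m2)) \<beta> x) = act T \<beta> (g x)) \<and>
          g (v_vec n (m1 + m2)) =
            pure_tensor UNIV V (case_bool (v_vec n m2) (v_vec n m1)))"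

definition M_dual_alg ::
  "nat \<Rightarrow> (complex, (nat \<times> nat \<Rightarrow>\<^sub>0 nat) \<Rightarrow> M_elem \<Rightarrow> complex) module" where
  "M_dual_alg n = \<lparr>
     carrier = {\<Phi> \<in> (\<Pi>\<^sub>E m\<in>multidegs n. dual (M_mod n m)).
       finite {m \<in> multidegs n. \<exists>x\<in>carrier (M_mod n m). \<Phi> m x \<noteq> 0}},
     monoid.mult = (\<lambda>\<Phi> \<Psi>. \<lambda>m\<in>multidegs n. \<lambda>x\<in>carrier (M_mod n m).
       \<Sum>(m1, m2) | m1 \<in> multidegs n \<and> m2 \<in> multidegs n \<and> m1 + m2 = m.
         tensor_functional UNIV (case_bool (\<Psi> m2) (\<Phi> m1)) (M_embedding n m1 m2 x)),
     one = (\<lambda>m\<in>multidegs n. if m = 0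
       then THE \<phi>. \<phi> \<in> dual (M_mod n 0) \<and> \<phi> (v_vec n 0) = 1
       else (\<lambda>x\<in>carrier (M_mod n m). 0)),
     zero = (\<lambda>m\<in>multidegs n. \<lambda>x\<in>carrier (M_mod n m). 0),
     add = (\<lambda>\<Phi> \<Psi>. \<lambda>m\<in>multidegs n. \<lambda>x\<in>carrier (M_mod n m). \<Phi> m x + \<Psi> m x),
     module.smult = (\<lambda>c \<Phi>. \<lambda>m\<in>multidegs n. \<lambda>x\<in>carrier (M_mod n m). c * \<Phi> m x)\<rparr>"


section \<open>The variety \<open>R\<^sub>n\<close> and its coordinate ring\<close>

type_synonym W_vec = "nat \<Rightarrow>\<^sub>0 complex"

definition w :: "nat \<Rightarrow> W_vec" where
  "w l = single l 1"

definition pr :: "nat \<Rightarrow> W_vec \<Rightarrow> W_vec" where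
  "pr k x = Poly_Mapping.update k 0 x"

definition W_index :: "nat \<Rightarrow> nat \<times> nat \<Rightarrow> nat set" where
  "W_index n = (\<lambda>(i, j). {1..i} \<union> {j+1..n})"

definition W_space :: "nat \<Rightarrow> nat \<times> nat \<Rightarrow> W_vec set" where
  "W_space n \<alpha> = pm.span (w ` W_index n \<alpha>)"

definition R_var :: "nat \<Rightarrow> (nat \<times> nat \<Rightarrow> W_vec set) set" where
  "R_var n = {V \<in> (\<Pi>\<^sub>E (i, j)\<in>roots n. {U. pm.subspace U \<and> U \<subseteq> W_space n (i, j) \<and> pm.dim U = i}).
     (\<forall>i j. 1 \<le> i \<and> i < j \<and> j \<le> n - 1 \<longrightarrow> V (i, j) \<subseteq> V (i + 1, j)) \<and>
     (\<forall>i j. 1 \<le> i \<and> i \<le> j \<and> j < n - 1 \<longrightarrow> pr (j + 1) ` V (i, j) \<subseteq> V (i, j + 1))}"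

text \<open>The variable \<open>X\<^sub>L\<^sup>(\<^sup>i\<^sup>,\<^sup>j\<^sup>)\<close> is encoded as \<open>((i, j), L)\<close>, where the increasing tuple
  \<open>L\<close> is replaced by its set of entries.\<close>

type_synonym X_var = "(nat \<times> nat) \<times> nat set"

definition X_vars :: "nat \<Rightarrow> X_var set" where
  "X_vars n = {((i, j), L). (i, j) \<in> roots n \<and> L \<subseteq> W_index n (i, j) \<and> card L = i}"

definition multihomogeneous :: "nat \<Rightarrow> X_var mpoly \<Rightarrow> bool" where
  "multihomogeneous n F \<longleftrightarrow>
     (\<exists>d. \<forall>t\<in>keys F. \<forall>\<alpha>\<in>roots n. (\<Sum>L | (\<alpha>, L) \<in> X_vars n. lookup t (\<alpha>, L)) = d \<alpha>)"

text \<open>The coefficient of \<open>w\<^sub>L\<close> in the wedge product of the vectors \<open>u (i, j) 0, \<dots>, u (i, j) (i - 1)\<close>.\<close>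

definition plucker :: "(nat \<times> nat \<Rightarrow> nat \<Rightarrow> W_vec) \<Rightarrow> X_var \<Rightarrow> complex" where
  "plucker u = (\<lambda>((i, j), L).
     det (mat i i (\<lambda>(a, b). lookup (u (i, j) a) (sorted_list_of_set L ! b))))"

text \<open>Homogeneous coordinates of a point of \<open>R\<^sub>n\<close> depend on the choice of bases of the
  \<open>V\<^sub>i\<^sub>,\<^sub>j\<close>; as \<open>dim V\<^sub>i\<^sub>,\<^sub>j = i\<close>, a spanning family of \<open>i\<close> vectors is a basis.\<close>

definition vanishes_on_R :: "nat \<Rightarrow> X_var mpoly \<Rightarrow> bool" where
  "vanishes_on_R n F \<longleftrightarrow>
     (\<forall>V\<in>R_var n. \<forall>u. (\<forall>(i, j)\<in>roots n. pm.span (u (i, j) ` {..<i}) = V (i, j)) \<longrightarrow>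
        peval (plucker u) F = 0)"

definition I_R :: "nat \<Rightarrow> X_var mpoly set" where
  "I_R n = Idl\<^bsub>poly_alg (X_vars n)\<^esub>
     {F \<in> carrier (poly_alg (X_vars n)). multihomogeneous n F \<and> vanishes_on_R n F}"

definition Q_alg :: "nat \<Rightarrow> (complex, X_var mpoly set) module" where
  "Q_alg n = quot (poly_alg (X_vars n)) (I_R n)"

end

theory Submission
  imports Defs
begin

text \<open>
  Why the two algebras agree. Let \<open>V\<close> be a space on which the \<open>f\<^sub>\<beta>\<close> act and \<open>v \<in> V\<close>. A functional \<open>\<phi>\<close>
  on \<open>V\<close> has a symbol: the polynomial \<open>c \<mapsto> \<phi> (exp (\<Sum> c\<^sub>\<beta> f\<^sub>\<beta>) v)\<close> in \<open>\<complex>[f\<^sub>\<beta>]\<close>, the \<open>f\<^sub>\<beta>\<close> now being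
  coordinates on the abelian group \<open>exp (\<nn>\<^sup>-)\<^sup>a\<close>. On a module generated by \<open>v\<close> a functional is determined
  by its symbol, and because the \<open>f\<^sub>\<beta>\<close> act on tensor products by the Leibniz rule, the symbol of
  \<open>\<phi> \<otimes> \<psi>\<close> is the product of the symbols. Hence \<open>\<Oplus>\<^sub>m M\<^sub>m\<^sup>*\<close> is an algebra of polynomials in the \<open>f\<^sub>\<beta>\<close>,
  graded by \<open>m\<close>, and it remains to find out which polynomials occur.

  For a single root \<open>\<alpha>\<^sub>i\<^sub>,\<^sub>j\<close> the module \<open>M\<^sub>\<alpha>\<close> is \<open>\<Lambda>\<^sup>i W\<^sub>i\<^sub>,\<^sub>j\<close>, with \<open>v\<^sub>\<alpha> = w\<^sub>1 \<and> \<dots> \<and> w\<^sub>i\<close>: its defining ideal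
  consists exactly of the \<open>p\<close> such that \<open>p(\<partial>)\<close> annihilates all minors of the matrix with rows
  \<open>w\<^sub>k + \<Sum>\<^sub>l f\<^sub>k\<^sub>,\<^sub>l w\<^sub>l\<^sub>+\<^sub>1\<close> (\<open>k \<le> i\<close>, \<open>l \<ge> j\<close>). One inclusion holds because minors satisfy the permanental
  equations (\<open>pdiff_Delta_permanent\<close>, \<open>J_annihilates\<close>); the other one because, modulo the ideal,
  every polynomial is a combination of one monomial for each minor (\<open>spanning\<close>, \<open>annihilator_in_J\<close>).
  So the symbols of functionals on \<open>M\<^sub>\<alpha>\<close> are the combinations of these minors. The symbols for \<open>M\<^sub>m\<close> are
  then the combinations of products of minors with \<open>m\<^sub>\<alpha>\<close> factors belonging to \<open>\<alpha>\<close>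
  (\<open>M_dual_basis\<close>, \<open>symbol_exists\<close>), that is, the image of the degree \<open>m\<close> part of \<open>\<complex>X\<^sub>n\<close> under
  \<open>X\<^sup>\<alpha>\<^sub>L \<mapsto> \<Delta>\<^sup>\<alpha>\<^sub>L\<close>. This makes \<open>\<Oplus>\<^sub>m M\<^sub>m\<^sup>*\<close> the quotient of \<open>\<complex>X\<^sub>n\<close> by the polynomials whose homogeneous
  components vanish after substituting the minors.

  The minors are the Pluecker coordinates of a family of points of \<open>R\<^sub>n\<close>, its open cell, so the
  kernel contains \<open>I(R\<^sub>n)\<close>. For equality the cell has to be dense. Each \<open>V\<^sub>i\<^sub>,\<^sub>j\<close> is \<open>V\<^sub>i\<^sub>-\<^sub>1\<^sub>,\<^sub>j\<close> plus the line
  of a vector \<open>y\<^sub>i\<^sub>,\<^sub>j = \<Sum>\<^sub>s\<^sub>\<le>\<^sub>i a\<^sub>s y\<^sub>s\<^sub>,\<^sub>j\<^sub>+\<^sub>1 + b w\<^sub>j\<^sub>+\<^sub>1\<close>, so all points are parametrised by the coefficients \<open>a\<close>, \<open>b\<close>,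
  and the point lies in the cell as soon as all diagonal coefficients \<open>a\<^sub>i\<close> are nonzero. Adding a small \<open>t\<close>
  to them moves any point into the cell (\<open>zero_on_cell_imp_vanishing\<close>).
\<close>

section \<open>Polynomials, derivations and evaluation\<close>

lemma pm_induct [case_names single add]:
  assumes "\<And>t c. P (single t c)" "\<And>p q. P p \<Longrightarrow> P q \<Longrightarrow> P (p + q)"
  shows "P (p :: 'b \<Rightarrow>\<^sub>0 'c::comm_monoid_add)"
proof (induction p rule: update_induct)
  case const
  show ?case using assms(1)[of undefined 0] by simp
next
  case (update f a b)
  have "Poly_Mapping.update a b f = f + single a b"
    using update.hyps by (intro poly_mapping_eqI)
      (auto simp: lookup_update lookup_add lookup_single when_def in_keys_iff)
  then show ?case using assms update by metis
qed

lemma scl_eq_mult: "scl c p = single 0 c * (p :: 'x mpoly)"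
  by (simp add: scl_def mult_map_scale_conv_mult)

lemma scl_single [simp]: "scl c (single t d) = single t (c * d)"
  by (rule poly_mapping_eqI) (simp add: lookup_single when_def)

lemma scl_mult_left: "scl c p * q = scl c (p * q)"
  and scl_mult_right: "p * scl c q = scl c (p * (q :: 'x mpoly))"
  by (simp_all add: scl_eq_mult ac_simps)

lemma keys_scl: "keys (scl c p) \<subseteq> keys p"
  by (auto simp: in_keys_iff)

lemma sum_keys_add:
  fixes h :: "'b \<Rightarrow> complex \<Rightarrow> 'c::comm_monoid_add"
  assumes "\<And>x. h x 0 = 0" "\<And>x c d. h x (c + d) = h x c + h x d"
  shows "(\<Sum>x\<in>keys (a + b). h x (lookup (a + b) x)) =
    (\<Sum>x\<in>keys a. h x (lookup a x)) + (\<Sum>x\<in>keys b. h x (lookup b x))"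
proof -
  have *: "(\<Sum>x\<in>keys a. h x (lookup a x)) = (\<Sum>x\<in>T. h x (lookup a x))"
    if "keys a \<subseteq> T" "finite T" for a T
    using that assms by (intro sum.mono_neutral_left) (auto simp: in_keys_iff)
  have "(\<Sum>x\<in>keys (a + b). h x (lookup (a + b) x)) =
      (\<Sum>x\<in>keys a \<union> keys b. h x (lookup (a + b) x))"
    using keys_add[of a b] by (intro *) auto
  also have "\<dots> = (\<Sum>x\<in>keys a \<union> keys b. h x (lookup a x)) + (\<Sum>x\<in>keys a \<union> keys b. h x (lookup b x))"
    by (simp add: lookup_add assms sum.distrib)
  also have "(\<Sum>x\<in>keys a \<union> keys b. h x (lookup a x)) = (\<Sum>x\<in>keys a. h x (lookup a x))"
    by (rule *[symmetric]) auto
  also have "(\<Sum>x\<in>keys a \<union> keys b. h x (lookup b x)) = (\<Sum>x\<in>keys b. h x (lookup b x))"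
    by (rule *[symmetric]) auto
  finally show ?thesis .
qed

lemma sum_keys_scl:
  fixes h :: "'b \<Rightarrow> complex \<Rightarrow> 'c::comm_monoid_add"
  assumes "\<And>x. h x 0 = 0"
  shows "(\<Sum>x\<in>keys (scl c a). h x (lookup (scl c a) x)) = (\<Sum>x\<in>keys a. h x (c * lookup a x))"
  using assms keys_scl[of c a] by (intro sum.mono_neutral_cong_left) (auto simp: in_keys_iff)

definition lin_val :: "('b \<Rightarrow> complex) \<Rightarrow> ('b \<Rightarrow>\<^sub>0 complex) \<Rightarrow> complex" where
  "lin_val f a = (\<Sum>x\<in>keys a. lookup a x * f x)"

lemma lin_val_add: "lin_val f (a + b) = lin_val f a + lin_val f b"
  and lin_val_scl: "lin_val f (scl c a) = c * lin_val f a"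
  and lin_val_single: "lin_val f (single x c) = c * f x"
  unfolding lin_val_def
    apply (rule sum_keys_add[of "\<lambda>x c. c * f x"]; simp add: distrib_right)
   apply (subst sum_keys_scl[of "\<lambda>x c. c * f x"]; simp add: sum_distrib_left mult.assoc)
  apply simp
  done

lemma lin_val_diff: "lin_val f (a - b) = lin_val f a - lin_val f b"
  using lin_val_add[of f "a - b" b] by simp

lemma lin_val_sum: "lin_val f (\<Sum>i\<in>I. a i) = (\<Sum>i\<in>I. lin_val f (a i))"
  by (induction I rule: infinite_finite_induct) (simp_all add: lin_val_add, simp_all add: lin_val_def)

lemma scl_uminus: "scl (- 1) p = - p"
  by (rule poly_mapping_eqI) simp

lemma pvar_mult_single: "pvar x * single t c = single (single x 1 + t) c"
  by (simp add: pvar_def mult_single)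

text \<open>A monomial is a product of variables; words are easier to induct on than exponents.\<close>

lemma monomial_word:
  assumes "keys t \<subseteq> A"
  obtains ws where "ws \<in> lists A" "single t 1 = prod_list (map pvar ws)"
proof -
  have "keys t \<subseteq> A \<Longrightarrow> \<exists>ws \<in> lists A. single t 1 = prod_list (map pvar ws)"
  proof (induction t rule: update_induct)
    case const
    show ?case by (intro bexI[of _ "[]"]) simp_all
  next
    case (update f a b)
    have k: "keys (Poly_Mapping.update a b f) = insert a (keys f)"
      using update.hyps by (simp add: keys_update)
    then obtain ws where ws: "ws \<in> lists A" "single f 1 = prod_list (map pvar ws)"
      using update by auto
    have e: "Poly_Mapping.update a b f = single a b + f"
      using update.hyps by (intro poly_mapping_eqI)
        (auto simp: lookup_update lookup_add lookup_single when_def in_keys_iff)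
    have p: "pvar a ^ c = single (single a c) 1" for c
      by (induction c) (simp_all add: pvar_def mult_single flip: single_add)
    have "single (Poly_Mapping.update a b f) 1 = pvar a ^ b * single f 1"
      by (simp add: e p mult_single)
    also have "\<dots> = prod_list (map pvar (replicate b a @ ws))"
      by (simp add: ws map_replicate_const prod_list.append)
    finally show ?case
      using k update.prems ws(1) by (intro bexI[of _ "replicate b a @ ws"]) (auto simp: in_lists_conv_set)
  qed
  then show ?thesis using assms that by blast
qed

lemma carrier_poly_alg: "p \<in> carrier (poly_alg A) \<longleftrightarrow> (\<forall>t\<in>keys p. keys t \<subseteq> A)"
  by (auto simp: poly_alg_def free_space_def)

lemma poly_alg_simps [simp]:
  "x \<oplus>\<^bsub>poly_alg A\<^esub> y = x + y" "x \<otimes>\<^bsub>poly_alg A\<^esub> y = x * y" "\<zero>\<^bsub>poly_alg A\<^esub> = 0"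
  "\<one>\<^bsub>poly_alg A\<^esub> = 1" "c \<odot>\<^bsub>poly_alg A\<^esub> x = scl c x"
  by (simp_all add: poly_alg_def free_space_def)

lemma poly_alg_closed:
  "0 \<in> carrier (poly_alg A)" "1 \<in> carrier (poly_alg A)"
  "p \<in> carrier (poly_alg A) \<Longrightarrow> q \<in> carrier (poly_alg A) \<Longrightarrow> p + q \<in> carrier (poly_alg A)"
  "p \<in> carrier (poly_alg A) \<Longrightarrow> q \<in> carrier (poly_alg A) \<Longrightarrow> p * q \<in> carrier (poly_alg A)"
  "p \<in> carrier (poly_alg A) \<Longrightarrow> scl c p \<in> carrier (poly_alg A)"
  "x \<in> A \<Longrightarrow> pvar x \<in> carrier (poly_alg A)"
  "keys t \<subseteq> A \<Longrightarrow> single t c \<in> carrier (poly_alg A)"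
proof -
  show "p + q \<in> carrier (poly_alg A)" if "p \<in> carrier (poly_alg A)" "q \<in> carrier (poly_alg A)"
    using that keys_add[of p q] unfolding carrier_poly_alg by blast
  show "p * q \<in> carrier (poly_alg A)" if "p \<in> carrier (poly_alg A)" "q \<in> carrier (poly_alg A)"
    unfolding carrier_poly_alg
  proof
    fix t assume "t \<in> keys (p * q)"
    then obtain a b where "t = a + b" "a \<in> keys p" "b \<in> keys q" using keys_mult[of p q] by blast
    then show "keys t \<subseteq> A" using that keys_add[of a b] unfolding carrier_poly_alg by blast
  qed
  show "scl c p \<in> carrier (poly_alg A)" if "p \<in> carrier (poly_alg A)"
    using that keys_scl[of c p] unfolding carrier_poly_alg by blast
qed (auto simp: carrier_poly_alg pvar_def)

lemma poly_alg_subspace: "pm.subspace (carrier (poly_alg A))"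
  by (simp add: pm.subspace_def poly_alg_closed)

lemma poly_alg_uminus: "p \<in> carrier (poly_alg A) \<Longrightarrow> - p \<in> carrier (poly_alg A)"
  using poly_alg_closed(5)[of p A "-1"] by (simp add: scl_uminus)

lemma cring_poly_alg: "cring (poly_alg A)"
proof (rule cringI)
  show "abelian_group (poly_alg A)"
  proof (rule abelian_groupI)
    fix x assume "x \<in> carrier (poly_alg A)"
    then show "\<exists>y\<in>carrier (poly_alg A). y \<oplus>\<^bsub>poly_alg A\<^esub> x = \<zero>\<^bsub>poly_alg A\<^esub>"
      by (intro bexI[of _ "- x"]) (auto intro: poly_alg_uminus)
  qed (auto simp: poly_alg_closed algebra_simps)
  show "comm_monoid (poly_alg A)"
    by (rule comm_monoidI) (auto simp: poly_alg_closed algebra_simps)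
qed (auto simp: algebra_simps)

text \<open>An algebra-style induction: two maps out of a polynomial algebra can be compared without touching
  coefficients.\<close>

lemma mpoly_induct [consumes 1, case_names one pvar add scl]:
  assumes p: "p \<in> carrier (poly_alg A)"
    and 1: "P 1"
    and x: "\<And>x q. x \<in> A \<Longrightarrow> q \<in> carrier (poly_alg A) \<Longrightarrow> P q \<Longrightarrow> P (pvar x * q)"
    and add: "\<And>q r. q \<in> carrier (poly_alg A) \<Longrightarrow> r \<in> carrier (poly_alg A) \<Longrightarrow> P q \<Longrightarrow> P r \<Longrightarrow> P (q + r)"
    and scl: "\<And>c q. q \<in> carrier (poly_alg A) \<Longrightarrow> P q \<Longrightarrow> P (scl c q)"
  shows "P p"
proof -
  have w: "prod_list (map pvar ws) \<in> carrier (poly_alg A) \<and> P (prod_list (map pvar ws))"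
    if "ws \<in> lists A" for ws using that
    by (induction ws) (auto intro: 1 x poly_alg_closed)
  have s: "P (single t c)" if t: "keys t \<subseteq> A" for t c
  proof -
    obtain ws where "ws \<in> lists A" "single t 1 = prod_list (map pvar ws)"
      using monomial_word[OF t] by metis
    then have "P (scl c (single t 1))" using w scl by auto
    then show ?thesis by simp
  qed
  have "(\<forall>t\<in>keys p. keys t \<subseteq> A) \<Longrightarrow> P p"
  proof (induction p rule: update_induct)
    case const
    show ?case using s[of 0 0] by simp
  next
    case (update f a b)
    have "Poly_Mapping.update a b f = single a b + f"
      using update.hyps by (intro poly_mapping_eqI)
        (auto simp: lookup_update lookup_add lookup_single when_def in_keys_iff)
    moreover have "keys (Poly_Mapping.update a b f) = insert a (keys f)"
      using update.hyps by (simp add: keys_update)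
    ultimately show ?case using update s[of a b]
      by (auto intro!: add simp: carrier_poly_alg split: if_splits)
  qed
  then show ?thesis using p by (simp add: carrier_poly_alg)
qed

lemma monom_minus_add: "lookup s x \<noteq> 0 \<Longrightarrow> s - single x (1::nat) + single x 1 = s"
  by (rule poly_mapping_eqI) (auto simp: lookup_minus lookup_add lookup_single when_def)

lemma lookup_pdiff:
  "lookup (pdiff x p) t = of_nat (lookup t x + 1) * lookup p (t + single x 1)"
proof -
  have "lookup (pdiff x p) t =
      (\<Sum>s\<in>keys p. if s = t + single x 1 then of_nat (lookup t x + 1) * lookup p s else 0)"
    unfolding pdiff_def lookup_sum
  proof (rule sum.cong[OF refl])
    fix s
    consider "s = t + single x 1" | "s \<noteq> t + single x 1" "lookup s x = 0"
      | "s \<noteq> t + single x 1" "lookup s x \<noteq> 0" by blast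
    then show "lookup (single (s - single x 1) (of_nat (lookup s x) * lookup p s)) t =
        (if s = t + single x 1 then of_nat (lookup t x + 1) * lookup p s else 0)"
    proof cases
      case 1
      then have "s - single x 1 = t" by simp
      with 1 show ?thesis by (simp add: lookup_add)
    next
      case 3
      then have "s - single x 1 \<noteq> t" using monom_minus_add[of s x] by metis
      with 3 show ?thesis by (simp add: lookup_single_not_eq)
    qed simp
  qed
  also have "\<dots> = of_nat (lookup t x + 1) * lookup p (t + single x 1)"
    by (simp add: sum.delta' in_keys_iff)
  finally show ?thesis .
qed

lemma pdiff_add: "pdiff x (p + q) = pdiff x p + pdiff x q"
  and pdiff_scl: "pdiff x (scl c p) = scl c (pdiff x p)"
  and pdiff_0 [simp]: "pdiff x 0 = 0"
  and pdiff_1 [simp]: "pdiff x 1 = 0"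
  by (rule poly_mapping_eqI; auto simp: lookup_pdiff lookup_add algebra_simps lookup_one when_def
      dest: arg_cong[where f="\<lambda>t. lookup t x"])+

lemma pdiff_minus: "pdiff x (- p) = - pdiff x p"
  using pdiff_scl[of x "-1" p] by (simp add: scl_uminus)

lemma pdiff_sum: "pdiff x (\<Sum>i\<in>I. p i) = (\<Sum>i\<in>I. pdiff x (p i))"
  by (induction I rule: infinite_finite_induct) (simp_all add: pdiff_add)

lemma pdiff_single: "pdiff x (single s a) = single (s - single x 1) (of_nat (lookup s x) * a)"
  by (simp add: pdiff_def)

lemma pdiff_mult: "pdiff x (p * q) = pdiff x p * q + p * pdiff x q"
proof (induction p rule: pm_induct)
  case (single s a)
  show ?case
  proof (induction q rule: pm_induct)
    case (single t b)
    have 1: "(s + t) - single x 1 = (s - single x 1) + t" if "lookup s x \<noteq> 0" for s t :: "'a \<Rightarrow>\<^sub>0 nat"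
      using that by (intro poly_mapping_eqI) (auto simp: lookup_minus lookup_add lookup_single when_def)
    have 2: "s + t - single x 1 = s + (t - single x 1)" if "lookup t x \<noteq> 0"
      using 1[OF that, of s] by (simp add: ac_simps)
    have 3: "t + (s - single x 1) = s + (t - single x 1)" if "lookup s x \<noteq> 0" "lookup t x \<noteq> 0"
      using 1[OF that(1), of t] 2[OF that(2)] by (simp add: ac_simps)
    show ?case
      by (cases "lookup s x = 0"; cases "lookup t x = 0")
        (simp_all add: pdiff_single mult_single lookup_add 1 2 3 algebra_simps del: One_nat_def flip: single_add)
  qed (simp add: pdiff_add algebra_simps)
qed (simp add: pdiff_add algebra_simps)

lemma pdiff_pvar: "pdiff x (pvar y) = (if x = y then 1 else 0)"
  by (auto simp: pvar_def pdiff_single lookup_single)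

lemma pdiff_closed: "p \<in> carrier (poly_alg A) \<Longrightarrow> pdiff x p \<in> carrier (poly_alg A)"
  unfolding carrier_poly_alg
  by (fastforce simp: in_keys_iff lookup_pdiff lookup_add subset_iff)

lemma pdiff_prod:
  assumes "finite K"
  shows "pdiff x (\<Prod>k\<in>K. g k) = (\<Sum>k\<in>K. \<Prod>l\<in>K. (g(k := pdiff x (g k))) l)"
  using assms
proof (induction K)
  case (insert a K)
  have *: "(\<Prod>l\<in>K. (g(a := v)) l) = prod g K" for v
    using insert by (intro prod.cong) auto
  have **: "(\<Prod>l\<in>insert a K. (g(k := v)) l) = g a * (\<Prod>l\<in>K. (g(k := v)) l)" if "k \<in> K" for k v
    using that insert by auto
  have "(\<Sum>k\<in>insert a K. \<Prod>l\<in>insert a K. (g(k := pdiff x (g k))) l) =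
    pdiff x (g a) * prod g K + (\<Sum>k\<in>K. g a * (\<Prod>l\<in>K. (g(k := pdiff x (g k))) l))"
    using insert * ** by (simp cong: sum.cong del: fun_upd_apply prod.insert)
      (simp add: *)
  then show ?case using insert by (simp add: pdiff_mult sum_distrib_left del: fun_upd_apply)
qed simp

subsection \<open>Evaluation\<close>

text \<open>Evaluation in an arbitrary commutative ring, along the ring homomorphism \<open>h\<close> on coefficients: it is
  needed at complex points, at polynomials, and at polynomials over polynomials.\<close>

definition insertion :: "(complex \<Rightarrow> 'r::comm_ring_1) \<Rightarrow> ('x \<Rightarrow> 'r) \<Rightarrow> 'x mpoly \<Rightarrow> 'r" where
  "insertion h P F = (\<Sum>t\<in>keys F. h (lookup F t) * (\<Prod>x\<in>keys t. P x ^ lookup t x))"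

lemma peval_insertion: "peval P F = insertion (\<lambda>a. a) P F"
  by (simp add: peval_def insertion_def)

context
  fixes h :: "complex \<Rightarrow> 'r::comm_ring_1" and P :: "'x \<Rightarrow> 'r"
  assumes h: "comm_ring_hom h"
begin

interpretation comm_ring_hom h by (fact h)

lemma insertion_single:
  "insertion h P (single t c) = h c * (\<Prod>x\<in>keys t. P x ^ lookup t x)"
  by (simp add: insertion_def)

lemma insertion_add: "insertion h P (F + G) = insertion h P F + insertion h P G"
  unfolding insertion_def
  by (rule sum_keys_add[of "\<lambda>t c. h c * (\<Prod>x\<in>keys t. P x ^ lookup t x)"])
    (simp_all add: hom_distribs distrib_right)

lemma insertion_mult: "insertion h P (F * G) = insertion h P F * insertion h P G"
proof (induction F rule: pm_induct)
  case (single s a)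
  show ?case
  proof (induction G rule: pm_induct)
    case (single t b)
    have *: "(\<Prod>x\<in>keys t. P x ^ lookup t x) = (\<Prod>x\<in>T. P x ^ lookup t x)"
      if "keys t \<subseteq> T" "finite T" for t T
      using that by (intro prod.mono_neutral_left) (auto simp: in_keys_iff)
    have "(\<Prod>x\<in>keys (s + t). P x ^ lookup (s + t) x) =
        (\<Prod>x\<in>keys s \<union> keys t. P x ^ lookup (s + t) x)"
      using keys_add[of s t] by (rule *) simp
    also have "\<dots> = (\<Prod>x\<in>keys s \<union> keys t. P x ^ lookup s x) *
        (\<Prod>x\<in>keys s \<union> keys t. P x ^ lookup t x)"
      by (simp add: lookup_add power_add prod.distrib)
    also have "(\<Prod>x\<in>keys s \<union> keys t. P x ^ lookup s x) = (\<Prod>x\<in>keys s. P x ^ lookup s x)"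
      by (rule *[symmetric]) auto
    also have "(\<Prod>x\<in>keys s \<union> keys t. P x ^ lookup t x) = (\<Prod>x\<in>keys t. P x ^ lookup t x)"
      by (rule *[symmetric]) auto
    finally show ?case by (simp add: mult_single insertion_single hom_distribs)
  qed (simp add: insertion_add algebra_simps)
qed (simp add: insertion_add algebra_simps)

lemma insertion_hom: "comm_ring_hom (insertion h P)"
  by unfold_locales
    (simp_all add: insertion_add insertion_mult insertion_single[of 0 0, simplified]
      insertion_single[of 0 1, simplified])

lemma insertion_pvar [simp]: "insertion h P (pvar x) = P x"
  by (simp add: pvar_def insertion_single)

lemma insertion_scl: "insertion h P (scl c F) = h c * insertion h P F"
  by (simp add: scl_eq_mult insertion_mult insertion_single)

end

lemma comm_ring_hom_id: "comm_ring_hom (\<lambda>a::complex. a)"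
  by unfold_locales auto

lemma peval_hom: "comm_ring_hom (peval P)"
  using insertion_hom[OF comm_ring_hom_id, of P] by (simp add: peval_insertion[abs_def])

lemma peval_simps [simp]:
  "peval P (F + G) = peval P F + peval P G" "peval P (F * G) = peval P F * peval P G"
  "peval P (pvar x) = P x" "peval P (scl c F) = c * peval P F" "peval P 1 = 1" "peval P 0 = 0"
proof -
  interpret comm_ring_hom "peval P" by (rule peval_hom)
  show "peval P (F + G) = peval P F + peval P G" "peval P (F * G) = peval P F * peval P G"
    "peval P 1 = 1" "peval P 0 = 0" by (simp_all add: hom_distribs)
  show "peval P (pvar x) = P x" "peval P (scl c F) = c * peval P F"
    using insertion_pvar[OF comm_ring_hom_id] insertion_scl[OF comm_ring_hom_id]
    by (simp_all add: peval_insertion)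
qed

lemma peval_at_zero: "peval (\<lambda>_. 0) q = lookup q 0"
proof -
  have "q \<in> carrier (poly_alg UNIV)" by (simp add: carrier_poly_alg)
  then show ?thesis
  proof (induction q rule: mpoly_induct)
    case (pvar x q)
    have "lookup (pvar x * q) 0 = 0"
      using keys_mult[of "pvar x" q]
      by (force simp: pvar_def in_keys_iff dest: arg_cong[where f="\<lambda>t. lookup t x"] simp: lookup_add)
    then show ?case by simp
  qed (simp_all add: lookup_add)
qed

lemma const_hom: "comm_ring_hom (\<lambda>q :: 'x mpoly. lookup q 0)"
proof -
  have "peval (\<lambda>_. 0) = (\<lambda>q :: 'x mpoly. lookup q 0)" by (rule ext) (rule peval_at_zero)
  then show ?thesis using peval_hom[of "\<lambda>_ :: 'x. 0"] by simp
qed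

subsection \<open>Iterated derivatives\<close>

text \<open>Derivatives are indexed by words and not by exponents: no multinomial coefficients occur then, and
  nothing has to commute.\<close>

primrec dword :: "'x list \<Rightarrow> 'x mpoly \<Rightarrow> 'x mpoly" where
  "dword [] g = g"
| "dword (x # ws) g = dword ws (pdiff x g)"

lemma dword_add: "dword ws (p + q) = dword ws p + dword ws q"
  and dword_scl: "dword ws (scl c p) = scl c (dword ws p)"
  by (induction ws arbitrary: p q) (simp_all add: pdiff_add pdiff_scl)

lemma dword_0 [simp]: "dword ws 0 = 0"
  by (induction ws) simp_all

lemma dword_sum: "dword ws (\<Sum>i\<in>I. p i) = (\<Sum>i\<in>I. dword ws (p i))"
  by (induction I rule: infinite_finite_induct) (simp_all add: dword_add)

definition mfact :: "('x \<Rightarrow>\<^sub>0 nat) \<Rightarrow> complex" where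
  "mfact t = (\<Prod>x\<in>keys t. fact (lookup t x))"

lemma mfact_nonzero: "mfact t \<noteq> 0"
  by (simp add: mfact_def)

lemma mfact_Suc: "mfact (t + single x 1) = of_nat (lookup t x + 1) * mfact t"
proof -
  have *: "mfact t = (\<Prod>x\<in>T. fact (lookup t x))" if "keys t \<subseteq> T" "finite T" for t T
    unfolding mfact_def using that by (intro prod.mono_neutral_left) (auto simp: in_keys_iff)
  have k: "keys (t + single x 1) \<subseteq> insert x (keys t)" using keys_add[of t "single x 1"] by auto
  have "(\<Prod>y\<in>keys t - {x}. fact (lookup (t + single x 1) y)) =
      (\<Prod>y\<in>keys t - {x}. (fact (lookup t y) :: complex))"
    by (rule prod.cong) (auto simp: lookup_add lookup_single)
  then show ?thesis
    using k by (simp add: *[of _ "insert x (keys t)"] prod.insert_remove lookup_add subset_insertI)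
qed

text \<open>The pairing \<open>\<langle>p, g\<rangle>\<close>: the constant term of \<open>p(\<partial>)\<close> applied to \<open>g\<close>.\<close>

definition pairing :: "'x mpoly \<Rightarrow> 'x mpoly \<Rightarrow> complex" where
  "pairing p g = lin_val (\<lambda>t. mfact t * lookup g t) p"

lemma pairing_single: "pairing (single t c) g = c * mfact t * lookup g t"
  and pairing_add_left: "pairing (p + q) g = pairing p g + pairing q g"
  and pairing_diff_left: "pairing (p - q) g = pairing p g - pairing q g"
  and pairing_scl_left: "pairing (scl c p) g = c * pairing p g"
  and pairing_sum_left: "pairing (\<Sum>i\<in>I. f i) g = (\<Sum>i\<in>I. pairing (f i) g)"
  by (simp_all add: pairing_def lin_val_single lin_val_add lin_val_diff lin_val_scl lin_val_sum)

lemma pairing_add_right: "pairing p (g + h) = pairing p g + pairing p h"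
  by (simp add: pairing_def lin_val_def lookup_add algebra_simps sum.distrib)

lemma pairing_0 [simp]: "pairing p 0 = 0" "pairing 0 g = 0"
  by (simp_all add: pairing_def lin_val_def)

lemma pairing_1 [simp]: "pairing 1 g = lookup g 0"
  using pairing_single[of 0 1 g] by (simp add: mfact_def)

lemma pairing_pvar: "pairing (pvar x * p) g = pairing p (pdiff x g)"
proof (induction p rule: pm_induct)
  case (single t c)
  show ?case
    using mfact_Suc[of t x]
    by (simp add: pvar_mult_single pairing_single lookup_pdiff add.commute algebra_simps)
qed (simp add: distrib_left pairing_add_left)

lemma pairing_word: "pairing (prod_list (map pvar ws) * p) g = pairing p (dword ws g)"
  by (induction ws arbitrary: g) (simp_all add: pairing_pvar mult.assoc)

lemma dword_const: "lookup (dword ws g) 0 = pairing (prod_list (map pvar ws)) g"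
  using pairing_word[of ws 1 g] by simp

text \<open>The coefficient at an exponent \<open>t\<close> is the constant term of the derivative along \<open>t\<close> divided by
  \<open>t!\<close>, which is invertible in characteristic zero.\<close>

lemma dword_const_zero_imp_zero:
  assumes "g \<in> carrier (poly_alg A)" "\<And>ws. ws \<in> lists A \<Longrightarrow> lookup (dword ws g) 0 = 0"
  shows "g = 0"
proof (rule poly_mapping_eqI)
  fix t
  show "lookup g t = lookup 0 t"
  proof (cases "t \<in> keys g")
    case True
    then have "keys t \<subseteq> A" using assms by (simp add: carrier_poly_alg)
    then obtain ws where "ws \<in> lists A" "single t 1 = prod_list (map pvar ws)"
      using monomial_word by metis
    then have "pairing (single t 1) g = 0" using assms(2) dword_const by metis
    then show ?thesis by (simp add: pairing_single mfact_nonzero)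
  qed (simp add: in_keys_iff)
qed

lemma peval_has_derivative:
  "((\<lambda>s. peval (c(x := s)) g) has_field_derivative peval c (pdiff x g)) (at (c x))"
proof -
  have "g \<in> carrier (poly_alg UNIV)" by (simp add: carrier_poly_alg)
  then show ?thesis
  proof (induction g rule: mpoly_induct)
    case (pvar y q)
    have 1: "((\<lambda>s. (c(x := s)) y) has_field_derivative (if x = y then 1 else 0)) (at (c x))"
      by (cases "x = y") (auto intro!: derivative_eq_intros)
    show ?case
      using DERIV_mult[OF 1 pvar(3)] unfolding peval_simps pdiff_mult
      by (rule DERIV_cong) (simp add: pdiff_pvar)
  qed (auto intro!: derivative_eq_intros simp: pdiff_add pdiff_scl simp del: fun_upd_apply)
qed

text \<open>If a polynomial function vanishes, so do its partial derivatives of all orders, and these at \<open>0\<close> give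
  the coefficients.\<close>

lemma peval_eq_0_imp_zero:
  assumes "\<And>c. peval c g = 0"
  shows "g = 0"
proof (rule dword_const_zero_imp_zero)
  show "g \<in> carrier (poly_alg UNIV)" by (simp add: carrier_poly_alg)
next
  fix ws :: "'a list"
  have "\<forall>c. peval c (dword ws g) = 0" using assms
  proof (induction ws arbitrary: g)
    case (Cons x ws)
    have "peval c (pdiff x g) = 0" for c
      using peval_has_derivative[of c x g] DERIV_unique[OF _ DERIV_const[of 0]]
      by (simp add: Cons.prems)
    then show ?case using Cons.IH by simp
  qed simp
  then have "peval (\<lambda>_. 0) (dword ws g) = 0" by blast
  then show "lookup (dword ws g) 0 = 0" by (simp add: peval_at_zero)
qed

section \<open>Modules over the complex numbers, functionals and symbols\<close>

lemma cplx_simps [simp]: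
  "carrier cplx = UNIV" "x \<oplus>\<^bsub>cplx\<^esub> y = x + y" "x \<otimes>\<^bsub>cplx\<^esub> y = x * y" "\<zero>\<^bsub>cplx\<^esub> = 0" "\<one>\<^bsub>cplx\<^esub> = 1"
  "c \<odot>\<^bsub>cplx\<^esub> x = c * x"
  by (simp_all add: cplx_def)

lemma cring_cplx: "cring cplx"
proof (rule cringI)
  show "abelian_group cplx"
  proof (rule abelian_groupI)
    fix x :: complex
    show "\<exists>y\<in>carrier cplx. y \<oplus>\<^bsub>cplx\<^esub> x = \<zero>\<^bsub>cplx\<^esub>" by (intro bexI[of _ "- x"]) auto
  qed auto
  show "comm_monoid cplx" by (rule comm_monoidI) auto
qed (auto simp: algebra_simps)

lemma cplx_moduleI:
  assumes "\<And>x y. x \<in> carrier M \<Longrightarrow> y \<in> carrier M \<Longrightarrow> x \<oplus>\<^bsub>M\<^esub> y \<in> carrier M"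
    "\<zero>\<^bsub>M\<^esub> \<in> carrier M"
    "\<And>x y z. x \<in> carrier M \<Longrightarrow> y \<in> carrier M \<Longrightarrow> z \<in> carrier M \<Longrightarrow>
      (x \<oplus>\<^bsub>M\<^esub> y) \<oplus>\<^bsub>M\<^esub> z = x \<oplus>\<^bsub>M\<^esub> (y \<oplus>\<^bsub>M\<^esub> z)"
    "\<And>x y. x \<in> carrier M \<Longrightarrow> y \<in> carrier M \<Longrightarrow> x \<oplus>\<^bsub>M\<^esub> y = y \<oplus>\<^bsub>M\<^esub> x"
    "\<And>x. x \<in> carrier M \<Longrightarrow> \<zero>\<^bsub>M\<^esub> \<oplus>\<^bsub>M\<^esub> x = x"
    "\<And>c x. x \<in> carrier M \<Longrightarrow> c \<odot>\<^bsub>M\<^esub> x \<in> carrier M"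
    "\<And>x. x \<in> carrier M \<Longrightarrow> (-1) \<odot>\<^bsub>M\<^esub> x \<oplus>\<^bsub>M\<^esub> x = \<zero>\<^bsub>M\<^esub>"
    "\<And>a b x. x \<in> carrier M \<Longrightarrow> (a + b) \<odot>\<^bsub>M\<^esub> x = a \<odot>\<^bsub>M\<^esub> x \<oplus>\<^bsub>M\<^esub> b \<odot>\<^bsub>M\<^esub> x"
    "\<And>a x y. x \<in> carrier M \<Longrightarrow> y \<in> carrier M \<Longrightarrow> a \<odot>\<^bsub>M\<^esub> (x \<oplus>\<^bsub>M\<^esub> y) = a \<odot>\<^bsub>M\<^esub> x \<oplus>\<^bsub>M\<^esub> a \<odot>\<^bsub>M\<^esub> y"
    "\<And>a b x. x \<in> carrier M \<Longrightarrow> (a * b) \<odot>\<^bsub>M\<^esub> x = a \<odot>\<^bsub>M\<^esub> (b \<odot>\<^bsub>M\<^esub> x)"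
    "\<And>x. x \<in> carrier M \<Longrightarrow> 1 \<odot>\<^bsub>M\<^esub> x = x"
  shows "module cplx M"
proof (rule moduleI)
  show "abelian_group M"
  proof (rule abelian_groupI)
    fix x assume x: "x \<in> carrier M"
    show "\<exists>y\<in>carrier M. y \<oplus>\<^bsub>M\<^esub> x = \<zero>\<^bsub>M\<^esub>"
      by (rule bexI[where x="(-1) \<odot>\<^bsub>M\<^esub> x"]) (fact assms(7)[OF x], fact assms(6)[OF x])
  qed (fact assms)+
qed (simp_all only: cplx_simps cring_cplx assms)

lemma cplx_smult:
  assumes "module cplx M" "x \<in> carrier M"
  shows "0 \<odot>\<^bsub>M\<^esub> x = \<zero>\<^bsub>M\<^esub>" "1 \<odot>\<^bsub>M\<^esub> x = x" "(-1) \<odot>\<^bsub>M\<^esub> x = \<ominus>\<^bsub>M\<^esub> x"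
proof -
  interpret module cplx M by fact
  show "0 \<odot>\<^bsub>M\<^esub> x = \<zero>\<^bsub>M\<^esub>" and 1: "1 \<odot>\<^bsub>M\<^esub> x = x"
    using smult_l_null[OF assms(2)] smult_one[OF assms(2)] by simp_all
  have "\<ominus>\<^bsub>cplx\<^esub> 1 = -1" using R.minus_equality[of "-1" 1] by simp
  then show "(-1) \<odot>\<^bsub>M\<^esub> x = \<ominus>\<^bsub>M\<^esub> x"
    using smult_l_minus[of 1 x] assms(2) 1 by simp
qed

lemma linear_mapsD:
  assumes "g \<in> linear_maps M N"
  shows "x \<in> carrier M \<Longrightarrow> g x \<in> carrier N"
    "x \<in> carrier M \<Longrightarrow> y \<in> carrier M \<Longrightarrow> g (x \<oplus>\<^bsub>M\<^esub> y) = g x \<oplus>\<^bsub>N\<^esub> g y"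
    "x \<in> carrier M \<Longrightarrow> g (c \<odot>\<^bsub>M\<^esub> x) = c \<odot>\<^bsub>N\<^esub> g x"
    "x \<notin> carrier M \<Longrightarrow> g x = undefined"
  using assms by (auto simp: linear_maps_def)

lemma dualD:
  assumes "\<phi> \<in> dual M"
  shows "x \<in> carrier M \<Longrightarrow> y \<in> carrier M \<Longrightarrow> \<phi> (x \<oplus>\<^bsub>M\<^esub> y) = \<phi> x + \<phi> y"
    "x \<in> carrier M \<Longrightarrow> \<phi> (c \<odot>\<^bsub>M\<^esub> x) = c * \<phi> x"
    "x \<notin> carrier M \<Longrightarrow> \<phi> x = undefined"
  using linear_mapsD[OF assms] by simp_all

lemma dual_eqI:
  assumes "\<phi> \<in> dual M" "\<psi> \<in> dual M" "\<And>x. x \<in> carrier M \<Longrightarrow> \<phi> x = \<psi> x"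
  shows "\<phi> = \<psi>"
  using assms dualD(3) by (metis ext)

lemma dualI:
  assumes "module cplx M"
    "\<And>x y. x \<in> carrier M \<Longrightarrow> y \<in> carrier M \<Longrightarrow> f (x \<oplus>\<^bsub>M\<^esub> y) = f x + f y"
    "\<And>c x. x \<in> carrier M \<Longrightarrow> f (c \<odot>\<^bsub>M\<^esub> x) = c * f x"
  shows "restrict f (carrier M) \<in> dual M"
proof -
  interpret module cplx M by fact
  show ?thesis using assms by (auto simp: linear_maps_def)
qed

lemma dual_lincomb:
  assumes "module cplx M" "\<phi> \<in> dual M" "\<psi> \<in> dual M"
  shows "(\<lambda>x\<in>carrier M. a * \<phi> x + b * \<psi> x) \<in> dual M"
  by (rule dualI) (simp_all add: assms dualD[OF assms(2)] dualD[OF assms(3)] algebra_simps)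

lemma dual_zero:
  assumes "module cplx M" shows "(\<lambda>x\<in>carrier M. 0) \<in> dual M"
  by (rule dualI) (use assms in auto)

lemma dual_at_zero:
  assumes "module cplx M" "\<phi> \<in> dual M"
  shows "\<phi> \<zero>\<^bsub>M\<^esub> = 0"
proof -
  interpret module cplx M by fact
  have "\<phi> (0 \<odot>\<^bsub>M\<^esub> \<zero>\<^bsub>M\<^esub>) = 0" using assms(2) by (subst dualD(2)) auto
  then show ?thesis by simp
qed

lemma dual_finsum:
  assumes "module cplx M" "\<phi> \<in> dual M" "finite A" "A \<subseteq> carrier M"
  shows "\<phi> (finsum M (\<lambda>e. c e \<odot>\<^bsub>M\<^esub> e) A) = (\<Sum>e\<in>A. c e * \<phi> e)"
proof -
  interpret module cplx M by fact
  show ?thesis using assms(3,4)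
  proof (induction A)
    case empty show ?case using dual_at_zero assms by simp
  next
    case (insert e A)
    have "finsum M (\<lambda>e. c e \<odot>\<^bsub>M\<^esub> e) (insert e A) =
        c e \<odot>\<^bsub>M\<^esub> e \<oplus>\<^bsub>M\<^esub> finsum M (\<lambda>e. c e \<odot>\<^bsub>M\<^esub> e) A"
      using insert by (intro finsum_insert) auto
    moreover have "finsum M (\<lambda>e. c e \<odot>\<^bsub>M\<^esub> e) A \<in> carrier M"
      using insert by (intro finsum_closed) auto
    ultimately show ?case using insert assms(2) by (simp add: dualD)
  qed
qed

text \<open>Separation is stated for pairs of points, so that no subtraction in \<open>M\<close> has to be written.\<close>

definition separates :: "('v \<Rightarrow> complex) set \<Rightarrow> (complex, 'v, 'r) module_scheme \<Rightarrow> bool" where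
  "separates \<Psi> M \<longleftrightarrow> (\<forall>x\<in>carrier M. \<forall>y\<in>carrier M. (\<forall>\<phi>\<in>\<Psi>. \<phi> x = \<phi> y) \<longrightarrow> x = y)"

lemma separatesD:
  "separates \<Psi> M \<Longrightarrow> x \<in> carrier M \<Longrightarrow> y \<in> carrier M \<Longrightarrow> (\<And>\<phi>. \<phi> \<in> \<Psi> \<Longrightarrow> \<phi> x = \<phi> y) \<Longrightarrow> x = y"
  by (auto simp: separates_def)

definition dual_basis ::
  "(complex, 'v, 'r) module_scheme \<Rightarrow> 'v set \<Rightarrow> ('v \<Rightarrow> 'v \<Rightarrow> complex) \<Rightarrow> bool" where
  "dual_basis M E \<epsilon> \<longleftrightarrow> finite E \<and> E \<subseteq> carrier M \<and> (\<forall>e\<in>E. \<epsilon> e \<in> dual M) \<and>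
     (\<forall>e\<in>E. \<forall>e'\<in>E. \<epsilon> e e' = (if e = e' then 1 else 0)) \<and>
     (\<forall>x\<in>carrier M. x = finsum M (\<lambda>e. \<epsilon> e x \<odot>\<^bsub>M\<^esub> e) E)"

text \<open>Gaussian elimination, one functional of \<open>\<Psi>\<close> at a time: if \<open>\<psi>\<close> is not yet a combination of the
  \<open>\<epsilon> e\<close>, then its residue \<open>\<rho>\<close> is nonzero somewhere, and the vector where this happens, corrected by the
  old basis, is the new basis vector. The functionals stay inside any subspace \<open>D\<close> containing \<open>\<Psi>\<close>, and
  the last conclusion shows that \<open>D\<close> is the whole dual.\<close>

lemma exists_dual_basis:
  assumes M: "module cplx M" and fin: "finite \<Psi>" and sub: "\<Psi> \<subseteq> D" "D \<subseteq> dual M"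
    and sep: "separates \<Psi> M"
    and D0: "(\<lambda>x\<in>carrier M. 0) \<in> D"
    and D: "\<And>\<phi> \<psi> a b. \<phi> \<in> D \<Longrightarrow> \<psi> \<in> D \<Longrightarrow> (\<lambda>x\<in>carrier M. a * \<phi> x + b * \<psi> x) \<in> D"
  obtains E \<epsilon> where "dual_basis M E \<epsilon>" "\<And>e. e \<in> E \<Longrightarrow> \<epsilon> e \<in> D"
    "\<And>\<phi> x. \<phi> \<in> dual M \<Longrightarrow> x \<in> carrier M \<Longrightarrow> \<phi> x = (\<Sum>e\<in>E. \<epsilon> e x * \<phi> e)"
proof -
  interpret module cplx M by fact
  have Dsum: "(\<lambda>x\<in>carrier M. \<Sum>i\<in>I. c i * f i x) \<in> D" if "finite I" "\<And>i. i \<in> I \<Longrightarrow> f i \<in> D"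
    for I and c :: "'a \<Rightarrow> complex" and f
    using that
  proof (induction I)
    case empty show ?case using D0 by (simp del: restrict_apply)
  next
    case (insert i I)
    have "(\<lambda>x\<in>carrier M. \<Sum>i\<in>insert i I. c i * f i x) =
        (\<lambda>x\<in>carrier M. c i * f i x + 1 * (\<lambda>x\<in>carrier M. \<Sum>i\<in>I. c i * f i x) x)"
      using insert by (auto simp: fun_eq_iff)
    then show ?case using insert by (simp only:) (intro D, auto)
  qed
  have "\<exists>E \<epsilon>. finite E \<and> E \<subseteq> carrier M \<and> (\<forall>e\<in>E. \<epsilon> e \<in> D) \<and>
     (\<forall>e\<in>E. \<forall>e'\<in>E. \<epsilon> e e' = (if e = e' then 1 else 0)) \<and>
     (\<forall>\<psi>\<in>\<Psi>. \<forall>x\<in>carrier M. \<psi> x = (\<Sum>e\<in>E. \<epsilon> e x * \<psi> e))"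
    using fin sub(1)
  proof (induction \<Psi>)
    case empty
    show ?case by (intro exI[of _ "{}"]) auto
  next
    case (insert \<psi> \<Psi>)
    then have "\<Psi> \<subseteq> D" by simp
    from insert.IH[OF this] obtain E \<epsilon> where E0: "finite E \<and> E \<subseteq> carrier M \<and> (\<forall>e\<in>E. \<epsilon> e \<in> D) \<and>
      (\<forall>e\<in>E. \<forall>e'\<in>E. \<epsilon> e e' = (if e = e' then 1 else 0)) \<and>
      (\<forall>\<psi>\<in>\<Psi>. \<forall>x\<in>carrier M. \<psi> x = (\<Sum>e\<in>E. \<epsilon> e x * \<psi> e))" by (elim exE)
    have E: "finite E" "E \<subseteq> carrier M" "\<And>e. e \<in> E \<Longrightarrow> \<epsilon> e \<in> D"
      "\<And>e e'. e \<in> E \<Longrightarrow> e' \<in> E \<Longrightarrow> \<epsilon> e e' = (if e = e' then 1 else 0)"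
      "\<And>\<psi> x. \<psi> \<in> \<Psi> \<Longrightarrow> x \<in> carrier M \<Longrightarrow> \<psi> x = (\<Sum>e\<in>E. \<epsilon> e x * \<psi> e)"
      using E0 by blast+
    \<comment> \<open>the part of \<open>\<psi>\<close> that the vectors found so far do not explain\<close>
    define \<rho> where "\<rho> x = \<psi> x - (\<Sum>e\<in>E. \<epsilon> e x * \<psi> e)" for x
    show ?case
    proof (cases "\<forall>x\<in>carrier M. \<rho> x = 0")
      case True
      then have "\<psi> x = (\<Sum>e\<in>E. \<epsilon> e x * \<psi> e)" if "x \<in> carrier M" for x
        using that by (simp add: \<rho>_def)
      then show ?thesis using E by (intro exI[of _ E] exI[of _ \<epsilon>]) auto
    next
      case False
      then obtain x0 where x0: "x0 \<in> carrier M" "\<rho> x0 \<noteq> 0" by auto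
      define y where "y = finsum M (\<lambda>e. (- \<epsilon> e x0) \<odot>\<^bsub>M\<^esub> e) E"
      define b where "b = (1 / \<rho> x0) \<odot>\<^bsub>M\<^esub> (x0 \<oplus>\<^bsub>M\<^esub> y)"
      have y: "y \<in> carrier M" using E unfolding y_def by (intro finsum_closed) auto
      have b: "b \<in> carrier M" using x0 y by (simp add: b_def)
      have at_b: "\<phi> b = (\<phi> x0 - (\<Sum>e\<in>E. \<epsilon> e x0 * \<phi> e)) / \<rho> x0" if "\<phi> \<in> D" for \<phi>
      proof -
        have \<phi>: "\<phi> \<in> dual M" using that sub(2) by auto
        have "\<phi> y = - (\<Sum>e\<in>E. \<epsilon> e x0 * \<phi> e)"
          unfolding y_def using E by (subst dual_finsum[OF M \<phi>]) (auto simp: sum_negf)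
        then show ?thesis using x0 y by (simp add: b_def dualD[OF \<phi>] divide_simps)
      qed
      have eb: "\<epsilon> e b = 0" if "e \<in> E" for e
      proof -
        have "(\<Sum>e'\<in>E. \<epsilon> e' x0 * \<epsilon> e e') = (\<Sum>e'\<in>E. if e' = e then \<epsilon> e x0 else 0)"
          using that by (intro sum.cong) (auto simp: E(4))
        then show ?thesis using that E(1,3) by (simp add: at_b)
      qed
      have pb: "\<psi>' b = 0" if "\<psi>' \<in> \<Psi>" for \<psi>'
        using that E(5)[OF that x0(1)] insert.prems by (subst at_b) auto
      have qb: "\<psi> b = 1"
        using x0 insert.prems by (simp add: at_b \<rho>_def[symmetric])
      have bE: "b \<notin> E" using eb E(4) by fastforce
      have rb: "\<rho> b = 1" using eb qb by (simp add: \<rho>_def)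
      have re: "\<rho> e = 0" if "e \<in> E" for e
      proof -
        have "(\<Sum>e'\<in>E. \<epsilon> e' e * \<psi> e') = (\<Sum>e'\<in>E. if e' = e then \<psi> e else 0)"
          using that by (intro sum.cong) (auto simp: E(4))
        then show ?thesis using that E(1) by (simp add: \<rho>_def)
      qed
      define \<epsilon>' where "\<epsilon>' = \<epsilon>(b := restrict \<rho> (carrier M))"
      have "restrict \<rho> (carrier M) = (\<lambda>x\<in>carrier M. 1 * \<psi> x + (-1) * (\<lambda>x\<in>carrier M. \<Sum>e\<in>E. \<psi> e * \<epsilon> e x) x)"
        by (auto simp: \<rho>_def fun_eq_iff mult.commute)
      also have "\<dots> \<in> D" using insert.prems E by (intro D Dsum) auto
      finally have rD: "restrict \<rho> (carrier M) \<in> D" .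
      have s: "(\<Sum>e\<in>insert b E. \<epsilon>' e x * f e) = (\<Sum>e\<in>E. \<epsilon> e x * f e) + \<rho> x * f b"
        if "x \<in> carrier M" for x f
      proof -
        have "(\<Sum>e\<in>E. \<epsilon>' e x * f e) = (\<Sum>e\<in>E. \<epsilon> e x * f e)"
          using bE by (intro sum.cong) (auto simp: \<epsilon>'_def)
        then show ?thesis using bE E(1) that by (simp add: \<epsilon>'_def)
      qed
      show ?thesis
      proof (intro exI[of _ "insert b E"] exI[of _ \<epsilon>'] conjI ballI)
        fix e assume "e \<in> insert b E" then show "\<epsilon>' e \<in> D" using E rD bE by (auto simp: \<epsilon>'_def)
      next
        fix e e' assume "e \<in> insert b E" "e' \<in> insert b E"
        then show "\<epsilon>' e e' = (if e = e' then 1 else 0)"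
          using E bE b rb re eb by (auto simp: \<epsilon>'_def)
      next
        fix \<psi>' x assume "\<psi>' \<in> insert \<psi> \<Psi>" "x \<in> carrier M"
        then show "\<psi>' x = (\<Sum>e\<in>insert b E. \<epsilon>' e x * \<psi>' e)"
          using s qb pb E(5) by (auto simp: \<rho>_def)
      qed (use E b in auto)
    qed
  qed
  then obtain E \<epsilon> where E0: "finite E \<and> E \<subseteq> carrier M \<and> (\<forall>e\<in>E. \<epsilon> e \<in> D) \<and>
      (\<forall>e\<in>E. \<forall>e'\<in>E. \<epsilon> e e' = (if e = e' then 1 else 0)) \<and>
      (\<forall>\<psi>\<in>\<Psi>. \<forall>x\<in>carrier M. \<psi> x = (\<Sum>e\<in>E. \<epsilon> e x * \<psi> e))" by (elim exE)
  have E: "finite E" "E \<subseteq> carrier M" "\<And>e. e \<in> E \<Longrightarrow> \<epsilon> e \<in> D"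
    "\<And>e e'. e \<in> E \<Longrightarrow> e' \<in> E \<Longrightarrow> \<epsilon> e e' = (if e = e' then 1 else 0)"
    "\<And>\<psi> x. \<psi> \<in> \<Psi> \<Longrightarrow> x \<in> carrier M \<Longrightarrow> \<psi> x = (\<Sum>e\<in>E. \<epsilon> e x * \<psi> e)"
    using E0 by blast+
  have expand: "x = finsum M (\<lambda>e. \<epsilon> e x \<odot>\<^bsub>M\<^esub> e) E" if x: "x \<in> carrier M" for x
  proof (rule separatesD[OF sep x])
    show "finsum M (\<lambda>e. \<epsilon> e x \<odot>\<^bsub>M\<^esub> e) E \<in> carrier M" using E by (intro finsum_closed) auto
    fix \<phi> assume "\<phi> \<in> \<Psi>"
    moreover have "\<phi> \<in> dual M" using \<open>\<phi> \<in> \<Psi>\<close> sub by auto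
    ultimately show "\<phi> x = \<phi> (finsum M (\<lambda>e. \<epsilon> e x \<odot>\<^bsub>M\<^esub> e) E)"
      using E x by (subst dual_finsum[OF M]) auto
  qed
  have db: "dual_basis M E \<epsilon>" using E expand sub unfolding dual_basis_def by blast
  have ex2: "\<phi> x = (\<Sum>e\<in>E. \<epsilon> e x * \<phi> e)" if "\<phi> \<in> dual M" "x \<in> carrier M" for \<phi> x
    using expand[OF that(2)] dual_finsum[OF M that(1) E(1,2)] by metis
  show thesis using that[OF db] E(3) ex2 by blast
qed

subsection \<open>Root modules\<close>

locale root_module = module cplx V for V :: "'v fmodule" (structure) +
  fixes n :: nat
  assumes act_closed: "\<beta> \<in> roots n \<Longrightarrow> x \<in> carrier V \<Longrightarrow> act V \<beta> x \<in> carrier V"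
    and act_add: "\<beta> \<in> roots n \<Longrightarrow> x \<in> carrier V \<Longrightarrow> y \<in> carrier V \<Longrightarrow>
      act V \<beta> (x \<oplus>\<^bsub>V\<^esub> y) = act V \<beta> x \<oplus>\<^bsub>V\<^esub> act V \<beta> y"
    and act_smult: "\<beta> \<in> roots n \<Longrightarrow> x \<in> carrier V \<Longrightarrow> act V \<beta> (c \<odot>\<^bsub>V\<^esub> x) = c \<odot>\<^bsub>V\<^esub> act V \<beta> x"

lemma root_module_module: "root_module V n \<Longrightarrow> module cplx V"
  by (simp add: root_module_def)

text \<open>The first letter of a word acts first, as in \<open>dword\<close>.\<close>

primrec actw :: "'v fmodule \<Rightarrow> (nat \<times> nat) list \<Rightarrow> 'v \<Rightarrow> 'v" where
  "actw V [] v = v"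
| "actw V (\<beta> # ws) v = actw V ws (act V \<beta> v)"

context root_module
begin

lemma actw_closed: "ws \<in> lists (roots n) \<Longrightarrow> x \<in> carrier V \<Longrightarrow> actw V ws x \<in> carrier V"
  by (induction ws arbitrary: x) (auto simp: act_closed)

lemma actw_add: "ws \<in> lists (roots n) \<Longrightarrow> x \<in> carrier V \<Longrightarrow> y \<in> carrier V \<Longrightarrow>
      actw V ws (x \<oplus>\<^bsub>V\<^esub> y) = actw V ws x \<oplus>\<^bsub>V\<^esub> actw V ws y"
  by (induction ws arbitrary: x y) (auto simp: act_closed act_add)

lemma actw_smult: "ws \<in> lists (roots n) \<Longrightarrow> x \<in> carrier V \<Longrightarrow>
      actw V ws (c \<odot>\<^bsub>V\<^esub> x) = c \<odot>\<^bsub>V\<^esub> actw V ws x"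
  by (induction ws arbitrary: x) (auto simp: act_closed act_smult)

end

text \<open>The polynomial \<open>g(c) = \<phi> (exp (\<Sum> c\<^sub>\<beta> f\<^sub>\<beta>) v)\<close>, described by its iterated derivatives at \<open>0\<close>,
  so that no exponential series has to be summed.\<close>

definition is_symbol ::
  "nat \<Rightarrow> 'v fmodule \<Rightarrow> ('v \<Rightarrow> complex) \<Rightarrow> 'v \<Rightarrow> (nat \<times> nat) mpoly \<Rightarrow> bool" where
  "is_symbol n V \<phi> v g \<longleftrightarrow> (\<forall>ws\<in>lists (roots n). \<phi> (actw V ws v) = lookup (dword ws g) 0)"

text \<open>Differentiating the symbol amounts to moving the base vector; this is what makes inductions over
  words work.\<close>

lemma is_symbol_act:
  "is_symbol n V \<phi> v g \<Longrightarrow> \<beta> \<in> roots n \<Longrightarrow> is_symbol n V \<phi> (act V \<beta> v) (pdiff \<beta> g)"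
  unfolding is_symbol_def
proof
  fix ws assume *: "\<forall>ws\<in>lists (roots n). \<phi> (actw V ws v) = lookup (dword ws g) 0"
    "\<beta> \<in> roots n" "ws \<in> lists (roots n)"
  then have "\<phi> (actw V (\<beta> # ws) v) = lookup (dword (\<beta> # ws) g) 0"
    by (intro bspec[OF *(1)]) simp
  then show "\<phi> (actw V ws (act V \<beta> v)) = lookup (dword ws (pdiff \<beta> g)) 0" by simp
qed

lemma is_symbol_const: "is_symbol n V \<phi> v g \<Longrightarrow> \<phi> v = lookup g 0"
  unfolding is_symbol_def by (drule bspec[of _ _ "[]"]) auto

lemma is_symbol_lincomb:
  assumes "root_module V n" "v \<in> carrier V" "is_symbol n V \<phi> v g" "is_symbol n V \<psi> v h"
  shows "is_symbol n V (\<lambda>x\<in>carrier V. a * \<phi> x + b * \<psi> x) v (scl a g + scl b h)"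
  using assms root_module.actw_closed[OF assms(1)]
  by (simp add: is_symbol_def dword_add dword_scl lookup_add)

lemma is_symbol_zero:
  assumes "root_module V n" "v \<in> carrier V"
  shows "is_symbol n V (\<lambda>x\<in>carrier V. 0) v 0"
  using assms root_module.actw_closed[OF assms(1)] by (simp add: is_symbol_def)

lemma is_symbol_unique:
  assumes "is_symbol n V \<phi> v g" "is_symbol n V \<phi> v h" "g \<in> carrier (S_alg n)" "h \<in> carrier (S_alg n)"
  shows "g = h"
proof -
  have "g + scl (- 1) h = 0"
  proof (rule dword_const_zero_imp_zero)
    show "g + scl (- 1) h \<in> carrier (S_alg n)" using assms(3,4) by (intro poly_alg_closed)
    fix ws assume "ws \<in> lists (roots n)"
    then show "lookup (dword ws (g + scl (- 1) h)) 0 = 0"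
      using assms(1,2) unfolding is_symbol_def dword_add dword_scl lookup_add lookup_scl by simp
  qed
  then show ?thesis by (simp add: scl_uminus)
qed

subsection \<open>Cyclic submodules\<close>

locale cyclic = root_module T n for T :: "'v fmodule" (structure) and n +
  fixes v
  assumes v: "v \<in> carrier T"
begin

abbreviation C :: "'v fmodule" where "C \<equiv> cyclic_submodule n T v"

definition closed_sub :: "'v set \<Rightarrow> bool" where
  "closed_sub U \<longleftrightarrow> submodule U cplx T \<and> (\<forall>\<beta>\<in>roots n. \<forall>x\<in>U. act T \<beta> x \<in> U)"

lemma closed_subI:
  assumes "U \<subseteq> carrier T" "v \<in> U" "\<And>x y. x \<in> U \<Longrightarrow> y \<in> U \<Longrightarrow> x \<oplus>\<^bsub>T\<^esub> y \<in> U"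
    "\<And>c x. x \<in> U \<Longrightarrow> c \<odot>\<^bsub>T\<^esub> x \<in> U" "\<And>\<beta> x. \<beta> \<in> roots n \<Longrightarrow> x \<in> U \<Longrightarrow> act T \<beta> x \<in> U"
  shows "closed_sub U"
  unfolding closed_sub_def
proof (intro conjI submoduleI)
  show "\<zero>\<^bsub>T\<^esub> \<in> U" using assms(4)[OF assms(2), of 0] cplx_smult(1)[OF module_axioms v] by simp
  fix a assume a: "a \<in> U"
  then show "\<ominus>\<^bsub>T\<^esub> a \<in> U"
    using assms(1) assms(4)[OF a, of "-1"] cplx_smult(3)[OF module_axioms, of a] by auto
qed (use assms in auto)

lemma carrier_C: "carrier C = closed_sub hull {v}"
  by (simp add: cyclic_submodule_def closed_sub_def[abs_def])

lemma C_simps [simp]: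
  "x \<oplus>\<^bsub>C\<^esub> y = x \<oplus>\<^bsub>T\<^esub> y" "\<zero>\<^bsub>C\<^esub> = \<zero>\<^bsub>T\<^esub>" "c \<odot>\<^bsub>C\<^esub> x = c \<odot>\<^bsub>T\<^esub> x" "act C = act T"
  by (simp_all add: cyclic_submodule_def)

lemma actw_C [simp]: "actw C ws x = actw T ws x"
  by (induction ws arbitrary: x) simp_all

lemma v_in_C: "v \<in> carrier C"
  unfolding carrier_C by (rule hull_inc) simp

lemma C_sub: "carrier C \<subseteq> carrier T"
  unfolding carrier_C by (rule hull_minimal) (use v act_closed in \<open>auto intro: closed_subI\<close>)

lemma C_closed:
  "x \<in> carrier C \<Longrightarrow> y \<in> carrier C \<Longrightarrow> x \<oplus>\<^bsub>T\<^esub> y \<in> carrier C"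
  "x \<in> carrier C \<Longrightarrow> c \<odot>\<^bsub>T\<^esub> x \<in> carrier C"
  "\<beta> \<in> roots n \<Longrightarrow> x \<in> carrier C \<Longrightarrow> act T \<beta> x \<in> carrier C"
  "\<zero>\<^bsub>T\<^esub> \<in> carrier C"
proof -
  have *: "closed_sub U \<Longrightarrow> x \<in> U \<Longrightarrow> y \<in> U \<Longrightarrow> x \<oplus>\<^bsub>T\<^esub> y \<in> U"
    "closed_sub U \<Longrightarrow> x \<in> U \<Longrightarrow> c \<odot>\<^bsub>T\<^esub> x \<in> U"
    "\<beta> \<in> roots n \<Longrightarrow> closed_sub U \<Longrightarrow> x \<in> U \<Longrightarrow> act T \<beta> x \<in> U" for U x y c \<beta>
    using submoduleE(4,5) by (auto simp: closed_sub_def)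
  show "x \<in> carrier C \<Longrightarrow> y \<in> carrier C \<Longrightarrow> x \<oplus>\<^bsub>T\<^esub> y \<in> carrier C"
    "x \<in> carrier C \<Longrightarrow> c \<odot>\<^bsub>T\<^esub> x \<in> carrier C"
    "\<beta> \<in> roots n \<Longrightarrow> x \<in> carrier C \<Longrightarrow> act T \<beta> x \<in> carrier C"
    unfolding carrier_C hull_def by (auto intro: *)
  then have "0 \<odot>\<^bsub>T\<^esub> v \<in> closed_sub hull {v}" using *(2) v_in_C unfolding carrier_C hull_def by auto
  then show "\<zero>\<^bsub>T\<^esub> \<in> carrier C" using cplx_smult(1)[OF module_axioms v] by (simp add: carrier_C)
qed

lemma C_induct [consumes 1, case_names gen act add smult]:
  assumes "x \<in> carrier C" "P v"
    "\<And>\<beta> x. \<beta> \<in> roots n \<Longrightarrow> x \<in> carrier C \<Longrightarrow> P x \<Longrightarrow> P (act T \<beta> x)"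
    "\<And>x y. x \<in> carrier C \<Longrightarrow> y \<in> carrier C \<Longrightarrow> P x \<Longrightarrow> P y \<Longrightarrow> P (x \<oplus>\<^bsub>T\<^esub> y)"
    "\<And>c x. x \<in> carrier C \<Longrightarrow> P x \<Longrightarrow> P (c \<odot>\<^bsub>T\<^esub> x)"
  shows "P x"
proof -
  have "closed_sub {x \<in> carrier C. P x}"
    using C_sub assms(2-) by (intro closed_subI) (auto simp: C_closed v_in_C)
  then have "carrier C \<subseteq> {x \<in> carrier C. P x}"
    using assms(2) v_in_C unfolding carrier_C by (intro hull_minimal) auto
  then show ?thesis using assms(1) by blast
qed

lemma root_module_C: "root_module C n"
proof -
  note s = C_sub[THEN subsetD]
  have "module cplx C"
  proof (rule cplx_moduleI)
    fix x assume x: "x \<in> carrier C"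
    show "(-1) \<odot>\<^bsub>C\<^esub> x \<oplus>\<^bsub>C\<^esub> x = \<zero>\<^bsub>C\<^esub>"
      unfolding C_simps cplx_smult(3)[OF module_axioms s[OF x]] by (rule l_neg[OF s[OF x]])
  qed (use s in \<open>auto simp: C_closed a_ac smult_r_distr smult_l_distr[simplified] smult_assoc1[simplified]
      cplx_smult[OF module_axioms]\<close>)
  then show ?thesis
    unfolding root_module_def root_module_axioms_def
    using s act_add act_smult C_closed by auto
qed

text \<open>The symbol records the values on all \<open>f\<^sub>\<beta>\<^sub>1 \<dots> f\<^sub>\<beta>\<^sub>r v\<close>, and these span the cyclic module.\<close>

lemma symbol_determines:
  assumes "\<phi> \<in> dual C" "\<psi> \<in> dual C" "is_symbol n C \<phi> v g" "is_symbol n C \<psi> v g"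
  shows "\<phi> = \<psi>"
proof (rule dual_eqI[OF assms(1,2)])
  interpret C: root_module C n by (rule root_module_C)
  fix x assume "x \<in> carrier C"
  then have "\<forall>ws\<in>lists (roots n). \<phi> (actw C ws x) = \<psi> (actw C ws x)"
  proof (induction x rule: C_induct)
    case gen
    show ?case using assms(3,4) by (simp add: is_symbol_def)
  next
    case (act \<beta> x)
    show ?case
    proof
      fix ws assume "ws \<in> lists (roots n)"
      then have "\<phi> (actw C (\<beta> # ws) x) = \<psi> (actw C (\<beta> # ws) x)"
        using act(1) by (intro bspec[OF act(3)]) simp
      then show "\<phi> (actw C ws (act T \<beta> x)) = \<psi> (actw C ws (act T \<beta> x))" by simp
    qed
  next
    case (add x y)
    then show ?case
      using C.actw_add[of _ x y] C.actw_closed dualD[OF assms(1)] dualD[OF assms(2)] by simp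
  next
    case (smult c x)
    then show ?case
      using C.actw_smult[of _ x c] C.actw_closed dualD[OF assms(1)] dualD[OF assms(2)] by simp
  qed
  then have "\<phi> (actw C [] x) = \<psi> (actw C [] x)" by blast
  then show "\<phi> x = \<psi> x" by simp
qed

text \<open>The only candidate sends \<open>\<Sum> a f\<^sub>\<beta>\<^sub>1 \<dots> f\<^sub>\<beta>\<^sub>r v\<close> to \<open>\<Sum> a f\<^sub>\<beta>\<^sub>1 \<dots> f\<^sub>\<beta>\<^sub>r v'\<close>. It is well defined because functionals
  with equal symbols take the same value on both combinations, and those on the target separate points.
  The proof replaces combinations by a relation that is closed under the operations.\<close>

lemma exists_cyclic_hom:
  assumes T': "root_module T' n" and v': "v' \<in> carrier T'"
    and sep: "separates \<Psi> T'" "\<Psi> \<subseteq> dual T'"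
    and sym: "\<And>\<psi>. \<psi> \<in> \<Psi> \<Longrightarrow> \<exists>\<phi>\<in>dual C. \<exists>g. is_symbol n C \<phi> v g \<and> is_symbol n T' \<psi> v' g"
  shows "\<exists>!g. g \<in> linear_maps C T' \<and>
    (\<forall>\<beta>\<in>roots n. \<forall>x\<in>carrier C. g (act C \<beta> x) = act T' \<beta> (g x)) \<and> g v = v'"
proof -
  interpret C: root_module C n by (rule root_module_C)
  interpret T': root_module T' n by (rule T')
  \<comment> \<open>All matched functionals agree on \<open>x\<close> and \<open>y\<close>, also after acting by words.\<close>
  define rel where "rel x y \<longleftrightarrow> x \<in> carrier C \<and> y \<in> carrier T' \<and>
    (\<forall>\<psi>\<in>\<Psi>. \<forall>\<phi>\<in>dual C. \<forall>g. is_symbol n C \<phi> v g \<and> is_symbol n T' \<psi> v' g \<longrightarrow>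
      (\<forall>ws\<in>lists (roots n). \<phi> (actw C ws x) = \<psi> (actw T' ws y)))" for x y
  have rel_v: "rel v v'" using v_in_C v' by (auto simp: rel_def is_symbol_def)
  have rel_act: "rel (act T \<beta> x) (act T' \<beta> y)" if "rel x y" "\<beta> \<in> roots n" for x y \<beta>
    unfolding rel_def
  proof (intro conjI ballI allI impI)
    fix \<psi> \<phi> g ws assume *: "\<psi> \<in> \<Psi>" "\<phi> \<in> dual C" "is_symbol n C \<phi> v g \<and> is_symbol n T' \<psi> v' g"
      "ws \<in> lists (roots n)"
    then have "\<beta> # ws \<in> lists (roots n)" using that by simp
    then have "\<phi> (actw C (\<beta> # ws) x) = \<psi> (actw T' (\<beta> # ws) y)"
      using that * unfolding rel_def by blast
    then show "\<phi> (actw C ws (act T \<beta> x)) = \<psi> (actw T' ws (act T' \<beta> y))" by simp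
  qed (use that C_closed T'.act_closed in \<open>auto simp: rel_def\<close>)
  have rel_add: "rel (x1 \<oplus>\<^bsub>T\<^esub> x2) (y1 \<oplus>\<^bsub>T'\<^esub> y2)" if "rel x1 y1" "rel x2 y2" for x1 x2 y1 y2
    unfolding rel_def
  proof (intro conjI ballI allI impI)
    fix \<psi> \<phi> g ws assume *: "\<psi> \<in> \<Psi>" "\<phi> \<in> dual C" "is_symbol n C \<phi> v g \<and> is_symbol n T' \<psi> v' g"
      "ws \<in> lists (roots n)"
    have "\<psi> \<in> dual T'" using * sep by auto
    moreover have "\<phi> (actw C ws x1) = \<psi> (actw T' ws y1)" "\<phi> (actw C ws x2) = \<psi> (actw T' ws y2)"
      using that * unfolding rel_def by blast+
    moreover have "x1 \<in> carrier C" "x2 \<in> carrier C" "y1 \<in> carrier T'" "y2 \<in> carrier T'"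
      using that by (auto simp: rel_def)
    ultimately show "\<phi> (actw C ws (x1 \<oplus>\<^bsub>T\<^esub> x2)) = \<psi> (actw T' ws (y1 \<oplus>\<^bsub>T'\<^esub> y2))"
      using * C.actw_add[of ws x1 x2] T'.actw_add[of ws y1 y2] C.actw_closed[of ws] T'.actw_closed[of ws]
        dualD(1)[of \<phi> C "actw T ws x1" "actw T ws x2"] dualD(1)[of \<psi> T' "actw T' ws y1" "actw T' ws y2"]
      by simp
  qed (use that C_closed T'.a_closed in \<open>auto simp: rel_def\<close>)
  have rel_smult: "rel (c \<odot>\<^bsub>T\<^esub> x) (c \<odot>\<^bsub>T'\<^esub> y)" if "rel x y" for x y c
    unfolding rel_def
  proof (intro conjI ballI allI impI)
    fix \<psi> \<phi> g ws assume *: "\<psi> \<in> \<Psi>" "\<phi> \<in> dual C" "is_symbol n C \<phi> v g \<and> is_symbol n T' \<psi> v' g"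
      "ws \<in> lists (roots n)"
    have "\<psi> \<in> dual T'" using * sep by auto
    moreover have "\<phi> (actw C ws x) = \<psi> (actw T' ws y)"
      using that * unfolding rel_def by blast+
    moreover have "x \<in> carrier C" "y \<in> carrier T'"
      using that by (auto simp: rel_def)
    ultimately show "\<phi> (actw C ws (c \<odot>\<^bsub>T\<^esub> x)) = \<psi> (actw T' ws (c \<odot>\<^bsub>T'\<^esub> y))"
      using * C.actw_smult[of ws x c] T'.actw_smult[of ws y c] C.actw_closed[of ws] T'.actw_closed[of ws]
        dualD(2)[of \<phi> C "actw T ws x"] dualD(2)[of \<psi> T' "actw T' ws y"]
      by simp
  qed (use that C_closed in \<open>auto simp: rel_def\<close>)
  have rel_unique: "y = y'" if "rel x y" "rel x y'" for x y y'
  proof (rule separatesD[OF sep(1)])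
    fix \<psi> assume "\<psi> \<in> \<Psi>"
    then obtain \<phi> g where "\<phi> \<in> dual C" "is_symbol n C \<phi> v g \<and> is_symbol n T' \<psi> v' g"
      using sym by blast
    then have "\<phi> (actw C [] x) = \<psi> (actw T' [] y)" "\<phi> (actw C [] x) = \<psi> (actw T' [] y')"
      using that \<open>\<psi> \<in> \<Psi>\<close> lists.Nil[of "roots n"] unfolding rel_def by blast+
    then show "\<psi> y = \<psi> y'" by simp
  qed (use that in \<open>auto simp: rel_def\<close>)
  have rel_ex: "\<exists>y. rel x y" if "x \<in> carrier C" for x
    using that by (induction x rule: C_induct) (use rel_v rel_act rel_add rel_smult in blast)+
  define g where "g = (\<lambda>x\<in>carrier C. THE y. rel x y)"
  have g: "rel x (g x)" if "x \<in> carrier C" for x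
    using rel_ex[OF that] rel_unique theI'[of "rel x"] that by (auto simp: g_def)
  have rel_carrier: "x \<in> carrier C" "y \<in> carrier T'" if "rel x y" for x y
    using that by (simp_all add: rel_def)
  have g_eq: "g x = y" if "rel x y" for x y
    using rel_unique[OF g[OF rel_carrier(1)[OF that]] that] .
  have g_ext: "g x = undefined" if "x \<notin> carrier C" for x
    using that by (simp add: g_def)
  show ?thesis
  proof (rule ex1I[of _ g])
    show "g \<in> linear_maps C T' \<and>
      (\<forall>\<beta>\<in>roots n. \<forall>x\<in>carrier C. g (act C \<beta> x) = act T' \<beta> (g x)) \<and> g v = v'"
      unfolding linear_maps_def
      using rel_carrier[OF g] g_eq[OF rel_add[OF g g]] g_eq[OF rel_smult[OF g]]
        g_eq[OF rel_act[OF g]] g_eq[OF rel_v] g_ext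
      by (auto simp: PiE_iff extensional_def)
  next
    fix f assume f: "f \<in> linear_maps C T' \<and>
      (\<forall>\<beta>\<in>roots n. \<forall>x\<in>carrier C. f (act C \<beta> x) = act T' \<beta> (f x)) \<and> f v = v'"
    have "rel x (f x)" if "x \<in> carrier C" for x
      using that
    proof (induction x rule: C_induct)
      case gen show ?case using f rel_v by simp
    next
      case (act \<beta> x) then show ?case using f rel_act[of x "f x" \<beta>] by simp
    next
      case (add x y) then show ?case using f rel_add[of x "f x" y "f y"]
        using linear_mapsD(2)[of f C T' x y] by simp
    next
      case (smult c x) then show ?case using f rel_smult[of x "f x" c]
        using linear_mapsD(3)[of f C T' x c] by simp
    qed
    then have "f x = g x" if "x \<in> carrier C" for x using g_eq that by metis
    moreover have "f x = g x" if "x \<notin> carrier C" for x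
      using that f linear_mapsD(4)[of f C T' x] by (auto simp: g_def)
    ultimately show "f = g" by blast
  qed
qed

end

section \<open>Quotients and tensor products\<close>

text \<open>All quotients in question are quotients of subspaces of spaces of finitely supported functions, where
  cosets can be described by differences.\<close>

locale pm_quot =
  fixes M :: "(complex, 'b \<Rightarrow>\<^sub>0 complex) module" and N
  assumes C: "pm.subspace (carrier M)" and N: "pm.subspace N" and N_sub: "N \<subseteq> carrier M"
    and M_add: "\<And>x y. x \<oplus>\<^bsub>M\<^esub> y = x + y" and M_smult: "\<And>c x. c \<odot>\<^bsub>M\<^esub> x = scl c x"
begin

abbreviation cls where "cls x \<equiv> N +>\<^bsub>M\<^esub> x"

lemma cls: "cls x = {y. y - x \<in> N}"
proof -
  have "y = (y - x) + x" for y by simp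
  then show ?thesis by (auto simp: a_r_coset_def' M_add)
qed

lemma N_closed: "0 \<in> N" "x \<in> N \<Longrightarrow> y \<in> N \<Longrightarrow> x + y \<in> N" "x \<in> N \<Longrightarrow> y \<in> N \<Longrightarrow> x - y \<in> N"
  "x \<in> N \<Longrightarrow> scl c x \<in> N" "x \<in> N \<Longrightarrow> - x \<in> N"
  using N by (auto simp: pm.subspace_def intro: pm.subspace_diff pm.subspace_neg)

lemma cls_eq: "cls x = cls y \<longleftrightarrow> x - y \<in> N"
proof
  assume "cls x = cls y"
  moreover have "x \<in> cls x" by (simp add: cls N_closed)
  ultimately show "x - y \<in> N" by (auto simp: cls)
next
  assume "x - y \<in> N"
  then have "z - x \<in> N \<longleftrightarrow> z - y \<in> N" for z
    using N_closed(2)[of "z - x" "x - y"] N_closed(3)[of "z - y" "x - y"] by auto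
  then show "cls x = cls y" by (simp add: cls)
qed

lemma quot_carrier: "carrier (quot M N) = cls ` carrier M"
  by (auto simp: quot_def A_RCOSETS_def')

lemma quot_add: "cls x \<oplus>\<^bsub>quot M N\<^esub> cls y = cls (x + y)"
proof -
  have "z - (x + y) \<in> N \<Longrightarrow> \<exists>a b. a - x \<in> N \<and> b - y \<in> N \<and> z = a + b" for z
    by (intro exI[of _ "z - y"] exI[of _ y]) (auto simp: N_closed algebra_simps)
  moreover have "a + b - (x + y) \<in> N" if "a - x \<in> N" "b - y \<in> N" for a b
    using N_closed(2)[OF that] by (simp add: algebra_simps)
  ultimately show ?thesis by (auto simp: quot_def set_add_def' cls M_add)
qed

lemma quot_smult: "c \<odot>\<^bsub>quot M N\<^esub> cls x = cls (scl c x)"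
proof -
  have "cls (scl c y) = cls (scl c x)" if "y \<in> cls x" for y
    using that N_closed(4)[of "y - x" c] by (simp add: cls_eq pm.scale_right_diff_distrib) (simp add: cls)
  moreover have "x \<in> cls x" by (simp add: cls N_closed)
  ultimately have "(\<Union>y\<in>cls x. cls (scl c y)) = cls (scl c x)" by (intro UN_constant_eq) blast+
  then show ?thesis by (simp add: quot_def M_smult)
qed

lemma quot_zero: "\<zero>\<^bsub>quot M N\<^esub> = cls 0"
  by (simp add: quot_def cls)

lemma C_closed: "0 \<in> carrier M" "x \<in> carrier M \<Longrightarrow> y \<in> carrier M \<Longrightarrow> x + y \<in> carrier M"
  "x \<in> carrier M \<Longrightarrow> scl c x \<in> carrier M"
  using C by (auto simp: pm.subspace_def)

lemma module_quot:
  assumes "carrier T = carrier (quot M N)" "add T = add (quot M N)" "zero T = zero (quot M N)"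
    "module.smult T = module.smult (quot M N)"
  shows "module cplx T"
  by (rule cplx_moduleI)
    (auto simp: assms quot_carrier quot_add quot_smult quot_zero C_closed
      pm.scale_left_distrib pm.scale_right_distrib ac_simps)

end

lemma module_extend_simps [simp]:
  "carrier (module.extend Q r) = carrier Q" "add (module.extend Q r) = add Q"
  "zero (module.extend Q r) = zero Q" "module.smult (module.extend Q r) = module.smult Q"
  "monoid.mult (module.extend Q r) = monoid.mult Q" "one (module.extend Q r) = one Q"
  "act (module.extend Q (fmodule.fields f)) = f"
  by (simp_all add: module.defs fmodule.defs)

definition lin_ext :: "('b \<Rightarrow> 'c \<Rightarrow>\<^sub>0 complex) \<Rightarrow> ('b \<Rightarrow>\<^sub>0 complex) \<Rightarrow> ('c \<Rightarrow>\<^sub>0 complex)" where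
  "lin_ext f a = (\<Sum>x\<in>keys a. scl (lookup a x) (f x))"

lemma lin_ext_add: "lin_ext f (a + b) = lin_ext f a + lin_ext f b"
  and lin_ext_scl: "lin_ext f (scl c a) = scl c (lin_ext f a)"
  and lin_ext_single: "lin_ext f (single x c) = scl c (f x)"
  unfolding lin_ext_def
    apply (rule sum_keys_add[of "\<lambda>x c. scl c (f x)"]; simp add: pm.scale_left_distrib)
   apply (subst sum_keys_scl[of "\<lambda>x c. scl c (f x)"]; simp add: pm.scale_sum_right)
  apply simp
  done

lemma lin_ext_0 [simp]: "lin_ext f 0 = 0"
  by (simp add: lin_ext_def)

lemma lin_ext_diff: "lin_ext f (a - b) = lin_ext f a - lin_ext f b"
  using lin_ext_add[of f "a - b" b] by simp

lemma lin_ext_sum: "lin_ext f (\<Sum>i\<in>I. a i) = (\<Sum>i\<in>I. lin_ext f (a i))"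
  by (induction I rule: infinite_finite_induct) (simp_all add: lin_ext_add)

locale tensor_product =
  fixes K :: "'k set" and V :: "'k \<Rightarrow> 'v fmodule" and n :: nat
  assumes finite_K: "finite K" and V: "\<And>k. k \<in> K \<Longrightarrow> root_module (V k) n"
begin

abbreviation X where "X \<equiv> \<Pi>\<^sub>E k\<in>K. carrier (V k)"
abbreviation F where "F \<equiv> free_space X"
abbreviation N where "N \<equiv> tensor_rels K V"
abbreviation T where "T \<equiv> tensor K V"

definition add_rel where
  "add_rel x k u v = single (x(k := u \<oplus>\<^bsub>V k\<^esub> v)) 1 - single (x(k := u)) (1::complex) - single (x(k := v)) 1"

definition smult_rel where
  "smult_rel x k c u = single (x(k := c \<odot>\<^bsub>V k\<^esub> u)) 1 - scl c (single (x(k := u)) 1)"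

lemma N_eq: "N = pm.span
    ({add_rel x k u v | x k u v. x \<in> X \<and> k \<in> K \<and> u \<in> carrier (V k) \<and> v \<in> carrier (V k)} \<union>
     {smult_rel x k c u | x k c u. x \<in> X \<and> k \<in> K \<and> u \<in> carrier (V k)})"
  by (simp add: tensor_rels_def add_rel_def smult_rel_def)

lemma add_rel_in: "x \<in> X \<Longrightarrow> k \<in> K \<Longrightarrow> u \<in> carrier (V k) \<Longrightarrow> v \<in> carrier (V k) \<Longrightarrow> add_rel x k u v \<in> N"
  unfolding N_eq by (rule pm.span_base) blast

lemma smult_rel_in: "x \<in> X \<Longrightarrow> k \<in> K \<Longrightarrow> u \<in> carrier (V k) \<Longrightarrow> smult_rel x k c u \<in> N"
  unfolding N_eq by (rule pm.span_base) blast

lemma N_subsetI: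
  assumes "pm.subspace U"
    "\<And>x k u v. x \<in> X \<Longrightarrow> k \<in> K \<Longrightarrow> u \<in> carrier (V k) \<Longrightarrow> v \<in> carrier (V k) \<Longrightarrow> add_rel x k u v \<in> U"
    "\<And>x k c u. x \<in> X \<Longrightarrow> k \<in> K \<Longrightarrow> u \<in> carrier (V k) \<Longrightarrow> smult_rel x k c u \<in> U"
  shows "N \<subseteq> U"
  unfolding N_eq using assms by (intro pm.span_minimal) auto

lemma F_carrier: "a \<in> carrier F \<longleftrightarrow> keys a \<subseteq> X"
  by (simp add: free_space_def)

lemma F_subspace: "pm.subspace (carrier F)"
  unfolding pm.subspace_def
proof (intro conjI allI ballI)
  fix x y assume "x \<in> carrier F" "y \<in> carrier F"
  then show "x + y \<in> carrier F" using keys_add[of x y] by (auto simp: F_carrier)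
next
  fix c x assume "x \<in> carrier F"
  then show "scl c x \<in> carrier F" using keys_scl[of c x] by (auto simp: F_carrier)
qed (simp add: F_carrier)

lemma upd_X: "x \<in> X \<Longrightarrow> k \<in> K \<Longrightarrow> u \<in> carrier (V k) \<Longrightarrow> x(k := u) \<in> X"
  by (auto simp: PiE_iff extensional_def)

lemma single_F: "x \<in> X \<Longrightarrow> single x c \<in> carrier F"
  by (simp add: F_carrier)

sublocale pm_quot F N
proof
  show "pm.subspace (carrier F)" by (rule F_subspace)
  show "pm.subspace N" by (simp add: N_eq)
  show "N \<subseteq> carrier F"
  proof (rule N_subsetI)
    fix x k u v assume *: "x \<in> X" "k \<in> K" "u \<in> carrier (V k)" "v \<in> carrier (V k)"
    interpret root_module "V k" n by (rule V) fact
    show "add_rel x k u v \<in> carrier F"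
      unfolding add_rel_def using *
      by (intro pm.subspace_diff F_subspace single_F upd_X) auto
  next
    fix x k c u assume *: "x \<in> X" "k \<in> K" "u \<in> carrier (V k)"
    interpret root_module "V k" n by (rule V) fact
    show "smult_rel x k c u \<in> carrier F"
      unfolding smult_rel_def using *
      by (intro pm.subspace_diff pm.subspace_scale F_subspace single_F upd_X) auto
  qed (rule F_subspace)
qed (simp_all add: free_space_def)

lemma T_simps:
  "carrier T = cls ` carrier F" "cls a \<oplus>\<^bsub>T\<^esub> cls b = cls (a + b)" "\<zero>\<^bsub>T\<^esub> = cls 0"
  "c \<odot>\<^bsub>T\<^esub> cls a = cls (scl c a)" "act T \<beta> Y = (\<Union>a\<in>Y. cls (free_act K V \<beta> a))"
  by (simp_all add: tensor_def Let_def quot_add quot_smult quot_zero quot_carrier)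

lemma module_T: "module cplx T"
  by (rule module_quot) (simp_all add: tensor_def Let_def)

lemma free_act: "free_act K V \<beta> = lin_ext (\<lambda>x. \<Sum>k\<in>K. single (x(k := act (V k) \<beta> (x k))) 1)"
  by (simp add: fun_eq_iff free_act_def lin_ext_def pm.scale_sum_right)

lemma free_act_single: "free_act K V \<beta> (single x 1) = (\<Sum>k\<in>K. single (x(k := act (V k) \<beta> (x k))) 1)"
  by (simp add: free_act lin_ext_single)

lemma free_act_closed:
  assumes "\<beta> \<in> roots n" "a \<in> carrier F"
  shows "free_act K V \<beta> a \<in> carrier F"
  unfolding free_act lin_ext_def
proof (intro pm.subspace_sum pm.subspace_scale F_subspace single_F upd_X)
  fix x k assume "x \<in> keys a" and k: "k \<in> K"
  then show x: "x \<in> X" using assms by (auto simp: F_carrier)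
  interpret root_module "V k" n by (rule V) fact
  show "act (V k) \<beta> (x k) \<in> carrier (V k)" using x k by (intro act_closed assms) auto
qed

text \<open>Applied to one of the multilinearity relations in the coordinate \<open>k\<close>, the summand \<open>l\<close> of the Leibniz
  rule is again such a relation: for \<open>l = k\<close> with both arguments moved, for \<open>l \<noteq> k\<close> with another coordinate
  of \<open>x\<close> moved.\<close>

lemma free_act_N:
  assumes \<beta>: "\<beta> \<in> roots n" and a: "a \<in> N"
  shows "free_act K V \<beta> a \<in> N"
proof -
  have "N \<subseteq> {a. free_act K V \<beta> a \<in> N}"
  proof (rule N_subsetI)
    show "pm.subspace {a. free_act K V \<beta> a \<in> N}"
      unfolding pm.subspace_def by (auto simp: free_act lin_ext_add lin_ext_scl N_closed)
    fix x k u v assume *: "x \<in> X" "k \<in> K" "u \<in> carrier (V k)" "v \<in> carrier (V k)"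
    have "(\<Sum>l\<in>K. single ((x(k := u \<oplus>\<^bsub>V k\<^esub> v))(l := act (V l) \<beta> ((x(k := u \<oplus>\<^bsub>V k\<^esub> v)) l))) (1::complex) -
       single ((x(k := u))(l := act (V l) \<beta> ((x(k := u)) l))) 1 -
       single ((x(k := v))(l := act (V l) \<beta> ((x(k := v)) l))) 1) \<in> N"
    proof (rule pm.subspace_sum[OF N])
      fix l assume l: "l \<in> K"
      interpret root_module "V l" n by (rule V) fact
      show "single ((x(k := u \<oplus>\<^bsub>V k\<^esub> v))(l := act (V l) \<beta> ((x(k := u \<oplus>\<^bsub>V k\<^esub> v)) l))) (1::complex) -
       single ((x(k := u))(l := act (V l) \<beta> ((x(k := u)) l))) 1 -
       single ((x(k := v))(l := act (V l) \<beta> ((x(k := v)) l))) 1 \<in> N"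
      proof (cases "l = k")
        case True
        have "add_rel x k (act (V k) \<beta> u) (act (V k) \<beta> v) \<in> N"
          using * True \<beta> by (intro add_rel_in act_closed[unfolded True]) auto
        then show ?thesis using * True \<beta> by (simp add: add_rel_def act_add[unfolded True])
      next
        case False
        have "x l \<in> carrier (V l)" using l *(1) by auto
        then have "x(l := act (V l) \<beta> (x l)) \<in> X" using * l \<beta> by (intro upd_X act_closed)
        then have "add_rel (x(l := act (V l) \<beta> (x l))) k u v \<in> N"
          using * by (intro add_rel_in)
        then show ?thesis using False by (simp add: add_rel_def fun_upd_twist)
      qed
    qed
    then show "add_rel x k u v \<in> {a. free_act K V \<beta> a \<in> N}"
      by (simp add: add_rel_def free_act lin_ext_diff lin_ext_single sum_subtractf del: fun_upd_apply)
  next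
    fix x k c u assume *: "x \<in> X" "k \<in> K" "u \<in> carrier (V k)"
    have "(\<Sum>l\<in>K. single ((x(k := c \<odot>\<^bsub>V k\<^esub> u))(l := act (V l) \<beta> ((x(k := c \<odot>\<^bsub>V k\<^esub> u)) l))) 1 -
       scl c (single ((x(k := u))(l := act (V l) \<beta> ((x(k := u)) l))) 1)) \<in> N"
    proof (rule pm.subspace_sum[OF N])
      fix l assume l: "l \<in> K"
      interpret root_module "V l" n by (rule V) fact
      show "single ((x(k := c \<odot>\<^bsub>V k\<^esub> u))(l := act (V l) \<beta> ((x(k := c \<odot>\<^bsub>V k\<^esub> u)) l))) 1 -
       scl c (single ((x(k := u))(l := act (V l) \<beta> ((x(k := u)) l))) 1) \<in> N"
      proof (cases "l = k")
        case True
        have "smult_rel x k c (act (V k) \<beta> u) \<in> N"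
          using * True \<beta> by (intro smult_rel_in act_closed[unfolded True]) auto
        then show ?thesis using * True \<beta> by (simp add: smult_rel_def act_smult[unfolded True])
      next
        case False
        have "x l \<in> carrier (V l)" using l *(1) by auto
        then have "x(l := act (V l) \<beta> (x l)) \<in> X" using * l \<beta> by (intro upd_X act_closed)
        then have "smult_rel (x(l := act (V l) \<beta> (x l))) k c u \<in> N"
          using * by (intro smult_rel_in)
        then show ?thesis using False by (simp add: smult_rel_def fun_upd_twist)
      qed
    qed
    then show "smult_rel x k c u \<in> {a. free_act K V \<beta> a \<in> N}"
      by (simp add: smult_rel_def free_act lin_ext_diff lin_ext_single lin_ext_scl sum_subtractf
          pm.scale_sum_right del: fun_upd_apply scl_single)
  qed
  then show ?thesis using a by blast
qed

lemma T_act: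
  assumes "\<beta> \<in> roots n"
  shows "act T \<beta> (cls a) = cls (free_act K V \<beta> a)"
proof -
  have "cls (free_act K V \<beta> b) = cls (free_act K V \<beta> a)" if "b \<in> cls a" for b
    using that free_act_N[OF assms, of "b - a"] unfolding cls_eq by (simp add: free_act lin_ext_diff cls)
  moreover have "a \<in> cls a" by (simp add: cls N_closed)
  ultimately show ?thesis unfolding T_simps by (intro UN_constant_eq) blast+
qed

lemma root_module_T: "root_module T n"
proof -
  interpret module cplx T by (rule module_T)
  show ?thesis
    by unfold_locales
      (auto simp: T_simps(1-4) T_act free_act_closed; simp add: free_act lin_ext_add lin_ext_scl)+
qed

abbreviation pure where "pure x \<equiv> cls (single x 1)"

lemma pure_tensor: "x \<in> X \<Longrightarrow> pure_tensor K V x = pure x"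
  by (simp add: pure_tensor_def PiE_restrict)

lemma pure_in_T: "x \<in> X \<Longrightarrow> pure x \<in> carrier T"
  by (simp add: T_simps single_F)

text \<open>The value of \<open>\<Otimes>\<^sub>k \<phi> k\<close> on a representative of a tensor.\<close>

definition val where "val \<phi> = lin_val (\<lambda>x. \<Prod>k\<in>K. \<phi> k (x k))"

lemma val_N:
  assumes \<phi>: "\<And>k. k \<in> K \<Longrightarrow> \<phi> k \<in> dual (V k)" and a: "a \<in> N"
  shows "val \<phi> a = 0"
proof -
  have P: "(\<Prod>l\<in>K. \<phi> l ((x(k := u)) l)) = \<phi> k u * (\<Prod>l\<in>K - {k}. \<phi> l (x l))" if "k \<in> K" for x k u
  proof -
    have "(\<Prod>l\<in>K - {k}. \<phi> l ((x(k := u)) l)) = (\<Prod>l\<in>K - {k}. \<phi> l (x l))"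
      by (rule prod.cong) auto
    then show ?thesis using that finite_K by (simp add: prod.remove)
  qed
  have "N \<subseteq> {a. val \<phi> a = 0}"
  proof (rule N_subsetI)
    show "pm.subspace {a. val \<phi> a = 0}"
      unfolding pm.subspace_def
      by (auto simp: val_def lin_val_add lin_val_scl) (simp add: lin_val_def)
    fix x k u v assume *: "x \<in> X" "k \<in> K" "u \<in> carrier (V k)" "v \<in> carrier (V k)"
    show "add_rel x k u v \<in> {a. val \<phi> a = 0}"
      using * dualD(1)[OF \<phi>[OF *(2)], of u v]
      by (simp add: val_def add_rel_def lin_val_diff lin_val_add lin_val_single P algebra_simps del: fun_upd_apply)
  next
    fix x k c u assume *: "x \<in> X" "k \<in> K" "u \<in> carrier (V k)"
    show "smult_rel x k c u \<in> {a. val \<phi> a = 0}"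
      using * dualD(2)[OF \<phi>[OF *(2)], of u c]
      by (simp add: val_def smult_rel_def lin_val_diff lin_val_single lin_val_scl P algebra_simps
          del: fun_upd_apply scl_single)
  qed
  then show ?thesis using a by blast
qed

lemma tensor_functional:
  assumes \<phi>: "\<And>k. k \<in> K \<Longrightarrow> \<phi> k \<in> dual (V k)"
  shows "tensor_functional K \<phi> (cls a) = val \<phi> a"
proof -
  have "val \<phi> b = val \<phi> a" if "b \<in> cls a" for b
    using that val_N[OF \<phi>, of "b - a"] by (simp add: cls val_def lin_val_diff)
  moreover have "a \<in> cls a" by (simp add: cls N_closed)
  ultimately have "(val \<phi>) ` cls a = {val \<phi> a}" by blast
  then show ?thesis by (simp add: tensor_functional_def val_def lin_val_def)
qed

lemma tensor_functional_dual:
  assumes \<phi>: "\<And>k. k \<in> K \<Longrightarrow> \<phi> k \<in> dual (V k)"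
  shows "restrict (tensor_functional K \<phi>) (carrier T) \<in> dual T"
proof (rule dualI[OF module_T])
  fix x y assume "x \<in> carrier T" "y \<in> carrier T"
  then show "tensor_functional K \<phi> (x \<oplus>\<^bsub>T\<^esub> y) = tensor_functional K \<phi> x + tensor_functional K \<phi> y"
    by (auto simp: T_simps(1-4) tensor_functional[of \<phi>, OF \<phi>] val_def lin_val_add)
next
  fix c x assume "x \<in> carrier T"
  then show "tensor_functional K \<phi> (c \<odot>\<^bsub>T\<^esub> x) = c * tensor_functional K \<phi> x"
    by (auto simp: T_simps(1-4) tensor_functional[of \<phi>, OF \<phi>] val_def lin_val_scl)
qed

text \<open>The symbol turns tensor products into products: on one letter both sides obey the Leibniz rule, and
  \<open>is_symbol_act\<close> puts the summands into the form of the claim again, with \<open>x\<close> and \<open>g\<close> changed in one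
  place. Hence the induction over the word generalises \<open>x\<close> and \<open>g\<close>.\<close>

lemma tensor_symbol:
  assumes \<phi>: "\<And>k. k \<in> K \<Longrightarrow> \<phi> k \<in> dual (V k)"
    and g: "\<And>k. k \<in> K \<Longrightarrow> is_symbol n (V k) (\<phi> k) (x k) (g k)"
  shows "is_symbol n T (tensor_functional K \<phi>) (pure x) (\<Prod>k\<in>K. g k)"
proof -
  define fa where "fa ws = foldr (\<lambda>\<beta> f. f \<circ> free_act K V \<beta>) ws id" for ws
  have fa: "fa [] = id" "fa (\<beta> # ws) = fa ws \<circ> free_act K V \<beta>" for \<beta> ws
    by (simp_all add: fa_def)
  have fa_sum: "fa ws (sum a I) = (\<Sum>i\<in>I. fa ws (a i))" for ws I and a :: "'k \<Rightarrow> _"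
    by (induction ws arbitrary: a) (simp_all add: fa free_act lin_ext_sum)
  have act: "actw T ws (cls a) = cls (fa ws a)" if "ws \<in> lists (roots n)" for ws a
    using that by (induction ws arbitrary: a) (simp_all add: fa T_act)
  have "val \<phi> (fa ws (single x 1)) = lookup (dword ws (\<Prod>k\<in>K. g k)) 0" if "ws \<in> lists (roots n)" for ws
    using that g
  proof (induction ws arbitrary: x g rule: list.induct)
    case Nil
    interpret const: comm_ring_hom "\<lambda>q :: (nat \<times> nat) mpoly. lookup q 0" by (rule const_hom)
    have "lookup (\<Prod>k\<in>K. g k) 0 = (\<Prod>k\<in>K. lookup (g k) 0)" by (rule const.hom_prod)
    then show ?case
      using is_symbol_const[OF Nil(2)] by (simp add: fa val_def lin_val_single)
  next
    case (Cons \<beta> ws)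
    have \<beta>: "\<beta> \<in> roots n" "ws \<in> lists (roots n)" using Cons.prems by auto
    have "val \<phi> (fa (\<beta> # ws) (single x 1)) =
        (\<Sum>k\<in>K. val \<phi> (fa ws (single (x(k := act (V k) \<beta> (x k))) 1)))"
      by (simp add: fa free_act_single fa_sum val_def lin_val_sum)
    also have "\<dots> = (\<Sum>k\<in>K. lookup (dword ws (\<Prod>l\<in>K. (g(k := pdiff \<beta> (g k))) l)) 0)"
    proof (rule sum.cong[OF refl], rule Cons.IH[OF \<beta>(2)])
      fix k l assume "k \<in> K" "l \<in> K"
      then show "is_symbol n (V l) (\<phi> l) ((x(k := act (V k) \<beta> (x k))) l) ((g(k := pdiff \<beta> (g k))) l)"
        using Cons.prems(2) is_symbol_act[OF Cons.prems(2) \<beta>(1)] by (cases "l = k") auto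
    qed
    also have "\<dots> = lookup (dword (\<beta> # ws) (\<Prod>k\<in>K. g k)) 0"
      unfolding dword.simps pdiff_prod[OF finite_K] dword_sum lookup_sum ..
    finally show ?case .
  qed
  then show ?thesis by (simp add: is_symbol_def act tensor_functional[of \<phi>, OF \<phi>])
qed

text \<open>Expanding the factors one after the other in their bases, a tensor becomes congruent to a combination
  of tensors of basis vectors, and the product functionals read off its coefficients.\<close>

lemma tensor_separates:
  assumes db: "\<And>k. k \<in> K \<Longrightarrow> dual_basis (V k) (E k) (\<epsilon> k)"
  shows "separates ((\<lambda>\<rho>. restrict (tensor_functional K (\<lambda>k. \<epsilon> k (\<rho> k))) (carrier T)) ` (\<Pi>\<^sub>E k\<in>K. E k)) T"
proof -
  have E: "finite (E k)" "E k \<subseteq> carrier (V k)" "e \<in> E k \<Longrightarrow> \<epsilon> k e \<in> dual (V k)"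
    "e \<in> E k \<Longrightarrow> e' \<in> E k \<Longrightarrow> \<epsilon> k e e' = (if e = e' then 1 else 0)"
    "u \<in> carrier (V k) \<Longrightarrow> finsum (V k) (\<lambda>e. \<epsilon> k e u \<odot>\<^bsub>V k\<^esub> e) (E k) = u"
    if "k \<in> K" for k e e' u
    using db[OF that] unfolding dual_basis_def by auto
  have expand: "single (x(k := finsum (V k) (\<lambda>e. c e \<odot>\<^bsub>V k\<^esub> e) A)) 1 -
      (\<Sum>e\<in>A. scl (c e) (single (x(k := e)) 1)) \<in> N"
    if x: "x \<in> X" and k: "k \<in> K" and A: "finite A" "A \<subseteq> carrier (V k)" for x k c A
  proof -
    interpret root_module "V k" n by (rule V) fact
    show ?thesis using A
    proof (induction A)
      case empty
      show ?case using smult_rel_in[OF x k, of "\<zero>\<^bsub>V k\<^esub>" 0]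
        by (simp add: smult_rel_def cplx_smult(1)[OF module_axioms] del: fun_upd_apply)
    next
      case (insert e A)
      let ?s = "finsum (V k) (\<lambda>e. c e \<odot>\<^bsub>V k\<^esub> e) A"
      have s: "?s \<in> carrier (V k)" using insert by (intro finsum_closed) auto
      have e: "e \<in> carrier (V k)" using insert by auto
      have "finsum (V k) (\<lambda>e. c e \<odot>\<^bsub>V k\<^esub> e) (insert e A) = c e \<odot>\<^bsub>V k\<^esub> e \<oplus>\<^bsub>V k\<^esub> ?s"
        using insert by (intro finsum_insert) auto
      moreover have "add_rel x k (c e \<odot>\<^bsub>V k\<^esub> e) ?s + smult_rel x k (c e) e +
         (single (x(k := ?s)) 1 - (\<Sum>e\<in>A. scl (c e) (single (x(k := e)) 1))) \<in> N"
        by (intro N_closed(2) add_rel_in smult_rel_in x k s e smult_closed insert.IH) (use insert.prems in simp_all)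
      ultimately show ?case using insert
        by (simp add: add_rel_def smult_rel_def algebra_simps del: fun_upd_apply)
    qed
  qed
  \<comment> \<open>representatives whose coordinates in \<open>J\<close> are basis vectors\<close>
  define B where "B J = {b :: ('k \<Rightarrow> 'v) \<Rightarrow>\<^sub>0 complex. keys b \<subseteq> {x \<in> X. \<forall>k\<in>J. x k \<in> E k}}" for J
  have red: "\<exists>b\<in>B J. a - b \<in> N" if "J \<subseteq> K" "a \<in> carrier F" for J a
    using finite_subset[OF that(1) finite_K] that(1)
  proof (induction J)
    case empty show ?case using that(2) N_closed(1) by (intro bexI[of _ a]) (auto simp: B_def F_carrier)
  next
    case (insert k J)
    then obtain b where b: "b \<in> B J" "a - b \<in> N" by auto
    have k: "k \<in> K" using insert by auto
    define f where "f = (\<lambda>x. \<Sum>e\<in>E k. scl (\<epsilon> k e (x k)) (single (x(k := e)) 1))"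
    have "b - lin_ext f b = (\<Sum>x\<in>keys b. scl (lookup b x) (single x 1 - f x))"
    proof -
      have "b = lin_ext (\<lambda>x. single x 1) b"
        by (induction b rule: pm_induct) (simp_all add: lin_ext_single lin_ext_add)
      then have "b - lin_ext f b = lin_ext (\<lambda>x. single x 1) b - lin_ext f b" by simp
      also have "\<dots> = (\<Sum>x\<in>keys b. scl (lookup b x) (single x 1 - f x))"
        by (simp add: lin_ext_def sum_subtractf pm.scale_right_diff_distrib)
      finally show ?thesis .
    qed
    also have "\<dots> \<in> N"
    proof (intro pm.subspace_sum[OF N] pm.subspace_scale[OF N])
      fix x assume "x \<in> keys b"
      then have x: "x \<in> X" using b by (auto simp: B_def)
      have "x k \<in> carrier (V k)" using x k by auto
      then show "single x 1 - f x \<in> N"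
        using expand[OF x k E(1,2)[OF k], of "\<lambda>e. \<epsilon> k e (x k)"] E(5)[OF k, of "x k"] by (simp add: f_def)
    qed
    finally have "a - lin_ext f b \<in> N" using N_closed(2)[OF b(2)] by fastforce
    moreover have "lin_ext f b \<in> B (insert k J)"
    proof -
      have "keys (lin_ext f b) \<subseteq> (\<Union>x\<in>keys b. \<Union>e\<in>E k. {x(k := e)})"
      proof -
        have 1: "keys (scl c (single y 1)) \<subseteq> {y}" for c and y :: "'k \<Rightarrow> 'v"
          using keys_scl[of c "single y 1"] by simp
        have 2: "keys (f x) \<subseteq> (\<Union>e\<in>E k. {x(k := e)})" for x
          unfolding f_def by (rule order_trans[OF keys_sum]) (intro UN_mono order_refl 1)
        show ?thesis unfolding lin_ext_def
          by (rule order_trans[OF keys_sum]) (intro UN_mono order_refl order_trans[OF keys_scl 2])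
      qed
      also have "\<dots> \<subseteq> {x \<in> X. \<forall>k\<in>insert k J. x k \<in> E k}"
      proof
        fix y assume "y \<in> (\<Union>x\<in>keys b. \<Union>e\<in>E k. {x(k := e)})"
        then obtain x e where y: "x \<in> keys b" "e \<in> E k" "y = x(k := e)" by blast
        then have x: "x \<in> X" "\<forall>k\<in>J. x k \<in> E k" using b(1) by (auto simp: B_def)
        have "y \<in> X" unfolding y(3) using x(1) k y(2) E(2)[OF k] by (intro upd_X) auto
        then show "y \<in> {x \<in> X. \<forall>k\<in>insert k J. x k \<in> E k}" using x(2) y by simp
      qed
      finally show ?thesis by (simp add: B_def)
    qed
    ultimately show ?case by blast
  qed
  have zero: "a \<in> N"
    if a: "a \<in> carrier F" and v: "\<And>\<rho>. \<rho> \<in> (\<Pi>\<^sub>E k\<in>K. E k) \<Longrightarrow> val (\<lambda>k. \<epsilon> k (\<rho> k)) a = 0" for a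
  proof -
    obtain b where b: "b \<in> B K" "a - b \<in> N" using red[OF order_refl a] by blast
    have bE: "x \<in> (\<Pi>\<^sub>E k\<in>K. E k)" if "x \<in> keys b" for x
    proof -
      have "x \<in> X" "\<forall>k\<in>K. x k \<in> E k" using b(1) that by (auto simp: B_def)
      then show ?thesis by (auto simp: PiE_iff)
    qed
    have "b = 0"
    proof (rule poly_mapping_eqI)
      fix \<rho>
      show "lookup b \<rho> = lookup 0 \<rho>"
      proof (cases "\<rho> \<in> keys b")
        case True
        then have \<rho>: "\<rho> \<in> (\<Pi>\<^sub>E k\<in>K. E k)" by (rule bE)
        have "val (\<lambda>k. \<epsilon> k (\<rho> k)) (a - b) = 0"
          using \<rho> by (intro val_N b E(3)) auto
        then have "val (\<lambda>k. \<epsilon> k (\<rho> k)) b = 0" using v[OF \<rho>] by (simp add: val_def lin_val_diff)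
        moreover have "(\<Prod>k\<in>K. \<epsilon> k (\<rho> k) (x k)) = (if x = \<rho> then 1 else 0)" if "x \<in> keys b" for x
        proof -
          have x: "x \<in> (\<Pi>\<^sub>E k\<in>K. E k)" using that by (rule bE)
          have "(\<Prod>k\<in>K. \<epsilon> k (\<rho> k) (x k)) = (\<Prod>k\<in>K. if \<rho> k = x k then 1 else 0)"
            using x \<rho> by (intro prod.cong) (simp_all add: E(4) PiE_mem[OF x] PiE_mem[OF \<rho>])
          also have "\<dots> = (if x = \<rho> then 1 else 0)"
          proof (cases "x = \<rho>")
            case False
            then obtain k where "k \<in> K" "\<rho> k \<noteq> x k" using x \<rho> by (metis PiE_ext)
            then show ?thesis using False finite_K by (auto intro!: prod_zero)
          qed simp
          finally show ?thesis .
        qed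
        then have "val (\<lambda>k. \<epsilon> k (\<rho> k)) b = (\<Sum>x\<in>keys b. if x = \<rho> then lookup b x else 0)"
          unfolding val_def lin_val_def by (intro sum.cong) auto
        ultimately show ?thesis using True by simp
      qed (simp add: in_keys_iff)
    qed
    then show ?thesis using b by simp
  qed
  show ?thesis
    unfolding separates_def
  proof (intro ballI impI)
    fix x y assume xy: "x \<in> carrier T" "y \<in> carrier T"
      and eq: "\<forall>\<phi>\<in>(\<lambda>\<rho>. restrict (tensor_functional K (\<lambda>k. \<epsilon> k (\<rho> k))) (carrier T)) ` (\<Pi>\<^sub>E k\<in>K. E k). \<phi> x = \<phi> y"
    then obtain a b where ab: "a \<in> carrier F" "b \<in> carrier F" "x = cls a" "y = cls b"
      by (auto simp: T_simps)
    have "a - b \<in> N"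
    proof (rule zero)
      show "a - b \<in> carrier F" using ab by (intro pm.subspace_diff F_subspace)
      fix \<rho> assume \<rho>: "\<rho> \<in> (\<Pi>\<^sub>E k\<in>K. E k)"
      then have d: "\<And>k. k \<in> K \<Longrightarrow> \<epsilon> k (\<rho> k) \<in> dual (V k)" by (auto intro: E(3))
      have "tensor_functional K (\<lambda>k. \<epsilon> k (\<rho> k)) x = tensor_functional K (\<lambda>k. \<epsilon> k (\<rho> k)) y"
        using bspec[OF eq imageI[OF \<rho>]] xy by simp
      then show "val (\<lambda>k. \<epsilon> k (\<rho> k)) (a - b) = 0"
        using tensor_functional[of "\<lambda>k. \<epsilon> k (\<rho> k)", OF d] by (simp add: ab val_def lin_val_diff)
    qed
    then show "x = y" using ab by (simp add: cls_eq)
  qed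
qed

end

section \<open>Pluecker coordinates as polynomials\<close>

text \<open>The coefficient of \<open>w\<^sub>L\<close> in the wedge product of the rows \<open>e 0, \<dots>, e (i - 1)\<close>.\<close>

definition wdet :: "nat \<Rightarrow> nat set \<Rightarrow> (nat \<Rightarrow> nat \<Rightarrow> 'r::comm_ring_1) \<Rightarrow> 'r" where
  "wdet i L e = det (mat i i (\<lambda>(a, b). e a (sorted_list_of_set L ! b)))"

lemma wdet_cong:
  assumes "finite L" "card L = i" "\<And>a l. a < i \<Longrightarrow> l \<in> L \<Longrightarrow> e a l = e' a l"
  shows "wdet i L e = wdet i L e'"
proof -
  have "mat i i (\<lambda>(a, b). e a (sorted_list_of_set L ! b)) = mat i i (\<lambda>(a, b). e' a (sorted_list_of_set L ! b))"
  proof (rule eq_matI)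
    fix a b assume "a < dim_row (mat i i (\<lambda>(a, b). e' a (sorted_list_of_set L ! b)))"
      "b < dim_col (mat i i (\<lambda>(a, b). e' a (sorted_list_of_set L ! b)))"
    moreover from this have "sorted_list_of_set L ! b \<in> L"
      using assms(1,2) nth_mem[of b "sorted_list_of_set L"] by simp
    ultimately show "mat i i (\<lambda>(a, b). e a (sorted_list_of_set L ! b)) $$ (a, b) =
        mat i i (\<lambda>(a, b). e' a (sorted_list_of_set L ! b)) $$ (a, b)"
      using assms(3) by simp
  qed auto
  then show ?thesis by (simp add: wdet_def)
qed

lemma wdet_hom:
  assumes "comm_ring_hom h"
  shows "h (wdet i L e) = wdet i L (\<lambda>a l. h (e a l))"
proof -
  interpret comm_ring_hom h by fact
  have "map_mat h (mat i i (\<lambda>(a, b). e a (sorted_list_of_set L ! b))) =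
      mat i i (\<lambda>(a, b). h (e a (sorted_list_of_set L ! b)))"
    by (rule eq_matI) auto
  then show ?thesis unfolding wdet_def by (metis hom_det)
qed

lemma wdet_swap:
  assumes "a < i" "a' < i" "a \<noteq> a'"
  shows "wdet i L (e(a := e a', a' := e a)) = - wdet i L e"
proof -
  let ?A = "mat i i (\<lambda>(a, b). e a (sorted_list_of_set L ! b))"
  have "mat i i (\<lambda>(c, b). (e(a := e a', a' := e a)) c (sorted_list_of_set L ! b)) = swaprows a a' ?A"
    using assms by (intro eq_matI) auto
  then show ?thesis unfolding wdet_def using det_swaprows[OF assms, of ?A] by simp
qed

lemma wdet_row_zero:
  assumes "a < i" "\<And>l. l \<in> L \<Longrightarrow> e a l = 0" "finite L" "card L = i"
  shows "wdet i L e = 0"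
proof -
  let ?A = "mat i i (\<lambda>(a, b). e a (sorted_list_of_set L ! b))"
  have "det ?A = (\<Sum>j<i. ?A $$ (a, j) * cofactor ?A a j)"
    by (rule laplace_expansion_row) (use assms in auto)
  also have "\<dots> = 0"
  proof (intro sum.neutral ballI)
    fix j assume "j \<in> {..<i}"
    moreover from this have "sorted_list_of_set L ! j \<in> L"
      using assms(3,4) nth_mem[of j "sorted_list_of_set L"] by simp
    ultimately show "?A $$ (a, j) * cofactor ?A a j = 0" using assms by simp
  qed
  finally show ?thesis by (simp add: wdet_def)
qed

lemma wdet_mult:
  "wdet i L (\<lambda>a l. \<Sum>b<i. C a b * e b l) = det (mat i i (\<lambda>(a, b). C a b)) * wdet i L e"
proof -
  have "mat i i (\<lambda>(a, b). \<Sum>c<i. C a c * e c (sorted_list_of_set L ! b)) =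
      mat i i (\<lambda>(a, b). C a b) * mat i i (\<lambda>(a, b). e a (sorted_list_of_set L ! b))"
    by (rule eq_matI) (auto simp: scalar_prod_def lessThan_atLeast0)
  then show ?thesis unfolding wdet_def by (simp add: det_mult[of _ i])
qed

lemma det_pdiff_const:
  assumes "\<And>a b. a < i \<Longrightarrow> b < i \<Longrightarrow> pdiff x (A $$ (a, b)) = 0" "A \<in> carrier_mat i i"
  shows "pdiff x (det A) = 0"
proof -
  have p: "pdiff x (\<Prod>a\<in>K. g a) = 0" if "finite K" "\<And>a. a \<in> K \<Longrightarrow> pdiff x (g a) = 0"
    for K :: "nat set" and g :: "nat \<Rightarrow> 'a mpoly"
    using that by (induction K) (simp_all add: pdiff_mult)
  have s: "pdiff x (of_int s * q) = of_int s * pdiff x q" for s :: int and q :: "'a mpoly"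
  proof -
    have "of_int s = (single 0 (of_int s) :: 'a mpoly)" by simp
    then show ?thesis using pdiff_scl[of x "of_int s" q] by (metis scl_eq_mult)
  qed
  show ?thesis
    unfolding det_def'[OF assms(2)] pdiff_sum s
  proof (intro sum.neutral ballI)
    fix p assume "p \<in> {p. p permutes {0..<i}}"
    then have "pdiff x (\<Prod>a = 0..<i. A $$ (a, p a)) = 0"
      by (intro p assms(1)) (auto simp: permutes_in_image)
    then show "of_int (sign p) * pdiff x (\<Prod>a = 0..<i. A $$ (a, p a)) = 0" by simp
  qed
qed

text \<open>In the Laplace expansion along the row \<open>a0\<close> the cofactors are constant for \<open>\<partial>\<^sub>x\<close>.\<close>

lemma pdiff_wdet:
  assumes a0: "a0 < i" and const: "\<And>a l. a < i \<Longrightarrow> a \<noteq> a0 \<Longrightarrow> pdiff x (e a l) = 0"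
  shows "pdiff x (wdet i L e) = wdet i L (e(a0 := \<lambda>l. pdiff x (e a0 l)))"
proof -
  let ?s = "\<lambda>b. sorted_list_of_set L ! b"
  let ?e' = "e(a0 := \<lambda>l. pdiff x (e a0 l))"
  let ?A = "mat i i (\<lambda>(a, b). e a (?s b))" and ?B = "mat i i (\<lambda>(a, b). ?e' a (?s b))"
  have cof: "cofactor ?A a0 j = cofactor ?B a0 j" if "j < i" for j
  proof -
    have "mat_delete ?A a0 j = mat_delete ?B a0 j"
      using that a0 by (intro eq_matI) (auto simp: mat_delete_def)
    then show ?thesis by (simp add: cofactor_def)
  qed
  have const_cof: "pdiff x (cofactor ?A a0 j) = 0" if "j < i" for j
  proof -
    have "pdiff x (det (mat_delete ?A a0 j)) = 0"
      using that a0 by (intro det_pdiff_const[of "i - 1"]) (auto simp: mat_delete_def const)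
    then show ?thesis
      unfolding cofactor_def using pdiff_minus[of x "det (mat_delete ?A a0 j)"]
      by (cases "even (a0 + j)") simp_all
  qed
  have "wdet i L e = (\<Sum>j<i. ?A $$ (a0, j) * cofactor ?A a0 j)"
    unfolding wdet_def by (rule laplace_expansion_row) (use a0 in auto)
  then have "pdiff x (wdet i L e) = (\<Sum>j<i. pdiff x (?A $$ (a0, j) * cofactor ?A a0 j))"
    by (simp only: pdiff_sum)
  also have "\<dots> = (\<Sum>j<i. ?B $$ (a0, j) * cofactor ?B a0 j)"
  proof (rule sum.cong[OF refl])
    fix b assume "b \<in> {..<i}"
    then have b: "b < i" by simp
    have "?B $$ (a0, b) = pdiff x (?A $$ (a0, b))" using a0 b by simp
    then show "pdiff x (?A $$ (a0, b) * cofactor ?A a0 b) = ?B $$ (a0, b) * cofactor ?B a0 b"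
      using const_cof[OF b] cof[OF b] by (simp only: pdiff_mult) simp
  qed
  also have "\<dots> = wdet i L ?e'"
    unfolding wdet_def by (rule laplace_expansion_row[symmetric]) (use a0 in auto)
  finally show ?thesis .
qed

definition unit_row :: "nat \<Rightarrow> nat \<Rightarrow> 'r::comm_ring_1" where
  "unit_row k l = (if l = k then 1 else 0)"

text \<open>The rows \<open>w\<^sub>a\<^sub>+\<^sub>1 + \<Sum>\<^sub>l f\<^sub>a\<^sub>+\<^sub>1\<^sub>,\<^sub>l w\<^sub>l\<^sub>+\<^sub>1\<close> (\<open>l \<ge> j\<close>) of the generic point of the open cell.\<close>

definition cell :: "nat \<Rightarrow> nat \<Rightarrow> nat \<Rightarrow> (nat \<times> nat) mpoly" where
  "cell j a l = (if l = a + 1 then 1 else if j < l then pvar (a + 1, l - 1) else 0)"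

definition Delta :: "X_var \<Rightarrow> (nat \<times> nat) mpoly" where
  "Delta = (\<lambda>((i, j), L). wdet i L (cell j))"

lemma finite_W_index: "finite (W_index n \<alpha>)"
  by (cases \<alpha>) (simp add: W_index_def)

lemma X_varsD:
  assumes "((i, j), L) \<in> X_vars n"
  shows "(i, j) \<in> roots n" "L \<subseteq> W_index n (i, j)" "card L = i" "finite L"
  using assms finite_subset[OF _ finite_W_index] by (auto simp: X_vars_def)

lemma rootsD: "(i, j) \<in> roots n \<Longrightarrow> 1 \<le> i \<and> i \<le> j \<and> j < n"
  by (auto simp: roots_def)

lemma roots_iff: "(i, j) \<in> roots n \<longleftrightarrow> 1 \<le> i \<and> i \<le> j \<and> j < n"
  by (auto simp: roots_def)

lemma finite_roots: "finite (roots n)"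
  by (rule finite_subset[of _ "{..n} \<times> {..n}"]) (auto simp: roots_iff)

lemma det_closed:
  assumes "\<And>a b. a < i \<Longrightarrow> b < i \<Longrightarrow> A $$ (a, b) \<in> carrier (poly_alg X)" "A \<in> carrier_mat i i"
  shows "det A \<in> carrier (poly_alg X)"
proof -
  have p: "(\<Prod>a\<in>K. g a) \<in> carrier (poly_alg X)" if "finite K" "\<And>a. a \<in> K \<Longrightarrow> g a \<in> carrier (poly_alg X)"
    for K :: "nat set" and g :: "nat \<Rightarrow> 'a mpoly"
    using that by (induction K) (simp_all add: poly_alg_closed)
  have s: "of_int s * q \<in> carrier (poly_alg X)" if "q \<in> carrier (poly_alg X)" for s :: int and q :: "'a mpoly"
    using that poly_alg_closed(5)[OF that, of "of_int s"] by (simp add: scl_eq_mult)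
  show ?thesis
    unfolding det_def'[OF assms(2)]
    by (intro pm.subspace_sum poly_alg_subspace s p assms(1)) (auto simp: permutes_in_image)
qed

lemma Delta_closed:
  assumes "((i, j), L) \<in> X_vars n"
  shows "Delta ((i, j), L) \<in> carrier (S_alg n)"
proof -
  note X = X_varsD[OF assms] and r = rootsD[OF X_varsD(1)[OF assms]]
  have "cell j a (sorted_list_of_set L ! b) \<in> carrier (S_alg n)" if "a < i" "b < i" for a b
  proof -
    have "sorted_list_of_set L ! b \<in> L" using that X nth_mem[of b "sorted_list_of_set L"] by simp
    then have "sorted_list_of_set L ! b \<le> n" using X(2) r by (auto simp: W_index_def)
    then show ?thesis using that r
      by (auto simp: cell_def roots_iff intro!: poly_alg_closed)
  qed
  then show ?thesis
    unfolding Delta_def by (simp add: wdet_def) (intro det_closed[of i], auto)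
qed

subsection \<open>Differential equations of the minors\<close>

locale fundamental =
  fixes n i j :: nat
  assumes root: "(i, j) \<in> roots n"
begin

lemma ij: "1 \<le> i" "i \<le> j" "j < n"
  using rootsD[OF root] by auto

text \<open>The roots \<open>\<beta> \<ge> \<alpha>\<^sub>i\<^sub>,\<^sub>j\<close>, that is, the positions of the variables in the matrix \<open>cell j\<close> with \<open>i\<close> rows.\<close>

definition inner :: "nat \<times> nat \<Rightarrow> bool" where
  "inner = (\<lambda>(k, l). 1 \<le> k \<and> k \<le> i \<and> j \<le> l \<and> l < n)"

lemma inner_root: "inner \<beta> \<Longrightarrow> \<beta> \<in> roots n"
  using ij by (cases \<beta>) (auto simp: inner_def roots_iff)

lemma root_ge_iff:
  assumes "\<beta> \<in> roots n" shows "root_ge \<beta> (i, j) \<longleftrightarrow> inner \<beta>"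
proof (cases \<beta>)
  case (Pair k l)
  then have kl: "1 \<le> k" "k \<le> l" "l < n" using assms rootsD by auto
  have "root_ge \<beta> (i, j) \<longleftrightarrow> k \<le> i \<and> j \<le> l"
  proof
    assume "root_ge \<beta> (i, j)"
    then have "0 \<le> root_coords \<beta> m - root_coords (i, j) m" for m by (simp add: root_ge_def)
    from this[of i] this[of j] show "k \<le> i \<and> j \<le> l"
      using ij by (auto simp: root_coords_def Pair split: if_splits)
  next
    assume "k \<le> i \<and> j \<le> l"
    then show "root_ge \<beta> (i, j)" by (auto simp: root_ge_def root_coords_def Pair)
  qed
  then show ?thesis using kl by (simp add: inner_def Pair)
qed

lemma pdiff_cell:
  assumes "(k, l) \<in> roots n"
  shows "a < i \<Longrightarrow> a + 1 \<noteq> k \<Longrightarrow> pdiff (k, l) (cell j a m) = 0"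
    and "a < i \<Longrightarrow> \<not> inner (k, l) \<Longrightarrow> pdiff (k, l) (cell j a m) = 0"
    and "inner (k, l) \<Longrightarrow> pdiff (k, l) (cell j (k - 1) m) = unit_row (l + 1) m"
  using rootsD[OF assms] ij by (auto simp: cell_def pdiff_pvar inner_def unit_row_def)

lemma pdiff_Delta_outer:
  assumes "\<beta> \<in> roots n" "\<not> inner \<beta>" "((i, j), L) \<in> X_vars n"
  shows "pdiff \<beta> (Delta ((i, j), L)) = 0"
proof (cases \<beta>)
  case (Pair k l)
  have "pdiff (k, l) (wdet i L (cell j)) = wdet i L ((cell j)(0 := \<lambda>m. pdiff (k, l) (cell j 0 m)))"
    using ij assms by (intro pdiff_wdet) (auto simp: Pair pdiff_cell)
  also have "\<dots> = 0"
    by (rule wdet_row_zero[of 0]) (use ij assms X_varsD[OF assms(3)] in \<open>auto simp: Pair pdiff_cell\<close>)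
  finally show ?thesis by (simp add: Delta_def Pair)
qed

lemma pdiff_unit_row [simp]: "pdiff x (unit_row k l) = 0"
  by (simp add: unit_row_def)

text \<open>The two variables of a second derivative replace two rows by unit vectors; exchanging the columns
  \<open>l\<close> and \<open>l'\<close> exchanges these two rows, which changes the sign of the determinant.\<close>

lemma pdiff_Delta_permanent:
  assumes in1: "inner (k, l)" and in2: "inner (k', l')" and L: "((i, j), L) \<in> X_vars n"
  shows "pdiff (k, l) (pdiff (k', l') (Delta ((i, j), L))) +
    pdiff (k, l') (pdiff (k', l) (Delta ((i, j), L))) = 0"
proof -
  \<comment> \<open>Two derivatives in the same row kill a determinant, which is linear in each row.\<close>
  have D: "pdiff (k, l) (pdiff (k', l') (Delta ((i, j), L))) = (if k = k' then 0 else
      wdet i L ((cell j)(k' - 1 := unit_row (l' + 1), k - 1 := unit_row (l + 1))))"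
    if i1: "inner (k, l)" and i2: "inner (k', l')" for l l'
  proof -
    have r: "(k, l) \<in> roots n" "(k', l') \<in> roots n" using that inner_root by auto
    have k: "k - 1 < i" "k' - 1 < i" "1 \<le> k" "1 \<le> k'" using that by (auto simp: inner_def)
    let ?e = "(cell j)(k' - 1 := unit_row (l' + 1))"
    have "pdiff (k', l') (Delta ((i, j), L)) =
        wdet i L ((cell j)(k' - 1 := \<lambda>m. pdiff (k', l') (cell j (k' - 1) m)))"
      unfolding Delta_def prod.case using k r by (intro pdiff_wdet pdiff_cell) auto
    also have "(\<lambda>m. pdiff (k', l') (cell j (k' - 1) m)) = unit_row (l' + 1)"
      using pdiff_cell(3)[OF r(2) i2] by blast
    finally have 1: "pdiff (k', l') (Delta ((i, j), L)) = wdet i L ?e" .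
    have "pdiff (k, l) (wdet i L ?e) = wdet i L (?e(k - 1 := \<lambda>m. pdiff (k, l) (?e (k - 1) m)))"
      using k r by (intro pdiff_wdet) (auto simp: pdiff_cell(1))
    also have "\<dots> = (if k = k' then 0 else wdet i L (?e(k - 1 := unit_row (l + 1))))"
    proof (cases "k = k'")
      case True
      have "wdet i L (?e(k - 1 := \<lambda>m. pdiff (k, l) (?e (k - 1) m))) = 0"
        by (rule wdet_row_zero[of "k - 1"]) (use k True X_varsD[OF L] in auto)
      then show ?thesis using True by simp
    next
      case False
      then have "k - 1 \<noteq> k' - 1" using k by auto
      then have "(\<lambda>m. pdiff (k, l) (?e (k - 1) m)) = unit_row (l + 1)"
        using pdiff_cell(3)[OF r(1) i1] by (simp add: fun_eq_iff)
      then show ?thesis using False by simp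
    qed
    finally show ?thesis using 1 by simp
  qed
  have in3: "inner (k, l')" "inner (k', l)" using in1 in2 by (auto simp: inner_def)
  show ?thesis
  proof (cases "k = k'")
    case False
    have k: "k - 1 < i" "k' - 1 < i" "k - 1 \<noteq> k' - 1" using in1 in2 False by (auto simp: inner_def)
    let ?e = "(cell j)(k' - 1 := unit_row (l' + 1), k - 1 := unit_row (l + 1))"
    have "wdet i L (?e(k - 1 := ?e (k' - 1), k' - 1 := ?e (k - 1))) = - wdet i L ?e"
      by (rule wdet_swap) (use k in auto)
    moreover have "?e(k - 1 := ?e (k' - 1), k' - 1 := ?e (k - 1)) =
        (cell j)(k' - 1 := unit_row (l + 1), k - 1 := unit_row (l' + 1))"
      using k by (auto simp: fun_eq_iff)
    ultimately show ?thesis using D[OF in1 in2] D[OF in3] False by simp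
  qed (use D[OF in1 in2] D[OF in3] in simp)
qed

end

section \<open>The fundamental modules\<close>

lemma poly_alg_idealI:
  assumes "pm.subspace U" "U \<subseteq> carrier (poly_alg A)"
    "\<And>p q. p \<in> U \<Longrightarrow> q \<in> carrier (poly_alg A) \<Longrightarrow> q * p \<in> U"
  shows "ideal U (poly_alg A)"
proof (rule idealI)
  interpret cring "poly_alg A" by (rule cring_poly_alg)
  show "ring (poly_alg A)" by (rule ring_axioms)
  show "subgroup U (add_monoid (poly_alg A))"
  proof (rule add.subgroupI)
    fix a assume a: "a \<in> U"
    then have "- a \<in> U" using assms(1) by (simp add: pm.subspace_neg)
    moreover have "\<ominus>\<^bsub>poly_alg A\<^esub> a = - a"
      using a assms(2) poly_alg_uminus by (intro minus_equality) auto
    ultimately show "\<ominus>\<^bsub>poly_alg A\<^esub> a \<in> U" by simp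
  qed (use assms in \<open>auto simp: pm.subspace_def\<close>)
qed (use assms in \<open>auto simp: mult.commute\<close>)

lemma poly_alg_idealD:
  assumes "ideal J (poly_alg A)"
  shows "pm.subspace J" "J \<subseteq> carrier (poly_alg A)"
    "\<And>p q. p \<in> J \<Longrightarrow> q \<in> carrier (poly_alg A) \<Longrightarrow> q * p \<in> J"
proof -
  interpret ideal J "poly_alg A" by fact
  show 1: "q * p \<in> J" if "p \<in> J" "q \<in> carrier (poly_alg A)" for p q
    using I_l_closed[OF that] by simp
  show "J \<subseteq> carrier (poly_alg A)" by (rule a_subset)
  show "pm.subspace J"
    unfolding pm.subspace_def
  proof (intro conjI allI ballI)
    show "0 \<in> J" using additive_subgroup.zero_closed[OF additive_subgroup_axioms] by simp
    fix x y assume "x \<in> J" "y \<in> J"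
    then show "x + y \<in> J" using additive_subgroup.a_closed[OF additive_subgroup_axioms] by simp
  next
    fix c x assume "x \<in> J"
    then show "scl c x \<in> J"
      using 1[of x "single 0 c"] poly_alg_closed(7)[of 0 A c] by (simp add: scl_eq_mult)
  qed
qed

context fundamental
begin

subsection \<open>The ideal annihilates the minors\<close>

text \<open>With the convention \<open>f\<^sub>k\<^sub>,\<^sub>l = 0\<close> for \<open>k > l\<close> the following formulas hold for all indices.\<close>

definition Fvar :: "nat \<Rightarrow> nat \<Rightarrow> (nat \<times> nat) mpoly" where
  "Fvar k l = (if (k, l) \<in> roots n then pvar (k, l) else 0)"

text \<open>A \<open>2 \<times> 2\<close> permanent of the matrix \<open>(f\<^sub>k\<^sub>,\<^sub>l)\<close>, up to a factor \<open>2\<close> on the diagonal the square of a variable.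
  Such permanents span the image of the summand \<open>S\<^sup>2 \<otimes> S\<^sup>2\<close> of the quadratic polynomials.\<close>

definition perm :: "nat \<Rightarrow> nat \<Rightarrow> nat \<Rightarrow> nat \<Rightarrow> (nat \<times> nat) mpoly" where
  "perm k k' l l' = Fvar k l * Fvar k' l' + Fvar k l' * Fvar k' l"

lemma Fvar_inner: "inner (k, l) \<Longrightarrow> Fvar k l = pvar (k, l)"
  using inner_root by (simp add: Fvar_def)

lemma Fvar_closed: "Fvar k l \<in> carrier (S_alg n)"
  by (simp add: Fvar_def poly_alg_closed)

lemma ad_add: "ad_derivation n x (p + q) = ad_derivation n x p + ad_derivation n x q"
  and ad_scl: "ad_derivation n x (scl c p) = scl c (ad_derivation n x p)"
  and ad_mult: "ad_derivation n x (p * q) = ad_derivation n x p * q + p * ad_derivation n x q"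
  by (simp_all add: ad_derivation_def pdiff_add pdiff_scl pdiff_mult algebra_simps sum.distrib
      scl_mult_left scl_mult_right pm.scale_sum_right sum_distrib_left sum_distrib_right)

lemma ad_pvar:
  assumes "\<beta> \<in> roots n"
  shows "ad_derivation n x (pvar \<beta>) = ad_mod_borel n x \<beta>"
proof -
  have "ad_derivation n x (pvar \<beta>) = (\<Sum>\<gamma>\<in>roots n. if \<gamma> = \<beta> then ad_mod_borel n x \<beta> else 0)"
    unfolding ad_derivation_def by (rule sum.cong) (auto simp: pdiff_pvar)
  then show ?thesis using assms finite_roots by simp
qed

text \<open>The commutator with a matrix unit, taken modulo \<open>\<bb>\<close>. Upper triangularity of \<open>x\<close> makes both sums vanish
  for \<open>k > l\<close>, where the left-hand side is zero by convention.\<close>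

lemma ad_Fvar:
  assumes x: "x \<in> borel_sl n" and k: "1 \<le> k" "k < n" and l: "1 \<le> l" "l < n"
  shows "ad_derivation n x (Fvar k l) =
    (\<Sum>s=1..<n. scl (x $$ (s, l)) (Fvar k s)) - (\<Sum>s=1..<n. scl (x $$ (k - 1, s - 1)) (Fvar s l))"
proof -
  have xc: "x \<in> carrier_mat n n" and upper: "\<And>a b. b < a \<Longrightarrow> a < n \<Longrightarrow> x $$ (a, b) = 0"
    using x by (auto simp: borel_sl_def upper_triangular_def)
  show ?thesis
  proof (cases "k \<le> l")
    case False
    have "scl (x $$ (s, l)) (Fvar k s) = 0" if "s \<in> {1..<n}" for s
      using that False upper[of l s] by (cases "l < s") (auto simp: Fvar_def roots_iff)
    then have z1: "(\<Sum>s=1..<n. scl (x $$ (s, l)) (Fvar k s)) = 0" by (intro sum.neutral ballI)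
    have "scl (x $$ (k - 1, s - 1)) (Fvar s l) = 0" if "s \<in> {1..<n}" for s
      using that False k upper[of "s - 1" "k - 1"] by (cases "s < k") (auto simp: Fvar_def roots_iff)
    then have z2: "(\<Sum>s=1..<n. scl (x $$ (k - 1, s - 1)) (Fvar s l)) = 0" by (intro sum.neutral ballI)
    have "ad_derivation n x (Fvar k l) = 0" using False by (simp add: Fvar_def roots_iff ad_derivation_def)
    then show ?thesis unfolding z1 z2 by simp
  next
    case True
    then have r: "(k, l) \<in> roots n" using k l by (simp add: roots_iff)
    have 1: "(x * f_mat n (k, l)) $$ (t, s - 1) = (if s = k then x $$ (t, l) else 0)"
      if "1 \<le> s" "s < n" "t < n" for s t
    proof -
      have "(x * f_mat n (k, l)) $$ (t, s - 1) = (\<Sum>u = 0..<n. x $$ (t, u) * (if u = l \<and> s - 1 = k - 1 then 1 else 0))"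
        using that xc by (simp add: f_mat_def scalar_prod_def)
      also have "\<dots> = (\<Sum>u = 0..<n. if u = l then (if s = k then x $$ (t, l) else 0) else 0)"
        by (rule sum.cong) (use that k in auto)
      also have "\<dots> = (if s = k then x $$ (t, l) else 0)" using l by simp
      finally show ?thesis .
    qed
    have 2: "(f_mat n (k, l) * x) $$ (t, s - 1) = (if t = l then x $$ (k - 1, s - 1) else 0)"
      if "1 \<le> s" "s < n" "t < n" for s t
    proof -
      have "(f_mat n (k, l) * x) $$ (t, s - 1) = (\<Sum>u = 0..<n. (if t = l \<and> u = k - 1 then 1 else 0) * x $$ (u, s - 1))"
        using that xc by (simp add: f_mat_def scalar_prod_def)
      also have "\<dots> = (\<Sum>u = 0..<n. if u = k - 1 then (if t = l then x $$ (k - 1, s - 1) else 0) else 0)"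
        by (rule sum.cong) auto
      also have "\<dots> = (if t = l then x $$ (k - 1, s - 1) else 0)"
        using k less_imp_diff_less[of k n 1] by simp
      finally show ?thesis .
    qed
    have "ad_derivation n x (Fvar k l) = ad_mod_borel n x (k, l)"
      using ad_pvar[OF r] r by (simp add: Fvar_def)
    also have "\<dots> = (\<Sum>(s, t)\<in>roots n. scl ((if s = k then x $$ (t, l) else 0) -
        (if t = l then x $$ (k - 1, s - 1) else 0)) (pvar (s, t)))"
      unfolding ad_mod_borel_def
    proof (rule sum.cong[OF refl], clarify)
      fix s t assume "(s, t) \<in> roots n"
      then have "1 \<le> s" "s < n" "t < n" by (auto simp: roots_iff)
      moreover have "f_mat n (k, l) * x \<in> carrier_mat n n" "x * f_mat n (k, l) \<in> carrier_mat n n"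
        using xc by (auto simp: f_mat_def)
      ultimately show "scl ((x * f_mat n (k, l) - f_mat n (k, l) * x) $$ (t, s - 1)) (pvar (s, t)) =
         scl ((if s = k then x $$ (t, l) else 0) - (if t = l then x $$ (k - 1, s - 1) else 0)) (pvar (s, t))"
        using 1[of s t] 2[of s t] by (subst index_minus_mat) auto
    qed
    also have "\<dots> = (\<Sum>(s, t)\<in>{1..<n} \<times> {1..<n}. scl ((if s = k then x $$ (t, l) else 0) -
        (if t = l then x $$ (k - 1, s - 1) else 0)) (Fvar s t))"
      by (rule sum.mono_neutral_cong_left) (auto simp: Fvar_def roots_iff)
    also have "\<dots> = (\<Sum>s = 1..<n. \<Sum>t = 1..<n. (if s = k then scl (x $$ (t, l)) (Fvar k t) else 0) -
        (if t = l then scl (x $$ (k - 1, s - 1)) (Fvar s l) else 0))"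
      by (subst sum.cartesian_product[symmetric], intro sum.cong)
        (auto simp: pm.scale_left_diff_distrib)
    also have "\<dots> = (\<Sum>s=1..<n. scl (x $$ (s, l)) (Fvar k s)) - (\<Sum>s=1..<n. scl (x $$ (k - 1, s - 1)) (Fvar s l))"
    proof -
      have "(\<Sum>s = 1..<n. \<Sum>t = 1..<n. if s = k then scl (x $$ (t, l)) (Fvar k t) else 0) =
          (\<Sum>s = 1..<n. if s = k then (\<Sum>t = 1..<n. scl (x $$ (t, l)) (Fvar k t)) else 0)"
        by (rule sum.cong) auto
      then show ?thesis using k l by (simp add: sum_subtractf)
    qed
    finally show ?thesis .
  qed
qed

text \<open>A set of generators that is stable under \<open>\<bb>\<close> up to linear combinations.\<close>

definition relations :: "(nat \<times> nat) mpoly set" where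
  "relations = {perm k k' l l' | k k' l l'. {k, k', l, l'} \<subseteq> {1..<n}} \<union>
     {Fvar k l | k l. {k, l} \<subseteq> {1..<n} \<and> \<not> (k \<le> i \<and> j \<le> l)}"

lemma relationsI:
  "{k, k', l, l'} \<subseteq> {1..<n} \<Longrightarrow> perm k k' l l' \<in> relations"
  "{k, l} \<subseteq> {1..<n} \<Longrightarrow> \<not> (k \<le> i \<and> j \<le> l) \<Longrightarrow> Fvar k l \<in> relations"
  unfolding relations_def by blast+

text \<open>The action moves one row index or one column index of the matrix at a time, and it moves it in both
  products of a permanent.\<close>

lemma ad_perm:
  assumes x: "x \<in> borel_sl n" and "{k, k', l, l'} \<subseteq> {1..<n}"
  shows "ad_derivation n x (perm k k' l l') =
    (\<Sum>s=1..<n. scl (x $$ (s, l)) (perm k k' s l') + scl (x $$ (s, l')) (perm k k' l s)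
       - scl (x $$ (k - 1, s - 1)) (perm s k' l l') - scl (x $$ (k' - 1, s - 1)) (perm k s l l'))"
proof -
  have ad: "ad_derivation n x (Fvar a b) =
      (\<Sum>s=1..<n. scl (x $$ (s, b)) (Fvar a s)) - (\<Sum>s=1..<n. scl (x $$ (a - 1, s - 1)) (Fvar s b))"
    if "a \<in> {k, k'}" "b \<in> {l, l'}" for a b
    using that assms by (intro ad_Fvar) auto
  show ?thesis
    unfolding perm_def ad_add ad_mult
    by (simp add: ad scl_mult_left scl_mult_right sum_distrib_left sum_distrib_right
        algebra_simps pm.scale_right_distrib sum.distrib sum_subtractf)
qed

lemma Ub_span_subset:
  "Ub_span n ({pvar \<beta> ^ 2 | \<beta>. \<beta> \<in> roots n \<and> root_ge \<beta> (i, j)} \<union>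
      {pvar \<beta> | \<beta>. \<beta> \<in> roots n \<and> \<not> root_ge \<beta> (i, j)}) \<subseteq> pm.span relations"
  unfolding Ub_span_def
proof (rule hull_minimal, rule subsetI)
  fix p assume "p \<in> {pvar \<beta> ^ 2 | \<beta>. \<beta> \<in> roots n \<and> root_ge \<beta> (i, j)} \<union>
      {pvar \<beta> | \<beta>. \<beta> \<in> roots n \<and> \<not> root_ge \<beta> (i, j)}"
  then consider k l where "p = pvar (k, l) ^ 2" "(k, l) \<in> roots n"
    | k l where "p = pvar (k, l)" "(k, l) \<in> roots n" "\<not> inner (k, l)"
    using root_ge_iff by fastforce
  then show "p \<in> pm.span relations"
  proof cases
    case 1
    have "perm k k l l \<in> relations" using 1(2) by (intro relationsI) (auto simp: roots_iff)
    then have "scl (1/2) (perm k k l l) \<in> pm.span relations" by (intro pm.span_scale pm.span_base)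
    moreover have "perm k k l l = p + p" using 1 by (simp add: perm_def Fvar_def power2_eq_square)
    then have "scl (1/2) (perm k k l l) = scl (1/2 + 1/2) p"
      by (simp only: pm.scale_right_distrib pm.scale_left_distrib)
    ultimately show ?thesis by simp
  next
    case 2
    then have "Fvar k l \<in> relations" by (intro relationsI) (auto simp: roots_iff inner_def)
    then show ?thesis using 2 by (simp add: Fvar_def pm.span_base)
  qed
next
  show "pm.subspace (pm.span relations) \<and>
      (\<forall>x\<in>borel_sl n. \<forall>p\<in>pm.span relations. ad_derivation n x p \<in> pm.span relations)"
  proof (intro conjI ballI)
    fix x p assume x: "x \<in> borel_sl n" and p: "p \<in> pm.span relations"
    have up: "\<And>a b. b < a \<Longrightarrow> a < n \<Longrightarrow> x $$ (a, b) = 0"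
      using x by (auto simp: borel_sl_def upper_triangular_def)
    have sub: "pm.subspace {p. ad_derivation n x p \<in> pm.span relations}"
      unfolding pm.subspace_def
      by (auto simp: ad_add ad_scl pm.span_add pm.span_scale) (simp add: ad_derivation_def pm.span_zero)
    have "relations \<subseteq> {p. ad_derivation n x p \<in> pm.span relations}"
    proof
      fix q assume "q \<in> relations"
      then consider k k' l l' where "q = perm k k' l l'" "{k, k', l, l'} \<subseteq> {1..<n}"
        | k l where "q = Fvar k l" "{k, l} \<subseteq> {1..<n}" "\<not> (k \<le> i \<and> j \<le> l)"
        unfolding relations_def by blast
      then show "q \<in> {p. ad_derivation n x p \<in> pm.span relations}"
      proof cases
        case 1
        have b: "perm a b c d \<in> pm.span relations" if "{a, b, c, d} \<subseteq> {1..<n}" for a b c d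
          using that by (intro pm.span_base relationsI)
        show ?thesis unfolding 1(1) mem_Collect_eq ad_perm[OF x 1(2)]
          by (intro pm.span_sum pm.span_diff pm.span_add pm.span_scale b) (use 1 in auto)
      next
        case 2
        have b: "Fvar a b \<in> pm.span relations" if "{a, b} \<subseteq> {1..<n}" "\<not> (a \<le> i \<and> j \<le> b)" for a b
          using that by (intro pm.span_base relationsI)
        have "scl (x $$ (s, l)) (Fvar k s) \<in> pm.span relations" if "s \<in> {1..<n}" for s
          using that 2 up[of l s] by (cases "l < s") (auto intro!: pm.span_scale b simp: pm.span_zero)
        moreover have "scl (x $$ (k - 1, s - 1)) (Fvar s l) \<in> pm.span relations" if "s \<in> {1..<n}" for s
        proof (cases "s < k")
          case True
          then have "x $$ (k - 1, s - 1) = 0" using that 2(2) by (intro up) auto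
          then show ?thesis by (simp add: pm.span_zero)
        next
          case False
          then show ?thesis using that 2 by (intro pm.span_scale b) auto
        qed
        moreover have "ad_derivation n x q = (\<Sum>s=1..<n. scl (x $$ (s, l)) (Fvar k s)) -
            (\<Sum>s=1..<n. scl (x $$ (k - 1, s - 1)) (Fvar s l))"
          unfolding 2(1) using 2(2) by (intro ad_Fvar x) auto
        ultimately show ?thesis by (auto intro!: pm.span_diff pm.span_sum)
      qed
    qed
    then show "ad_derivation n x p \<in> pm.span relations"
      using pm.span_minimal[OF _ sub] p by blast
  qed simp
qed

abbreviation J where "J \<equiv> I_root n (i, j)"

abbreviation gens where "gens \<equiv> {pvar \<beta> ^ 2 | \<beta>. \<beta> \<in> roots n \<and> root_ge \<beta> (i, j)} \<union>
      {pvar \<beta> | \<beta>. \<beta> \<in> roots n \<and> \<not> root_ge \<beta> (i, j)}"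

lemma relations_closed: "pm.span relations \<subseteq> carrier (S_alg n)"
  by (rule pm.span_minimal[OF _ poly_alg_subspace])
    (auto simp: relations_def perm_def intro!: poly_alg_closed Fvar_closed)

lemma J_ideal: "ideal J (S_alg n)"
proof -
  interpret cring "S_alg n" by (rule cring_poly_alg)
  show ?thesis unfolding I_root_def
    using Ub_span_subset relations_closed by (intro genideal_ideal) blast
qed

lemmas J_subspace = poly_alg_idealD(1)[OF J_ideal]
  and J_sub = poly_alg_idealD(2)[OF J_ideal]
  and J_mult = poly_alg_idealD(3)[OF J_ideal]

text \<open>The polynomials \<open>p\<close> with \<open>\<langle>q p, \<Delta>\<rangle> = 0\<close> for all \<open>q\<close> form an ideal, so it suffices to treat \<open>relations\<close>.\<close>

lemma J_annihilates:
  assumes p: "p \<in> J" and L: "((i, j), L) \<in> X_vars n"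
  shows "pairing p (Delta ((i, j), L)) = 0"
proof -
  let ?D = "Delta ((i, j), L)"
  define Ann where "Ann = {p \<in> carrier (S_alg n). \<forall>q. pairing (q * p) ?D = 0}"
  interpret cring "S_alg n" by (rule cring_poly_alg)
  have Ann_sub: "pm.subspace Ann"
    unfolding pm.subspace_def Ann_def
    by (auto simp: poly_alg_closed distrib_left pairing_add_left scl_mult_right pairing_scl_left)
  have "Fvar k l \<in> Ann" if "\<not> inner (k, l)" for k l
  proof -
    have "pairing (q * Fvar k l) ?D = 0" for q
      unfolding mult.commute[of q] using pdiff_Delta_outer[OF _ that L] by (simp add: Fvar_def pairing_pvar)
    then show ?thesis using Fvar_closed by (simp add: Ann_def)
  qed
  moreover have "perm k k' l l' \<in> Ann" for k k' l l'
  proof -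
    have 1: "pairing (q * (Fvar a b * Fvar c d)) ?D = 0" if "\<not> inner (a, b) \<or> \<not> inner (c, d)" for a b c d q
    proof -
      have "pairing (Fvar a b * q) ?D = 0" if "\<not> inner (a, b)" for a b q
        using that pdiff_Delta_outer[OF _ that L] by (simp add: Fvar_def pairing_pvar)
      from this[of a b "q * Fvar c d"] this[of c d "q * Fvar a b"] that show ?thesis by (auto simp: ac_simps)
    qed
    have 2: "pairing (q * (Fvar a b * Fvar c d)) ?D = pairing q (pdiff (a, b) (pdiff (c, d) ?D))"
      if "inner (a, b)" "inner (c, d)" for a b c d q
    proof -
      have "q * (Fvar a b * Fvar c d) = pvar (c, d) * (pvar (a, b) * q)"
        using that by (simp add: Fvar_inner ac_simps)
      then show ?thesis by (simp only: pairing_pvar)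
    qed
    have "pairing (q * perm k k' l l') ?D = 0" for q
    proof (cases "inner (k, l) \<and> inner (k', l')")
      case True
      then have "inner (k, l')" "inner (k', l)" by (auto simp: inner_def)
      then show ?thesis
        using True pdiff_Delta_permanent[of k l k' l' L] L
        by (simp add: perm_def distrib_left pairing_add_left 2 flip: pairing_add_right)
    next
      case False
      then have "\<not> inner (k, l') \<or> \<not> inner (k', l)" by (auto simp: inner_def)
      then show ?thesis using False by (simp add: perm_def distrib_left pairing_add_left 1)
    qed
    then show ?thesis by (auto simp: Ann_def perm_def intro!: poly_alg_closed Fvar_closed)
  qed
  ultimately have "relations \<subseteq> Ann" by (auto simp: relations_def inner_def)
  then have "pm.span relations \<subseteq> Ann" by (intro pm.span_minimal Ann_sub)
  moreover have "ideal Ann (S_alg n)"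
    by (rule poly_alg_idealI[OF Ann_sub]) (auto simp: Ann_def poly_alg_closed simp flip: mult.assoc)
  ultimately have "J \<subseteq> Ann"
    unfolding I_root_def using Ub_span_subset by (intro genideal_minimal) auto
  then have "pairing (1 * p) ?D = 0" using p unfolding Ann_def by blast
  then show ?thesis by simp
qed

subsection \<open>Relations in the ideal\<close>

abbreviation H where "H \<equiv> Ub_span n gens"

lemma H_sub_J: "H \<subseteq> J"
proof -
  interpret cring "S_alg n" by (rule cring_poly_alg)
  show ?thesis unfolding I_root_def
    using Ub_span_subset relations_closed by (intro genideal_self) blast
qed

lemma H_closed: "pm.subspace H" "x \<in> borel_sl n \<Longrightarrow> p \<in> H \<Longrightarrow> ad_derivation n x p \<in> H" "gens \<subseteq> H"
proof -
  have "(\<lambda>U. pm.subspace U \<and> (\<forall>x\<in>borel_sl n. \<forall>p\<in>U. ad_derivation n x p \<in> U)) H"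
    unfolding Ub_span_def by (rule hull_in) (auto simp: pm.subspace_def)
  then show "pm.subspace H" "x \<in> borel_sl n \<Longrightarrow> p \<in> H \<Longrightarrow> ad_derivation n x p \<in> H" by blast+
  show "gens \<subseteq> H" unfolding Ub_span_def by (rule hull_subset)
qed

lemma pvar_outer_in_J:
  assumes "\<beta> \<in> roots n" "\<not> inner \<beta>" shows "pvar \<beta> \<in> J"
proof -
  have "pvar \<beta> \<in> gens" using assms root_ge_iff by blast
  then show ?thesis using H_closed(3) H_sub_J by blast
qed

text \<open>Matrix units; above the diagonal they lie in \<open>\<bb>\<close>.\<close>

definition elem :: "nat \<Rightarrow> nat \<Rightarrow> complex mat" where
  "elem a b = mat n n (\<lambda>(c, d). if c = a \<and> d = b then 1 else 0)"

lemma elem_borel: "a < b \<Longrightarrow> elem a b \<in> borel_sl n"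
  by (auto simp: elem_def borel_sl_def upper_triangular_def intro!: sum.neutral)

lemma elem_index: "c < n \<Longrightarrow> d < n \<Longrightarrow> elem a b $$ (c, d) = (if c = a \<and> d = b then 1 else 0)"
  by (simp add: elem_def)

lemma ad_elem:
  assumes "inner (k, l)" "a < b" "b < n"
  shows "ad_derivation n (elem a b) (Fvar k l) =
    (if b = l then Fvar k a else 0) - (if a = k - 1 then Fvar (b + 1) l else 0)"
proof -
  have kl: "1 \<le> k" "k < n" "1 \<le> l" "l < n" using assms ij by (auto simp: inner_def)
  have "(\<Sum>s=1..<n. scl (elem a b $$ (s, l)) (Fvar k s)) = (\<Sum>s=1..<n. if s = a then (if b = l then Fvar k a else 0) else 0)"
    by (rule sum.cong) (use kl in \<open>auto simp: elem_index\<close>)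
  also have "\<dots> = (if b = l then Fvar k a else 0)"
  proof (cases "a = 0")
    case True
    then show ?thesis by (auto simp: Fvar_def roots_iff intro!: sum.neutral)
  qed (use assms in auto)
  finally have 1: "(\<Sum>s=1..<n. scl (elem a b $$ (s, l)) (Fvar k s)) = (if b = l then Fvar k a else 0)" .
  have "(\<Sum>s=1..<n. scl (elem a b $$ (k - 1, s - 1)) (Fvar s l)) =
      (\<Sum>s=1..<n. if s = b + 1 then (if a = k - 1 then Fvar (b + 1) l else 0) else 0)"
    by (rule sum.cong) (use kl in \<open>auto simp: elem_index\<close>)
  also have "\<dots> = (if a = k - 1 then Fvar (b + 1) l else 0)"
    using assms(3) by (cases "b + 1 < n") (auto simp: Fvar_def roots_iff)
  finally show ?thesis
    using 1 ad_Fvar[OF elem_borel[OF assms(2)] kl] by simp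
qed

lemma Fvar_sq_in_H: "inner (k, l) \<Longrightarrow> Fvar k l * Fvar k l \<in> H"
  using H_closed(3) root_ge_iff[OF inner_root] inner_root
  by (fastforce simp: Fvar_inner power2_eq_square)

text \<open>A matrix unit that moves the row \<open>k\<close> to \<open>k'\<close> sends \<open>f\<^sub>k\<^sub>,\<^sub>l\<^sup>2\<close> to \<open>- 2 f\<^sub>k\<^sub>,\<^sub>l f\<^sub>k'\<^sub>,\<^sub>l\<close>.\<close>

lemma same_column_in_H:
  assumes "inner (k, l)" "inner (k', l)"
  shows "Fvar k l * Fvar k' l \<in> H"
proof -
  have *: "Fvar k l * Fvar k' l \<in> H" if "inner (k, l)" "inner (k', l)" "k < k'" for k k'
  proof -
    have k: "1 \<le> k" "k' \<le> i" "j \<le> l" "l < n" using that by (auto simp: inner_def)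
    have "ad_derivation n (elem (k - 1) (k' - 1)) (Fvar k l) = - Fvar k' l"
      using k that(3) ij by (subst ad_elem[OF that(1)]) auto
    then have ad: "ad_derivation n (elem (k - 1) (k' - 1)) (Fvar k l * Fvar k l) =
        - (Fvar k l * Fvar k' l) - Fvar k l * Fvar k' l"
      by (simp only: ad_mult) (simp add: mult.commute)
    have "ad_derivation n (elem (k - 1) (k' - 1)) (Fvar k l * Fvar k l) \<in> H"
      using that k by (intro H_closed elem_borel Fvar_sq_in_H) auto
    then have "scl (- (1/2)) (- (Fvar k l * Fvar k' l) - Fvar k l * Fvar k' l) \<in> H"
      unfolding ad by (rule pm.subspace_scale[OF H_closed(1)])
    also have "scl (- (1/2)) (- (Fvar k l * Fvar k' l) - Fvar k l * Fvar k' l) = scl (1/2 + 1/2) (Fvar k l * Fvar k' l)"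
      by (simp only: pm.scale_right_diff_distrib pm.scale_left_distrib pm.scale_minus_left pm.scale_minus_right
          minus_minus diff_minus_eq_add)
    finally show ?thesis by simp
  qed
  show ?thesis
    using *[of k k'] *[of k' k] assms Fvar_sq_in_H[of k l] by (cases k k' rule: linorder_cases) (auto simp: mult.commute)
qed

text \<open>A matrix unit that moves the column \<open>l\<close> to \<open>l'\<close> sends \<open>f\<^sub>k\<^sub>,\<^sub>l f\<^sub>k'\<^sub>,\<^sub>l\<close> to the permanent.\<close>

lemma perm_in_J:
  assumes "inner (k, l)" "inner (k', l')"
  shows "perm k k' l l' \<in> J"
proof -
  have *: "perm k k' l l' \<in> H" if "inner (k, l)" "inner (k', l')" "l' < l" for l l'
  proof -
    have k: "1 \<le> k" "k \<le> i" "1 \<le> k'" "k' \<le> i" "j \<le> l'" "l < n" using that by (auto simp: inner_def)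
    have in': "inner (k', l)" using that by (auto simp: inner_def)
    have "ad_derivation n (elem l' l) (Fvar k l) = Fvar k l'"
      "ad_derivation n (elem l' l) (Fvar k' l) = Fvar k' l'"
      using k that(3) ij by (subst ad_elem; use that in' in auto)+
    then have "ad_derivation n (elem l' l) (Fvar k l * Fvar k' l) = perm k k' l l'"
      by (simp add: ad_mult perm_def)
    moreover have "ad_derivation n (elem l' l) (Fvar k l * Fvar k' l) \<in> H"
      using that in' by (intro H_closed elem_borel same_column_in_H)
    ultimately show ?thesis by simp
  qed
  have in': "inner (k, l')" "inner (k', l)" using assms by (auto simp: inner_def)
  have "perm k k' l l' = perm k k' l' l" by (simp add: perm_def)
  moreover have "perm k k' l l \<in> H"
    unfolding perm_def using assms in' by (intro pm.subspace_add H_closed same_column_in_H)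
  ultimately have "perm k k' l l' \<in> H"
    using *[of l l'] *[of l' l] assms in' by (cases l l' rule: linorder_cases) auto
  then show ?thesis using H_sub_J by blast
qed

end

context fundamental
begin

subsection \<open>Spanning monomials\<close>

text \<open>Such a \<open>\<tau>\<close> stands for the wedge product \<open>w\<^bsub>\<tau> 0\<^esub> \<and> \<dots> \<and> w\<^bsub>\<tau> (i - 1)\<^esub>\<close>, obtained from \<open>w\<^sub>1 \<and> \<dots> \<and> w\<^sub>i\<close> by
  replacing some of the factors by vectors \<open>w\<^sub>l\<close> with \<open>l > j\<close>.\<close>

definition valid :: "(nat \<Rightarrow> nat) \<Rightarrow> bool" where
  "valid \<tau> \<longleftrightarrow> (\<forall>a<i. \<tau> a = a + 1 \<or> j < \<tau> a \<and> \<tau> a \<le> n) \<and> inj_on \<tau> {..<i}"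

definition moved :: "(nat \<Rightarrow> nat) \<Rightarrow> nat set" where
  "moved \<tau> = {a. a < i \<and> \<tau> a \<noteq> a + 1}"

text \<open>The monomial in the \<open>f\<^sub>k\<^sub>,\<^sub>l\<close> that carries out these replacements.\<close>

definition mono :: "(nat \<Rightarrow> nat) \<Rightarrow> (nat \<times> nat) mpoly" where
  "mono \<tau> = (\<Prod>a\<in>moved \<tau>. pvar (a + 1, \<tau> a - 1))"

lemma finite_moved [simp]: "finite (moved \<tau>)"
  by (simp add: moved_def)

lemma moved_inner: "valid \<tau> \<Longrightarrow> a \<in> moved \<tau> \<Longrightarrow> inner (a + 1, \<tau> a - 1)"
  and moved_gt: "valid \<tau> \<Longrightarrow> a \<in> moved \<tau> \<Longrightarrow> j < \<tau> a \<and> \<tau> a \<le> n"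
  using ij by (auto simp: valid_def moved_def inner_def)

lemma mono_closed: "valid \<tau> \<Longrightarrow> mono \<tau> \<in> carrier (S_alg n)"
proof -
  assume v: "valid \<tau>"
  have "(\<Prod>a\<in>K. pvar (a + 1, \<tau> a - 1)) \<in> carrier (S_alg n)" if "finite K" "K \<subseteq> moved \<tau>" for K
    using that
  proof (induction K)
    case (insert a K)
    then show ?case using inner_root[OF moved_inner[OF v, of a]]
      by (simp add: poly_alg_closed)
  qed (simp add: poly_alg_closed)
  then show ?thesis by (simp add: mono_def)
qed

lemma J_sum_diff: "p \<in> J \<Longrightarrow> q \<in> J \<Longrightarrow> p + q \<in> J" "p \<in> J \<Longrightarrow> q \<in> J \<Longrightarrow> p - q \<in> J"
  "p \<in> J \<Longrightarrow> scl c p \<in> J" "0 \<in> J" "p \<in> J \<Longrightarrow> - p \<in> J"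
  using J_subspace by (auto simp: pm.subspace_add pm.subspace_diff pm.subspace_scale pm.subspace_0 pm.subspace_neg)

text \<open>Two variables in the same row or column form a permanent with two equal terms.\<close>

lemma prod_pair_in_J:
  assumes "inner (k, l)" "inner (k', l')" "k = k' \<or> l = l'"
  shows "pvar (k, l) * pvar (k', l') \<in> J"
proof -
  have "perm k k' l l' = pvar (k, l) * pvar (k', l') + pvar (k, l) * pvar (k', l')"
    using assms by (auto simp: perm_def Fvar_inner)
  then have "scl (1/2) (pvar (k, l) * pvar (k', l') + pvar (k, l) * pvar (k', l')) \<in> J"
    using J_sum_diff(3)[OF perm_in_J[OF assms(1,2)], of "1/2"] by simp
  also have "scl (1/2) (pvar (k, l) * pvar (k', l') + pvar (k, l) * pvar (k', l')) =
      scl (1/2 + 1/2) (pvar (k, l) * pvar (k', l'))"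
    by (simp only: pm.scale_right_distrib pm.scale_left_distrib)
  finally show ?thesis by simp
qed

lemma mono_split:
  assumes "a \<in> moved \<tau>"
  shows "mono \<tau> = (\<Prod>b\<in>moved \<tau> - {a}. pvar (b + 1, \<tau> b - 1)) * pvar (a + 1, \<tau> a - 1)"
  unfolding mono_def using assms by (simp add: prod.remove mult.commute)

lemma prod_closed:
  assumes "valid \<tau>" "K \<subseteq> moved \<tau>"
  shows "(\<Prod>b\<in>K. pvar (b + 1, \<tau> b - 1)) \<in> carrier (S_alg n)"
proof -
  have "finite K" using assms(2) finite_moved finite_subset by blast
  then show ?thesis using assms(2)
  proof (induction K)
    case (insert a K)
    then show ?case using inner_root[OF moved_inner[OF assms(1), of a]]
      by (simp add: poly_alg_closed)
  qed (simp add: poly_alg_closed)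
qed

text \<open>A new variable is outside the matrix, or it meets a variable of the monomial in its row or column, or
  it prolongs the monomial.\<close>

lemma pvar_times_mono:
  assumes \<beta>: "\<beta> \<in> roots n" and v: "valid \<tau>"
  shows "pvar \<beta> * mono \<tau> \<in> J \<or> (\<exists>\<tau>'. valid \<tau>' \<and> pvar \<beta> * mono \<tau> = mono \<tau>')"
proof (cases "inner \<beta>")
  case False
  then have "mono \<tau> * pvar \<beta> \<in> J" using \<beta> v by (intro J_mult pvar_outer_in_J mono_closed)
  then show ?thesis by (simp add: mult.commute)
next
  case True
  obtain k l where kl: "\<beta> = (k, l)" by (cases \<beta>)
  have k: "1 \<le> k" "k \<le> i" "j \<le> l" "l < n" using True by (auto simp: kl inner_def)
  have pair: "pvar \<beta> * mono \<tau> \<in> J" if "a \<in> moved \<tau>" "a + 1 = k \<or> \<tau> a - 1 = l" for a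
  proof -
    have "(\<Prod>b\<in>moved \<tau> - {a}. pvar (b + 1, \<tau> b - 1)) * (pvar (a + 1, \<tau> a - 1) * pvar \<beta>) \<in> J"
      unfolding kl using that True v
      by (intro J_mult prod_pair_in_J prod_closed moved_inner) (auto simp: kl)
    then show ?thesis by (simp add: mono_split[OF that(1)] ac_simps)
  qed
  show ?thesis
  proof (cases "\<exists>a\<in>moved \<tau>. a + 1 = k \<or> \<tau> a = l + 1")
    case True
    then show ?thesis using pair by auto
  next
    case False
    then have new: "k - 1 \<notin> moved \<tau>" "\<And>a. a \<in> moved \<tau> \<Longrightarrow> \<tau> a \<noteq> l + 1" using k by auto
    define \<tau>' where "\<tau>' = \<tau>(k - 1 := l + 1)"
    have l_new: "\<tau> a \<noteq> l + 1" if "a < i" for a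
      using new(2)[of a] that k ij by (cases "a \<in> moved \<tau>") (auto simp: moved_def)
    have "valid \<tau>'"
      unfolding valid_def
    proof
      show "\<forall>a<i. \<tau>' a = a + 1 \<or> j < \<tau>' a \<and> \<tau>' a \<le> n"
        using v k by (auto simp: valid_def \<tau>'_def)
      show "inj_on \<tau>' {..<i}"
        unfolding \<tau>'_def
      proof (rule inj_on_fun_updI)
        show "inj_on \<tau> {..<i}" using v by (simp add: valid_def)
        show "l + 1 \<notin> \<tau> ` {..<i}" using l_new by (metis imageE lessThan_iff)
      qed
    qed
    moreover have mv: "moved \<tau>' = insert (k - 1) (moved \<tau>)"
      using k ij by (auto simp: moved_def \<tau>'_def)
    have "(\<Prod>a\<in>moved \<tau>. pvar (a + 1, \<tau>' a - 1)) = mono \<tau>"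
      unfolding mono_def by (rule prod.cong) (use new(1) in \<open>auto simp: \<tau>'_def\<close>)
    then have "mono \<tau>' = pvar \<beta> * mono \<tau>"
      unfolding mono_def[of \<tau>'] mv using new(1) k by (simp add: kl \<tau>'_def del: fun_upd_apply) (simp add: \<tau>'_def)
    ultimately show ?thesis by metis
  qed
qed

lemma mono_cong: "(\<And>a. a < i \<Longrightarrow> \<tau> a = \<tau>' a) \<Longrightarrow> mono \<tau> = mono \<tau>'"
proof -
  assume *: "\<And>a. a < i \<Longrightarrow> \<tau> a = \<tau>' a"
  then have "moved \<tau> = moved \<tau>'" by (auto simp: moved_def)
  then show "mono \<tau> = mono \<tau>'" unfolding mono_def using * by (intro prod.cong) (auto simp: moved_def)
qed

text \<open>Exchanging two values of \<open>\<tau>\<close> changes the sign modulo the ideal, by a permanent. Such exchanges lead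
  from \<open>\<tau>\<close> to any \<open>\<tau>'\<close> with the same values, because values \<open>\<le> j\<close> are never moved.\<close>

lemma mono_range:
  assumes "valid \<tau>" "valid \<tau>'" "\<tau> ` {..<i} = \<tau>' ` {..<i}"
  shows "\<exists>c. mono \<tau> - scl c (mono \<tau>') \<in> J"
  using assms
proof (induction "card {a. a < i \<and> \<tau> a \<noteq> \<tau>' a}" arbitrary: \<tau> rule: less_induct)
  case less
  note v = \<open>valid \<tau>\<close> and v' = \<open>valid \<tau>'\<close> and range = less.prems(3)
  show ?case
  proof (cases "\<forall>a<i. \<tau> a = \<tau>' a")
    case True
    then have "mono \<tau> = mono \<tau>'" by (intro mono_cong) auto
    then show ?thesis using J_sum_diff(4) by (intro exI[of _ 1]) simp
  next
    case False
    then obtain a where a: "a < i" "\<tau> a \<noteq> \<tau>' a" by blast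
    have "\<tau>' a \<in> \<tau> ` {..<i}" using a range by blast
    then obtain a' where a': "a' < i" "\<tau> a' = \<tau>' a" by auto
    have ne: "a \<noteq> a'" using a a' by auto
    have dich: "b \<notin> moved \<sigma> \<longleftrightarrow> \<sigma> b \<le> j" if "valid \<sigma>" "b < i" for \<sigma> b
      using that ij by (auto simp: valid_def moved_def)
    have fix_val: "\<sigma> b = b + 1" if "valid \<sigma>" "b < i" "\<sigma> b \<le> j" for \<sigma> b
      using that by (auto simp: valid_def)
    \<comment> \<open>Values \<open>\<le> j\<close> sit in the same place in \<open>\<tau>\<close> and \<open>\<tau>'\<close>, so both \<open>a\<close> and \<open>a'\<close> carry values \<open>> j\<close>.\<close>
    have "a' \<in> moved \<tau>"
    proof (rule ccontr)
      assume "a' \<notin> moved \<tau>"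
      then have "\<tau> a' = a' + 1" "\<tau>' a \<le> j" using dich[OF v] fix_val[OF v] a' by auto
      then show False using fix_val[OF v' a(1)] a' ne by simp
    qed
    moreover have "a \<in> moved \<tau>"
    proof (rule ccontr)
      assume "a \<notin> moved \<tau>"
      then have ta: "\<tau> a = a + 1" "a + 1 \<le> j" using dich[OF v] fix_val[OF v] a by auto
      have "\<tau> a \<in> \<tau>' ` {..<i}" using a range by blast
      then obtain b where "b < i" "\<tau>' b = a + 1" using ta by auto
      then have "\<tau>' a = a + 1" using fix_val[OF v', of b] ta by auto
      then show False using ta a by simp
    qed
    ultimately have mv: "a \<in> moved \<tau>" "a' \<in> moved \<tau>" by auto
    define \<tau>'' where "\<tau>'' = \<tau>(a := \<tau> a', a' := \<tau> a)"
    define s where "s b = (if b = a then a' else if b = a' then a else b)" for b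
    have s: "\<tau>'' b = \<tau> (s b)" "s (s b) = b" "b < i \<Longrightarrow> s b < i" for b
      using ne a a' by (auto simp: \<tau>''_def s_def)
    have gt: "j < \<tau> a" "j < \<tau> a'" "\<tau> a \<le> n" "\<tau> a' \<le> n" using mv moved_gt[OF v] by auto
    have v'': "valid \<tau>''"
      unfolding valid_def
    proof
      show "\<forall>b<i. \<tau>'' b = b + 1 \<or> j < \<tau>'' b \<and> \<tau>'' b \<le> n"
        using v gt by (auto simp: valid_def \<tau>''_def)
      show "inj_on \<tau>'' {..<i}"
      proof (rule inj_onI)
        fix b c assume "b \<in> {..<i}" "c \<in> {..<i}" "\<tau>'' b = \<tau>'' c"
        then have "s b = s c" using v s by (auto simp: valid_def inj_on_def)
        then show "b = c" using s(2) by metis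
      qed
    qed
    have mv'': "moved \<tau>'' = moved \<tau>"
      using mv gt ij a a' by (auto simp: moved_def \<tau>''_def)
    have range'': "\<tau>'' ` {..<i} = \<tau>' ` {..<i}"
    proof -
      have "\<tau>'' ` {..<i} = \<tau> ` {..<i}"
      proof
        show "\<tau>'' ` {..<i} \<subseteq> \<tau> ` {..<i}" using s by auto
        have "\<tau> b \<in> \<tau>'' ` {..<i}" if "b < i" for b
          using that s by (metis imageI lessThan_iff)
        then show "\<tau> ` {..<i} \<subseteq> \<tau>'' ` {..<i}" by blast
      qed
      then show ?thesis using range by simp
    qed
    have "{b. b < i \<and> \<tau>'' b \<noteq> \<tau>' b} \<subset> {b. b < i \<and> \<tau> b \<noteq> \<tau>' b}"
    proof
      have "\<tau>' a' \<noteq> \<tau>' a" using v' a a' ne by (auto simp: valid_def inj_on_def)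
      then show "{b. b < i \<and> \<tau>'' b \<noteq> \<tau>' b} \<subseteq> {b. b < i \<and> \<tau> b \<noteq> \<tau>' b}"
        using a a' by (auto simp: \<tau>''_def)
      have "a \<in> {b. b < i \<and> \<tau> b \<noteq> \<tau>' b}" "a \<notin> {b. b < i \<and> \<tau>'' b \<noteq> \<tau>' b}"
        using a a' ne by (auto simp: \<tau>''_def)
      then show "{b. b < i \<and> \<tau>'' b \<noteq> \<tau>' b} \<noteq> {b. b < i \<and> \<tau> b \<noteq> \<tau>' b}" by blast
    qed
    then have "card {b. b < i \<and> \<tau>'' b \<noteq> \<tau>' b} < card {b. b < i \<and> \<tau> b \<noteq> \<tau>' b}"
      by (intro psubset_card_mono) auto
    from less.hyps[OF this v'' v' range''] obtain c where c: "mono \<tau>'' - scl c (mono \<tau>') \<in> J" by blast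
    define r where "r = (\<Prod>b\<in>moved \<tau> - {a} - {a'}. pvar (b + 1, \<tau> b - 1))"
    have split: "mono \<sigma> = (\<Prod>b\<in>moved \<tau> - {a} - {a'}. pvar (b + 1, \<sigma> b - 1)) *
        (pvar (a + 1, \<sigma> a - 1) * pvar (a' + 1, \<sigma> a' - 1))" if "moved \<sigma> = moved \<tau>" for \<sigma>
      unfolding mono_def that using mv ne
      by (simp add: prod.remove[of "moved \<tau>" a] prod.remove[of "moved \<tau> - {a}" a'] ac_simps)
    have r'': "(\<Prod>b\<in>moved \<tau> - {a} - {a'}. pvar (b + 1, \<tau>'' b - 1)) = r"
      unfolding r_def by (rule prod.cong) (auto simp: \<tau>''_def)
    have in1: "inner (a + 1, \<tau> a - 1)" "inner (a' + 1, \<tau> a' - 1)" using mv moved_inner[OF v] by auto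
    have in2: "inner (a + 1, \<tau> a' - 1)" "inner (a' + 1, \<tau> a - 1)" using in1 by (auto simp: inner_def)
    have "mono \<tau> + mono \<tau>'' = r * perm (a + 1) (a' + 1) (\<tau> a - 1) (\<tau> a' - 1)"
      unfolding split[OF refl] split[OF mv''] r'' using ne
      by (simp add: perm_def Fvar_inner in1[simplified] in2[simplified] \<tau>''_def r_def distrib_left)
    also have "\<dots> \<in> J"
      unfolding r_def by (intro J_mult perm_in_J in1 prod_closed v) auto
    finally have "mono \<tau> + mono \<tau>'' - (mono \<tau>'' - scl c (mono \<tau>')) \<in> J" by (rule J_sum_diff(2)[OF _ c])
    then have "mono \<tau> - scl (- c) (mono \<tau>') \<in> J" by simp
    then show ?thesis by blast
  qed
qed

definition ranges :: "nat set set" where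
  "ranges = {\<tau> ` {..<i} | \<tau>. valid \<tau>}"

text \<open>Any choice will do, by \<open>mono_range\<close>.\<close>

definition rep :: "nat set \<Rightarrow> nat \<Rightarrow> nat" where
  "rep L = (SOME \<tau>. valid \<tau> \<and> \<tau> ` {..<i} = L)"

lemma rep:
  assumes "L \<in> ranges" shows "valid (rep L) \<and> rep L ` {..<i} = L"
proof -
  have "\<exists>\<tau>. valid \<tau> \<and> \<tau> ` {..<i} = L" using assms by (auto simp: ranges_def)
  then show ?thesis unfolding rep_def by (rule someI_ex)
qed

lemma ranges_X_vars: "L \<in> ranges \<Longrightarrow> ((i, j), L) \<in> X_vars n"
proof -
  assume "L \<in> ranges"
  then obtain \<tau> where t: "valid \<tau>" "L = \<tau> ` {..<i}" by (auto simp: ranges_def)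
  then have "card L = i" by (simp add: valid_def card_image)
  moreover have "L \<subseteq> W_index n (i, j)"
  proof
    fix x assume "x \<in> L"
    then obtain a where "a < i" "x = \<tau> a" using t by auto
    then show "x \<in> W_index n (i, j)" using t(1) by (fastforce simp: valid_def W_index_def)
  qed
  ultimately show ?thesis using root by (simp add: X_vars_def)
qed

lemma finite_ranges: "finite ranges"
proof -
  have "ranges \<subseteq> Pow (W_index n (i, j))" using ranges_X_vars X_varsD(2) by blast
  then show ?thesis using finite_W_index finite_subset by blast
qed

lemma spanning:
  assumes "p \<in> carrier (S_alg n)"
  shows "\<exists>x. p - (\<Sum>L\<in>ranges. scl (x L) (mono (rep L))) \<in> J"
  using assms
proof (induction p rule: mpoly_induct)
  have step: "\<exists>x. mono \<tau> - (\<Sum>L\<in>ranges. scl (x L) (mono (rep L))) \<in> J" if v: "valid \<tau>" for \<tau>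
  proof -
    have L: "\<tau> ` {..<i} \<in> ranges" using v by (auto simp: ranges_def)
    then obtain c where c: "mono \<tau> - scl c (mono (rep (\<tau> ` {..<i}))) \<in> J"
      using mono_range[OF v, of "rep (\<tau> ` {..<i})"] rep[OF L] by auto
    have "(\<Sum>L\<in>ranges. scl (if L = \<tau> ` {..<i} then c else 0) (mono (rep L))) =
        (\<Sum>L\<in>ranges. if L = \<tau> ` {..<i} then scl c (mono (rep (\<tau> ` {..<i}))) else 0)"
      by (rule sum.cong) auto
    also have "\<dots> = scl c (mono (rep (\<tau> ` {..<i})))"
      using L finite_ranges by simp
    finally show ?thesis using c by (intro exI[of _ "\<lambda>L. if L = \<tau> ` {..<i} then c else 0"]) simp
  qed
  {
    case one
    have "valid (\<lambda>a. a + 1)" "mono (\<lambda>a. a + 1) = 1" by (auto simp: valid_def mono_def moved_def)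
    then show ?case using step[of "\<lambda>a. a + 1"] by simp
  next
    case (add q r)
    then obtain x y where "q - (\<Sum>L\<in>ranges. scl (x L) (mono (rep L))) \<in> J"
      "r - (\<Sum>L\<in>ranges. scl (y L) (mono (rep L))) \<in> J" by blast
    from J_sum_diff(1)[OF this] show ?case
      by (intro exI[of _ "\<lambda>L. x L + y L"]) (simp add: pm.scale_left_distrib sum.distrib algebra_simps)
  next
    case (scl c q)
    then obtain x where "q - (\<Sum>L\<in>ranges. scl (x L) (mono (rep L))) \<in> J" by blast
    from J_sum_diff(3)[OF this, of c] show ?case
      by (intro exI[of _ "\<lambda>L. c * x L"]) (simp add: pm.scale_right_diff_distrib pm.scale_sum_right)
  next
    case (pvar \<beta> q)
    then obtain x where x: "q - (\<Sum>L\<in>ranges. scl (x L) (mono (rep L))) \<in> J" by blast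
    have "\<exists>y. pvar \<beta> * mono (rep L) - (\<Sum>L'\<in>ranges. scl (y L') (mono (rep L'))) \<in> J" if L: "L \<in> ranges" for L
    proof -
      consider "pvar \<beta> * mono (rep L) \<in> J" | \<tau>' where "valid \<tau>'" "pvar \<beta> * mono (rep L) = mono \<tau>'"
        using pvar_times_mono[OF pvar(1), of "rep L"] rep[OF L] by blast
      then show ?thesis
      proof cases
        case 1 then show ?thesis by (intro exI[of _ "\<lambda>_. 0"]) simp
      next
        case 2 then show ?thesis using step by simp
      qed
    qed
    then have "\<forall>L\<in>ranges. \<exists>y. pvar \<beta> * mono (rep L) - (\<Sum>L'\<in>ranges. scl (y L') (mono (rep L'))) \<in> J"
      by simp
    then have "\<exists>y. \<forall>L\<in>ranges. pvar \<beta> * mono (rep L) - (\<Sum>L'\<in>ranges. scl (y L L') (mono (rep L'))) \<in> J"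
      by (rule bchoice)
    then obtain y where "\<forall>L\<in>ranges. pvar \<beta> * mono (rep L) - (\<Sum>L'\<in>ranges. scl (y L L') (mono (rep L'))) \<in> J" ..
    then have y: "pvar \<beta> * mono (rep L) - (\<Sum>L'\<in>ranges. scl (y L L') (mono (rep L'))) \<in> J" if "L \<in> ranges" for L
      using that by (rule bspec)
    have "pvar \<beta> * (q - (\<Sum>L\<in>ranges. scl (x L) (mono (rep L)))) +
        (\<Sum>L\<in>ranges. scl (x L) (pvar \<beta> * mono (rep L) - (\<Sum>L'\<in>ranges. scl (y L L') (mono (rep L'))))) \<in> J"
      using pvar(1) by (intro J_sum_diff pm.subspace_sum J_subspace J_mult x y poly_alg_closed)
    also have "pvar \<beta> * (q - (\<Sum>L\<in>ranges. scl (x L) (mono (rep L)))) +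
        (\<Sum>L\<in>ranges. scl (x L) (pvar \<beta> * mono (rep L) - (\<Sum>L'\<in>ranges. scl (y L L') (mono (rep L'))))) =
        pvar \<beta> * q - (\<Sum>L\<in>ranges. \<Sum>L'\<in>ranges. scl (x L * y L L') (mono (rep L')))"
      by (simp add: pm.scale_right_diff_distrib sum_subtractf pm.scale_sum_right right_diff_distrib
          sum_distrib_left scl_mult_right)
    also have "(\<Sum>L\<in>ranges. \<Sum>L'\<in>ranges. scl (x L * y L L') (mono (rep L'))) =
        (\<Sum>L'\<in>ranges. scl (\<Sum>L\<in>ranges. x L * y L L') (mono (rep L')))"
      by (subst sum.swap) (simp add: pm.scale_sum_left)
    finally show ?case by (intro exI)
  }
qed

text \<open>Each variable of the monomial differentiates a row of its own and turns it into a unit vector.\<close>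

lemma pairing_mono:
  assumes v: "valid \<tau>" and L: "((i, j), L) \<in> X_vars n"
  shows "pairing (mono \<tau>) (Delta ((i, j), L)) = wdet i L (\<lambda>a. unit_row (\<tau> a))"
proof -
  have D: "pairing (\<Prod>a\<in>K. pvar (a + 1, \<tau> a - 1)) (wdet i L (\<lambda>a. if a \<in> K' then unit_row (\<tau> a) else cell j a))
      = lookup (wdet i L (\<lambda>a. if a \<in> K \<union> K' then unit_row (\<tau> a) else cell j a)) 0"
    if "finite K" "K \<subseteq> moved \<tau>" "K \<inter> K' = {}" for K K'
    using that
  proof (induction K arbitrary: K')
    case (insert a K)
    let ?e = "\<lambda>b. if b \<in> K' then unit_row (\<tau> b) else cell j b"
    have a: "a \<in> moved \<tau>" "a < i" "a \<notin> K'" using insert.prems by (auto simp: moved_def)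
    have inn: "inner (a + 1, \<tau> a - 1)" by (rule moved_inner[OF v a(1)])
    then have r: "(a + 1, \<tau> a - 1) \<in> roots n" by (rule inner_root)
    have "pdiff (a + 1, \<tau> a - 1) (wdet i L ?e) = wdet i L (?e(a := \<lambda>l. pdiff (a + 1, \<tau> a - 1) (?e a l)))"
      using a pdiff_cell(1)[OF r] by (intro pdiff_wdet) auto
    also have "?e(a := \<lambda>l. pdiff (a + 1, \<tau> a - 1) (?e a l)) =
        (\<lambda>b. if b \<in> insert a K' then unit_row (\<tau> b) else cell j b)"
      using a pdiff_cell(3)[OF r inn] moved_gt[OF v a(1)] by (auto simp: fun_eq_iff)
    finally show ?case
      using insert by (simp add: pairing_pvar del: insert_iff) (simp add: disj_left_commute)
  qed simp
  have "pairing (mono \<tau>) (Delta ((i, j), L)) =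
      lookup (wdet i L (\<lambda>a. if a \<in> moved \<tau> then unit_row (\<tau> a) else cell j a)) 0"
    using D[of "moved \<tau>" "{}"] by (simp add: mono_def Delta_def)
  also have "\<dots> = wdet i L (\<lambda>a l. lookup ((if a \<in> moved \<tau> then unit_row (\<tau> a) else cell j a) l) 0)"
    by (rule wdet_hom[OF const_hom])
  also have "\<dots> = wdet i L (\<lambda>a. unit_row (\<tau> a))"
  proof (rule wdet_cong)
    fix a l assume a: "a < i"
    have "lookup (pvar \<beta> :: (nat \<times> nat) mpoly) 0 = 0" for \<beta>
      by (simp add: flip: peval_at_zero)
    then show "lookup ((if a \<in> moved \<tau> then unit_row (\<tau> a) else cell j a) l) 0 = unit_row (\<tau> a) l"
      using a by (auto simp: moved_def unit_row_def cell_def)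
  qed (use X_varsD[OF L] in auto)
  finally show ?thesis .
qed

lemma wdet_unit_zero:
  assumes "((i, j), L) \<in> X_vars n" "card (\<tau> ` {..<i}) = i" "\<tau> ` {..<i} \<noteq> L"
  shows "wdet i L (\<lambda>a. unit_row (\<tau> a) :: nat \<Rightarrow> complex) = 0"
proof -
  have "\<not> \<tau> ` {..<i} \<subseteq> L"
    using assms X_varsD[OF assms(1)] card_subset_eq[of L "\<tau> ` {..<i}"] by auto
  then obtain a where "a < i" "\<tau> a \<notin> L" by auto
  then show ?thesis using X_varsD[OF assms(1)]
    by (intro wdet_row_zero[of a]) (auto simp: unit_row_def)
qed

text \<open>A permutation matrix times its transpose is the identity.\<close>

lemma wdet_unit_nonzero:
  assumes inj: "inj_on \<tau> {..<i}"
  shows "wdet i (\<tau> ` {..<i}) (\<lambda>a. unit_row (\<tau> a) :: nat \<Rightarrow> complex) \<noteq> 0"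
proof -
  define L where "L = \<tau> ` {..<i}"
  define A where "A = mat i i (\<lambda>(a, b). unit_row (\<tau> a) (sorted_list_of_set L ! b) :: complex)"
  have L: "finite L" "card L = i" using inj by (auto simp: L_def card_image)
  have "A * A\<^sup>T = 1\<^sub>m i"
  proof (rule eq_matI)
    fix a a' assume "a < dim_row (1\<^sub>m i)" "a' < dim_col (1\<^sub>m i)"
    then have a: "a < i" "a' < i" by auto
    then have "\<tau> a \<in> set (sorted_list_of_set L)" using L by (simp add: L_def)
    then obtain b where "b < length (sorted_list_of_set L)" and bt: "sorted_list_of_set L ! b = \<tau> a"
      unfolding in_set_conv_nth by blast
    then have b: "b < i" "sorted_list_of_set L ! b = \<tau> a" using L by simp_all
    have uniq: "c = b" if "c < i" "sorted_list_of_set L ! c = \<tau> a" for c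
      using that b L nth_eq_iff_index_eq[of "sorted_list_of_set L" c b] by simp
    have "(A * A\<^sup>T) $$ (a, a') = (\<Sum>c = 0..<i. unit_row (\<tau> a) (sorted_list_of_set L ! c) *
        unit_row (\<tau> a') (sorted_list_of_set L ! c))"
      using a by (simp add: A_def scalar_prod_def)
    also have "\<dots> = (\<Sum>c = 0..<i. if c = b then unit_row (\<tau> a') (\<tau> a) else 0)"
    proof (rule sum.cong[OF refl])
      fix c assume "c \<in> {0..<i}"
      then have "c \<noteq> b \<Longrightarrow> sorted_list_of_set L ! c \<noteq> \<tau> a" using uniq[of c] by auto
      then show "unit_row (\<tau> a) (sorted_list_of_set L ! c) * unit_row (\<tau> a') (sorted_list_of_set L ! c) =
          (if c = b then unit_row (\<tau> a') (\<tau> a) else (0 :: complex))"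
        using b(2) by (cases "c = b") (simp_all add: unit_row_def)
    qed
    also have "\<dots> = (if a = a' then 1 else 0)"
      using b a inj by (auto simp: unit_row_def inj_on_def)
    finally show "(A * A\<^sup>T) $$ (a, a') = 1\<^sub>m i $$ (a, a')" using a by simp
  qed (simp_all add: A_def)
  moreover have "A \<in> carrier_mat i i" by (simp add: A_def)
  ultimately have "det A * det (A\<^sup>T) = 1" using det_mult[of A i "A\<^sup>T"] by simp
  then have "det A \<noteq> 0" by auto
  then show ?thesis by (simp add: wdet_def A_def L_def)
qed

text \<open>Pairing with the minors extracts the coefficients of the representatives of the spanning monomials.\<close>

lemma annihilator_in_J:
  assumes p: "p \<in> carrier (S_alg n)"
    and zero: "\<And>L. ((i, j), L) \<in> X_vars n \<Longrightarrow> pairing p (Delta ((i, j), L)) = 0"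
  shows "p \<in> J"
proof -
  obtain x where x: "p - (\<Sum>L\<in>ranges. scl (x L) (mono (rep L))) \<in> J" using spanning[OF p] by blast
  have "x L = 0" if L: "L \<in> ranges" for L
  proof -
    have X: "((i, j), L) \<in> X_vars n" by (rule ranges_X_vars[OF L])
    have "0 = pairing (\<Sum>L'\<in>ranges. scl (x L') (mono (rep L'))) (Delta ((i, j), L))"
      using J_annihilates[OF x X] zero[OF X] by (simp add: pairing_diff_left)
    also have "\<dots> = (\<Sum>L'\<in>ranges. x L' * wdet i L (\<lambda>a. unit_row (rep L' a)))"
      using rep pairing_mono[OF _ X] by (simp add: pairing_sum_left pairing_scl_left)
    also have "\<dots> = (\<Sum>L'\<in>ranges. if L' = L then x L * wdet i L (\<lambda>a. unit_row (rep L a)) else 0)"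
    proof (rule sum.cong[OF refl])
      fix L' assume L': "L' \<in> ranges"
      have "inj_on (rep L') {..<i}" using rep[OF L'] by (simp add: valid_def)
      then have "card (rep L' ` {..<i}) = i" by (simp add: card_image)
      then show "x L' * wdet i L (\<lambda>a. unit_row (rep L' a)) =
          (if L' = L then x L * wdet i L (\<lambda>a. unit_row (rep L a)) else 0)"
        using wdet_unit_zero[OF X, of "rep L'"] rep[OF L'] by auto
    qed
    also have "\<dots> = x L * wdet i L (\<lambda>a. unit_row (rep L a))" using L finite_ranges by simp
    finally show ?thesis using wdet_unit_nonzero[of "rep L"] rep[OF L] by (auto simp: valid_def)
  qed
  then have "(\<Sum>L\<in>ranges. scl (x L) (mono (rep L))) = 0" by (intro sum.neutral) auto
  then show ?thesis using x by simp
qed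

subsection \<open>Functionals on the fundamental module\<close>

abbreviation M where "M \<equiv> M_root n (i, j)"

sublocale Q: pm_quot "S_alg n" J
  by unfold_locales (simp_all add: poly_alg_subspace J_subspace J_sub)

lemma M_simps:
  "carrier M = Q.cls ` carrier (S_alg n)" "Q.cls a \<oplus>\<^bsub>M\<^esub> Q.cls b = Q.cls (a + b)" "\<zero>\<^bsub>M\<^esub> = Q.cls 0"
  "c \<odot>\<^bsub>M\<^esub> Q.cls a = Q.cls (scl c a)" "\<one>\<^bsub>M\<^esub> = Q.cls 1"
  by (simp_all add: M_root_def Let_def Q.quot_add Q.quot_smult Q.quot_zero Q.quot_carrier)
    (simp add: quot_def)

lemma M_act: "\<beta> \<in> roots n \<Longrightarrow> p \<in> carrier (S_alg n) \<Longrightarrow> act M \<beta> (Q.cls p) = Q.cls (pvar \<beta> * p)"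
  using ideal.rcoset_mult_add[OF J_ideal, of "pvar \<beta>" p] poly_alg_closed(6)[of \<beta> "roots n"]
  by (simp add: M_root_def Let_def) (simp add: quot_def)

lemma root_module_M: "root_module M n"
proof -
  interpret module cplx M
    by (rule Q.module_quot) (simp_all add: M_root_def Let_def)
  show ?thesis
    by unfold_locales
      (auto simp: M_simps M_act poly_alg_closed distrib_left scl_mult_right)
qed

text \<open>The functional \<open>p \<mapsto> \<langle>p, \<Delta>\<^sub>L\<rangle>\<close> on the quotient, which does not depend on the representative \<open>p\<close>.\<close>

definition plucker_fun :: "nat set \<Rightarrow> (nat \<times> nat) mpoly set \<Rightarrow> complex" where
  "plucker_fun L = (\<lambda>Y\<in>carrier M. pairing (SOME p. p \<in> carrier (S_alg n) \<and> Y = Q.cls p) (Delta ((i, j), L)))"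

lemma plucker_fun:
  assumes "((i, j), L) \<in> X_vars n" "p \<in> carrier (S_alg n)"
  shows "plucker_fun L (Q.cls p) = pairing p (Delta ((i, j), L))"
proof -
  define q where "q = (SOME q. q \<in> carrier (S_alg n) \<and> Q.cls p = Q.cls q)"
  have "q \<in> carrier (S_alg n) \<and> Q.cls p = Q.cls q"
    unfolding q_def by (rule someI[of _ p]) (use assms in simp)
  then have "p - q \<in> J" by (simp add: Q.cls_eq)
  then have "pairing p (Delta ((i, j), L)) = pairing q (Delta ((i, j), L))"
    using J_annihilates[OF \<open>p - q \<in> J\<close> assms(1)] by (simp add: pairing_diff_left)
  moreover have "Q.cls p \<in> carrier M" using assms by (simp add: M_simps)
  ultimately show ?thesis by (simp add: plucker_fun_def q_def)
qed

lemma plucker_fun_dual: "((i, j), L) \<in> X_vars n \<Longrightarrow> plucker_fun L \<in> dual M"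
proof -
  assume L: "((i, j), L) \<in> X_vars n"
  have "restrict (plucker_fun L) (carrier M) \<in> dual M"
    by (rule dualI[OF root_module_module[OF root_module_M]])
      (auto simp: M_simps plucker_fun[OF L] poly_alg_closed pairing_add_left pairing_scl_left)
  then show ?thesis by (simp add: plucker_fun_def)
qed

lemma plucker_fun_symbol:
  assumes "((i, j), L) \<in> X_vars n"
  shows "is_symbol n M (plucker_fun L) \<one>\<^bsub>M\<^esub> (Delta ((i, j), L))"
proof -
  have cl: "prod_list (map pvar ws) * p \<in> carrier (S_alg n)"
    if "ws \<in> lists (roots n)" "p \<in> carrier (S_alg n)" for ws p
    using that by (induction ws) (auto simp: mult.assoc intro!: poly_alg_closed)
  have act: "actw M ws (Q.cls p) = Q.cls (prod_list (map pvar ws) * p)"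
    if "ws \<in> lists (roots n)" "p \<in> carrier (S_alg n)" for ws p
    using that by (induction ws arbitrary: p) (simp_all add: M_act poly_alg_closed ac_simps)
  show ?thesis
    unfolding is_symbol_def M_simps
  proof
    fix ws assume ws: "ws \<in> lists (roots n)"
    then show "plucker_fun L (actw M ws (Q.cls 1)) = lookup (dword ws (Delta ((i, j), L))) 0"
      using cl[OF ws poly_alg_closed(2)] act[OF ws poly_alg_closed(2)]
      by (simp add: plucker_fun[OF assms] dword_const)
  qed
qed

lemma plucker_fun_separates: "separates (plucker_fun ` {L. ((i, j), L) \<in> X_vars n}) M"
  unfolding separates_def
proof (intro ballI impI)
  fix x y assume "x \<in> carrier M" "y \<in> carrier M"
    and eq: "\<forall>\<phi>\<in>plucker_fun ` {L. ((i, j), L) \<in> X_vars n}. \<phi> x = \<phi> y"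
  then obtain p q where pq: "p \<in> carrier (S_alg n)" "q \<in> carrier (S_alg n)" "x = Q.cls p" "y = Q.cls q"
    by (auto simp: M_simps)
  have "p - q \<in> J"
  proof (rule annihilator_in_J)
    show "p - q \<in> carrier (S_alg n)" using pq by (intro pm.subspace_diff poly_alg_subspace)
    fix L assume L: "((i, j), L) \<in> X_vars n"
    then have "plucker_fun L x = plucker_fun L y" using eq by blast
    then show "pairing (p - q) (Delta ((i, j), L)) = 0"
      using pq plucker_fun[OF L] by (simp add: pairing_diff_left)
  qed
  then show "x = y" using pq by (simp add: Q.cls_eq)
qed

end

section \<open>Polynomials vanishing on the variety\<close>

lemma lookup_w [simp]: "lookup (w k) m = (if m = k then 1 else 0)"
  by (simp add: w_def lookup_single when_def)

lemma lookup_pr [simp]: "lookup (pr k x) m = (if m = k then 0 else lookup x m)"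
  by (simp add: pr_def lookup_update)

lemma span_w: "pm.span (w ` S) = {x. keys x \<subseteq> S}"
proof
  have "pm.subspace {x :: W_vec. keys x \<subseteq> S}"
  proof (rule pm.subspaceI)
    fix x y :: W_vec assume "x \<in> {x. keys x \<subseteq> S}" "y \<in> {x. keys x \<subseteq> S}"
    then show "x + y \<in> {x. keys x \<subseteq> S}" using keys_add[of x y] by blast
  next
    fix c and x :: W_vec assume "x \<in> {x. keys x \<subseteq> S}"
    then show "scl c x \<in> {x. keys x \<subseteq> S}" using keys_scl[of c x] by blast
  qed simp
  then show "pm.span (w ` S) \<subseteq> {x. keys x \<subseteq> S}"
    by (intro pm.span_minimal) (auto simp: w_def)
  show "{x. keys x \<subseteq> S} \<subseteq> pm.span (w ` S)"
  proof
    fix x assume "x \<in> {x :: W_vec. keys x \<subseteq> S}"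
    then have k: "keys x \<subseteq> S" by simp
    have "x = (\<Sum>m\<in>keys x. scl (lookup x m) (w m))"
    proof (rule poly_mapping_eqI)
      fix l
      have "(\<Sum>m\<in>keys x. lookup x m * (if l = m then 1 else 0)) = (\<Sum>m\<in>keys x. if m = l then lookup x l else 0)"
        by (rule sum.cong) auto
      then show "lookup x l = lookup (\<Sum>m\<in>keys x. scl (lookup x m) (w m)) l"
        by (simp add: lookup_sum in_keys_iff)
    qed
    also have "\<dots> \<in> pm.span (w ` S)"
      using k by (intro pm.span_sum pm.span_scale pm.span_base) auto
    finally show "x \<in> pm.span (w ` S)" .
  qed
qed

lemma span_image_finite:
  assumes "finite I" "x \<in> pm.span (f ` I)"
  shows "\<exists>c. x = (\<Sum>i\<in>I. scl (c i) (f i))"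
  using assms(2)
proof (induction x rule: pm.span_induct_alt)
  case base
  show ?case by (intro exI[of _ "\<lambda>_. 0"]) simp
next
  case (step c x y)
  then obtain d i where d: "y = (\<Sum>i\<in>I. scl (d i) (f i))" and i: "i \<in> I" "x = f i" by auto
  have "(\<Sum>k\<in>I. scl (d k + (if k = i then c else 0)) (f k)) =
      (\<Sum>k\<in>I. scl (d k) (f k)) + (\<Sum>k\<in>I. if k = i then scl c (f i) else 0)"
    unfolding sum.distrib[symmetric] by (rule sum.cong) (auto simp: pm.scale_left_distrib)
  then show ?case using assms(1) i d
    by (intro exI[of _ "\<lambda>k. d k + (if k = i then c else 0)"]) (simp add: add.commute)
qed

lemma peval_cong:
  assumes "F \<in> carrier (poly_alg A)" "\<And>x. x \<in> A \<Longrightarrow> P x = Q x"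
  shows "peval P F = peval Q F"
  using assms(1) by (induction F rule: mpoly_induct) (simp_all add: assms(2))

lemma X_vars_Sigma: "X_vars n = Sigma (roots n) (\<lambda>\<alpha>. {L. (\<alpha>, L) \<in> X_vars n})"
  by (auto simp: X_vars_def)

lemma finite_X_vars_L: "finite {L. (\<alpha>, L) \<in> X_vars n}"
proof (rule finite_subset)
  show "{L. (\<alpha>, L) \<in> X_vars n} \<subseteq> Pow (W_index n \<alpha>)" by (auto simp: X_vars_def)
qed (simp add: finite_W_index)

lemma finite_X_vars: "finite (X_vars n)"
  by (subst X_vars_Sigma) (intro finite_SigmaI finite_roots finite_X_vars_L)

text \<open>The points of a product of projective spaces have homogeneous coordinates only up to a factor for
  each \<open>\<alpha>\<close>.\<close>

lemma peval_scaled: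
  assumes F: "F \<in> carrier (poly_alg (X_vars n))" and hom: "multihomogeneous n F"
  shows "\<exists>K. \<forall>P. peval (\<lambda>x. lam (fst x) * P x) F = K * peval P F"
proof -
  obtain d where d: "\<And>t \<alpha>. t \<in> keys F \<Longrightarrow> \<alpha> \<in> roots n \<Longrightarrow>
      (\<Sum>L | (\<alpha>, L) \<in> X_vars n. lookup t (\<alpha>, L)) = d \<alpha>"
    using hom unfolding multihomogeneous_def by blast
  have m: "(\<Prod>x\<in>keys t. lam (fst x) ^ lookup t x) = (\<Prod>\<alpha>\<in>roots n. lam \<alpha> ^ d \<alpha>)" if t: "t \<in> keys F" for t
  proof -
    have "(\<Prod>x\<in>keys t. lam (fst x) ^ lookup t x) = (\<Prod>x\<in>X_vars n. lam (fst x) ^ lookup t x)"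
      using F t finite_X_vars by (intro prod.mono_neutral_left) (auto simp: carrier_poly_alg in_keys_iff)
    also have "\<dots> = (\<Prod>(\<alpha>, L)\<in>Sigma (roots n) (\<lambda>\<alpha>. {L. (\<alpha>, L) \<in> X_vars n}). lam \<alpha> ^ lookup t (\<alpha>, L))"
      by (subst X_vars_Sigma) (rule prod.cong, auto)
    also have "\<dots> = (\<Prod>\<alpha>\<in>roots n. \<Prod>L | (\<alpha>, L) \<in> X_vars n. lam \<alpha> ^ lookup t (\<alpha>, L))"
      using finite_roots finite_X_vars_L by (intro prod.Sigma[symmetric]) auto
    also have "\<dots> = (\<Prod>\<alpha>\<in>roots n. lam \<alpha> ^ d \<alpha>)"
      by (rule prod.cong) (auto simp: d[OF t, symmetric] power_sum)
    finally show ?thesis .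
  qed
  have "peval (\<lambda>x. lam (fst x) * P x) F = (\<Prod>\<alpha>\<in>roots n. lam \<alpha> ^ d \<alpha>) * peval P F" for P
    unfolding peval_def sum_distrib_left
    by (rule sum.cong[OF refl]) (simp add: power_mult_distrib prod.distrib m)
  then show ?thesis by blast
qed

lemma plucker_wdet: "plucker u ((i, j), L) = wdet i L (\<lambda>a l. lookup (u (i, j) a) l)"
  by (simp add: plucker_def wdet_def)

text \<open>Used both for changing bases of the \<open>V\<^sub>i\<^sub>,\<^sub>j\<close> and for triangular substitutions. By \<open>wdet_mult\<close> the
  Pluecker coordinates belonging to \<open>(i, j)\<close> are all multiplied by the same determinant.\<close>

lemma peval_plucker_lincomb:
  assumes F: "F \<in> carrier (poly_alg (X_vars n))" and hom: "multihomogeneous n F"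
    and u: "\<And>i j a. (i, j) \<in> roots n \<Longrightarrow> a < i \<Longrightarrow> u (i, j) a = (\<Sum>b<i. scl (C (i, j) a b) (u' (i, j) b))"
    and zero: "peval (plucker u') F = 0"
  shows "peval (plucker u) F = 0"
proof -
  define d where "d = (\<lambda>(i, j). det (mat i i (\<lambda>(a, b). C (i, j) a b)))"
  have "plucker u x = d (fst x) * plucker u' x" if x: "x \<in> X_vars n" for x
  proof -
    obtain i j L where xe: "x = ((i, j), L)" by (metis prod.exhaust)
    note X = X_varsD[OF x[unfolded xe]]
    have "plucker u x = wdet i L (\<lambda>a l. \<Sum>b<i. C (i, j) a b * lookup (u' (i, j) b) l)"
      unfolding xe plucker_wdet using X by (intro wdet_cong) (auto simp: u lookup_sum)
    then show ?thesis by (simp add: wdet_mult xe plucker_wdet d_def)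
  qed
  then have "peval (plucker u) F = peval (\<lambda>x. d (fst x) * plucker u' x) F"
    by (intro peval_cong[OF F])
  then show ?thesis using peval_scaled[OF F hom, of d] zero by auto
qed

subsection \<open>The open cell\<close>

definition cell_vec :: "nat \<Rightarrow> (nat \<times> nat \<Rightarrow> complex) \<Rightarrow> nat \<Rightarrow> nat \<Rightarrow> W_vec" where
  "cell_vec n c j k = w k + (\<Sum>l=j..<n. scl (c (k, l)) (w (l + 1)))"

definition cell_basis :: "nat \<Rightarrow> (nat \<times> nat \<Rightarrow> complex) \<Rightarrow> nat \<times> nat \<Rightarrow> nat \<Rightarrow> W_vec" where
  "cell_basis n c = (\<lambda>(i, j) a. cell_vec n c j (a + 1))"

lemma lookup_cell_vec:
  "lookup (cell_vec n c j k) m = (if m = k then 1 else 0) + (if j < m \<and> m \<le> n then c (k, m - 1) else 0)"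
proof -
  have "(\<Sum>l=j..<n. c (k, l) * (if m = l + 1 then 1 else 0)) = (\<Sum>l=j..<n. if l = m - 1 then (if 1 \<le> m then c (k, m - 1) else 0) else 0)"
    by (rule sum.cong) auto
  also have "\<dots> = (if j < m \<and> m \<le> n then c (k, m - 1) else 0)" by auto
  finally show ?thesis by (simp add: cell_vec_def lookup_add lookup_sum)
qed

lemma plucker_cell:
  assumes "x \<in> X_vars n"
  shows "peval c (Delta x) = plucker (cell_basis n c) x"
proof -
  obtain i j L where x: "x = ((i, j), L)" by (metis prod.exhaust)
  note X = X_varsD[OF assms[unfolded x]]
  have "peval c (Delta x) = wdet i L (\<lambda>a l. peval c (cell j a l))"
    by (simp add: x Delta_def wdet_hom[OF peval_hom])
  also have "\<dots> = wdet i L (\<lambda>a l. lookup (cell_basis n c (i, j) a) l)"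
    by (rule wdet_cong[OF X(4,3)])
      (use X(2) rootsD[OF X(1)] in \<open>auto simp: cell_def cell_basis_def lookup_cell_vec W_index_def subset_iff\<close>)
  finally show ?thesis by (simp add: x plucker_wdet)
qed

lemma dim_cell:
  assumes "(i, j) \<in> roots n"
  shows "pm.dim (pm.span (cell_basis n c (i, j) ` {..<i})) = i"
proof -
  let ?f = "cell_basis n c (i, j)"
  have look: "lookup (?f a) (b + 1) = (if a = b then 1 else 0)" if "a < i" "b < i" for a b
    using rootsD[OF assms] that by (simp add: cell_basis_def lookup_cell_vec)
  have inj: "inj_on ?f {..<i}"
  proof (rule inj_onI)
    fix a b assume "a \<in> {..<i}" "b \<in> {..<i}" "?f a = ?f b"
    then show "a = b" using look[of a b] look[of b b] by (auto split: if_splits)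
  qed
  have "pm.independent (?f ` {..<i})"
  proof (rule pm.independent_if_scalars_zero)
    fix g x assume 0: "(\<Sum>x\<in>?f ` {..<i}. scl (g x) x) = 0" and "x \<in> ?f ` {..<i}"
    then obtain b where b: "b < i" "x = ?f b" by auto
    have "0 = lookup (\<Sum>a<i. scl (g (?f a)) (?f a)) (b + 1)"
      using 0 by (simp add: sum.reindex[OF inj])
    also have "\<dots> = (\<Sum>a<i. g (?f a) * lookup (?f a) (b + 1))" by (simp add: lookup_sum)
    also have "\<dots> = (\<Sum>a<i. if a = b then g (?f b) else 0)"
      by (rule sum.cong[OF refl]) (use look b in \<open>auto simp del: One_nat_def add_Suc_right\<close>)
    also have "\<dots> = g x" using b by simp
    finally show "g x = 0" by simp
  qed simp
  then show ?thesis by (simp add: pm.dim_eq_card_independent card_image[OF inj])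
qed

text \<open>The subspaces spanned by the rows of the generic matrix satisfy the incidence conditions of \<open>R\<^sub>n\<close>:
  the row \<open>k\<close> is the same for all \<open>i\<close>, and \<open>pr\<^sub>j\<^sub>+\<^sub>1\<close> only removes its component at \<open>w\<^sub>j\<^sub>+\<^sub>1\<close>.\<close>

lemma vanishing_imp_zero_on_cell:
  assumes F: "F \<in> carrier (poly_alg (X_vars n))" and van: "vanishes_on_R n F"
  shows "peval (\<lambda>x. peval c (Delta x)) F = 0"
proof -
  let ?u = "cell_basis n c"
  define V where "V = (\<lambda>(i, j)\<in>roots n. pm.span (?u (i, j) ` {..<i}))"
  have V: "V (i, j) = pm.span (?u (i, j) ` {..<i})" if "(i, j) \<in> roots n" for i j
    using that by (simp add: V_def)
  have "V \<in> R_var n"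
    unfolding R_var_def
  proof (intro CollectI conjI allI impI)
    have "pm.span (?u (i, j) ` {..<i}) \<subseteq> W_space n (i, j)" if r: "(i, j) \<in> roots n" for i j
      unfolding W_space_def
    proof (rule pm.span_minimal)
      show "?u (i, j) ` {..<i} \<subseteq> pm.span (w ` W_index n (i, j))"
        unfolding span_w using rootsD[OF r]
        by (auto simp: in_keys_iff cell_basis_def lookup_cell_vec W_index_def split: if_splits)
    qed simp
    then show "V \<in> (\<Pi>\<^sub>E (i, j)\<in>roots n. {U. pm.subspace U \<and> U \<subseteq> W_space n (i, j) \<and> pm.dim U = i})"
      using dim_cell by (auto simp: V_def)
  next
    fix i j assume "1 \<le> i \<and> i < j \<and> j \<le> n - 1"
    then have "(i, j) \<in> roots n" "(i + 1, j) \<in> roots n" by (auto simp: roots_iff)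
    then show "V (i, j) \<subseteq> V (i + 1, j)"
      by (simp only: V) (intro pm.span_mono, auto simp: cell_basis_def)
  next
    fix i j assume ij: "1 \<le> i \<and> i \<le> j \<and> j < n - 1"
    then have r: "(i, j) \<in> roots n" "(i, Suc j) \<in> roots n" by (auto simp: roots_iff)
    have sub: "pm.subspace {x. pr (Suc j) x \<in> V (i, Suc j)}"
    proof -
      have "pr k (x + y) = pr k x + pr k y" "pr k (scl c x) = scl c (pr k x)" "pr k 0 = 0" for k x y c
        by (rule poly_mapping_eqI; simp add: lookup_add)+
      then show ?thesis by (auto simp: pm.subspace_def V[OF r(2)] pm.span_add pm.span_scale pm.span_zero)
    qed
    have "pr (Suc j) (?u (i, j) a) = ?u (i, Suc j) a" if "a < i" for a
      using that ij by (intro poly_mapping_eqI) (auto simp: cell_basis_def lookup_cell_vec)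
    then have "?u (i, j) ` {..<i} \<subseteq> {x. pr (Suc j) x \<in> V (i, Suc j)}"
      by (auto simp: V[OF r(2)] pm.span_base)
    from pm.span_minimal[OF this sub] show "pr (j + 1) ` V (i, j) \<subseteq> V (i, j + 1)"
      by (auto simp: V[OF r(1)] subset_iff)
  qed
  moreover have "\<forall>(i, j)\<in>roots n. pm.span (?u (i, j) ` {..<i}) = V (i, j)" using V by auto
  ultimately have "peval (plucker ?u) F = 0" using van unfolding vanishes_on_R_def by blast
  moreover have "peval (\<lambda>x. peval c (Delta x)) F = peval (plucker ?u) F"
    by (rule peval_cong[OF F plucker_cell])
  ultimately show ?thesis by simp
qed

subsection \<open>Density of the cell\<close>

lemma triangular_solve:
  fixes T :: "nat \<Rightarrow> nat \<Rightarrow> complex"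
  assumes "\<forall>i\<in>{1..m}. T i i \<noteq> 0"
  shows "\<exists>\<gamma>. \<forall>i\<in>{1..m}. (\<Sum>s=1..i. T i s * \<gamma> s) = b i"
  using assms
proof (induction m)
  case (Suc m)
  then obtain \<gamma> where g: "\<forall>i\<in>{1..m}. (\<Sum>s=1..i. T i s * \<gamma> s) = b i" by auto
  define \<gamma>' where "\<gamma>' = \<gamma>(Suc m := (b (Suc m) - (\<Sum>s=1..m. T (Suc m) s * \<gamma> s)) / T (Suc m) (Suc m))"
  have eq: "(\<Sum>s=1..i. T k s * \<gamma>' s) = (\<Sum>s=1..i. T k s * \<gamma> s)" if "i \<le> m" for i k
    using that by (intro sum.cong) (auto simp: \<gamma>'_def)
  have "(\<Sum>s=1..i. T i s * \<gamma>' s) = b i" if "i \<in> {1..Suc m}" for i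
  proof (cases "i = Suc m")
    case True
    then show ?thesis using eq[of m "Suc m"] Suc.prems by (simp add: \<gamma>'_def)
  qed (use that eq g in auto)
  then show ?case by blast
qed simp

text \<open>A flag step: some \<open>v \<in> V\<close> lies outside the hyperplane \<open>U\<close>. The case \<open>m = 0\<close> is stated separately
  because \<open>dim\<close> is also \<open>0\<close> for spaces of infinite dimension.\<close>

lemma new_vector:
  assumes U: "pm.subspace U" "pm.subspace V" "U \<subseteq> V" "pm.dim U = m" "pm.dim V = Suc m" "m = 0 \<Longrightarrow> U = {0}"
  shows "\<exists>v\<in>V. V \<subseteq> pm.span (insert v U)"
proof -
  obtain B where B: "B \<subseteq> U" "pm.independent B" "U \<subseteq> pm.span B" "card B = m"
    using pm.basis_exists[of U] U(4) by metis
  have fB: "finite B"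
  proof (cases "m = 0")
    case True
    then have "B \<subseteq> {0}" using B U by auto
    then show ?thesis by (rule finite_subset) simp
  qed (rule card_ge_0_finite, simp add: B)
  obtain D where D: "D \<subseteq> V" "pm.independent D" "V \<subseteq> pm.span D" "card D = Suc m"
    using pm.basis_exists[of V] U(5) by metis
  have fD: "finite D" by (rule card_ge_0_finite) (simp add: D)
  have "\<not> D \<subseteq> pm.span B"
    using pm.independent_span_bound[OF fB D(2)] B(4) D(4) by auto
  then obtain v where v: "v \<in> D" "v \<notin> pm.span B" by blast
  have ind: "pm.independent (insert v B)" by (rule pm.independent_insertI[OF v(2) B(2)])
  have vB: "v \<notin> B" using v pm.span_base by blast
  have "V \<subseteq> pm.span (insert v B)"
  proof
    fix z assume z: "z \<in> V"
    show "z \<in> pm.span (insert v B)"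
    proof (rule ccontr)
      assume nz: "z \<notin> pm.span (insert v B)"
      then have "pm.independent (insert z (insert v B))" by (rule pm.independent_insertI[OF _ ind])
      moreover have "insert z (insert v B) \<subseteq> pm.span D" using z v D B U by blast
      ultimately have "card (insert z (insert v B)) \<le> card D"
        using pm.independent_span_bound[OF fD] by blast
      moreover have "z \<notin> insert v B" using nz pm.span_base by blast
      ultimately show False using vB fB B D by simp
    qed
  qed
  also have "\<dots> \<subseteq> pm.span (insert v U)" using B by (intro pm.span_mono) auto
  finally show ?thesis using v D by blast
qed

text \<open>A point of \<open>R\<^sub>n\<close> is built step by step: \<open>V\<^sub>i\<^sub>,\<^sub>j\<close> arises from \<open>V\<^sub>i\<^sub>-\<^sub>1\<^sub>,\<^sub>j\<close> by adding one vector,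
  which lies in \<open>V\<^sub>i\<^sub>,\<^sub>j\<^sub>+\<^sub>1\<close> up to a multiple of \<open>w\<^sub>j\<^sub>+\<^sub>1\<close>.
  For uniformity \<open>y n i\<close> denotes \<open>w\<^sub>i\<close>, as if there were \<open>V\<^sub>i\<^sub>,\<^sub>n = W\<^sub>i\<^sub>,\<^sub>n\<close>.\<close>

lemma R_var_basis:
  assumes V: "V \<in> R_var n"
  obtains y where "\<And>i j. (i, j) \<in> roots n \<Longrightarrow> V (i, j) = pm.span (y j ` {1..i})"
    "\<And>i. y n i = w i"
    "\<And>i j. (i, j) \<in> roots n \<Longrightarrow> \<exists>A b. y j i = (\<Sum>s=1..i. scl (A s) (y (j + 1) s)) + scl b (w (j + 1))"
proof -
  have Vs: "pm.subspace (V (i, j))" "V (i, j) \<subseteq> W_space n (i, j)" "pm.dim (V (i, j)) = i"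
    if "(i, j) \<in> roots n" for i j
    using V that unfolding R_var_def by (auto simp: PiE_iff)
  have mono: "V (i, j) \<subseteq> V (i + 1, j)" if "1 \<le> i" "i < j" "j < n" for i j
    using V that by (auto simp: R_var_def)
  have prV: "pr (j + 1) ` V (i, j) \<subseteq> V (i, j + 1)" if "1 \<le> i" "i \<le> j" "j + 1 < n" for i j
    using V that by (auto simp: R_var_def)
  define V0 where "V0 i j = (if i = 0 then {0} else V (i, j))" for i j
  have "\<exists>v\<in>V (i, j). V (i, j) \<subseteq> pm.span (insert v (V0 (i - 1) j))" if r: "(i, j) \<in> roots n" for i j
  proof (rule new_vector[where m = "i - 1"])
    have ij: "1 \<le> i" "i \<le> j" "j < n" using rootsD[OF r] by auto
    have d0: "pm.dim ({0} :: W_vec set) = 0"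
      using pm.dim_eq_card_independent[OF pm.independent_empty]
        pm.dim_span[of "{} :: W_vec set", unfolded pm.span_empty] by simp
    show "pm.subspace (V0 (i - 1) j)" "V0 (i - 1) j \<subseteq> V (i, j)" "pm.dim (V0 (i - 1) j) = i - 1"
    proof (atomize (full), cases "i = 1")
      case True
      then show "pm.subspace (V0 (i - 1) j) \<and> V0 (i - 1) j \<subseteq> V (i, j) \<and> pm.dim (V0 (i - 1) j) = i - 1"
        using d0 pm.subspace_0[OF Vs(1)[OF r]] by (simp add: V0_def pm.subspace_single_0)
    next
      case False
      then have "(i - 1, j) \<in> roots n" "1 \<le> i - 1" "i - 1 < j" "i - 1 + 1 = i" using ij by (auto simp: roots_iff)
      then show "pm.subspace (V0 (i - 1) j) \<and> V0 (i - 1) j \<subseteq> V (i, j) \<and> pm.dim (V0 (i - 1) j) = i - 1"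
        using Vs[of "i - 1" j] mono[of "i - 1" j] ij by (auto simp: V0_def)
    qed
    show "pm.dim (V (i, j)) = Suc (i - 1)" using ij Vs[OF r] by simp
  qed (use Vs[OF r] in \<open>auto simp: V0_def\<close>)
  then have "\<forall>x\<in>roots n. \<exists>v. v \<in> V x \<and> V x \<subseteq> pm.span (insert v (V0 (fst x - 1) (snd x)))"
    by fastforce
  then have "\<exists>f. \<forall>x\<in>roots n. f x \<in> V x \<and> V x \<subseteq> pm.span (insert (f x) (V0 (fst x - 1) (snd x)))"
    by (rule bchoice)
  then obtain f where f: "\<forall>x\<in>roots n. f x \<in> V x \<and> V x \<subseteq> pm.span (insert (f x) (V0 (fst x - 1) (snd x)))" ..
  define y where "y j i = (if j = n then w i else f (i, j))" for i j
  have y: "y j i \<in> V (i, j)" "V (i, j) \<subseteq> pm.span (insert (y j i) (V0 (i - 1) j))" if "(i, j) \<in> roots n" for i j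
    using bspec[OF f that] rootsD[OF that] by (auto simp: y_def)
  have sp: "(i, j) \<in> roots n \<Longrightarrow> V (i, j) = pm.span (y j ` {1..i})" for i j
  proof (induction i)
    case (Suc i)
    note r = Suc.prems
    have "V0 i j \<subseteq> pm.span (y j ` {1..i})"
      using Suc.IH rootsD[OF r] by (cases "i = 0") (auto simp: V0_def roots_iff pm.span_zero)
    also have "\<dots> \<subseteq> pm.span (y j ` {1..Suc i})" by (intro pm.span_mono) auto
    finally have "insert (y j (Suc i)) (V0 i j) \<subseteq> pm.span (y j ` {1..Suc i})"
      by (auto intro: pm.span_base)
    then have "pm.span (insert (y j (Suc i)) (V0 i j)) \<subseteq> pm.span (y j ` {1..Suc i})"
      by (intro pm.span_minimal) auto
    then have 1: "V (Suc i, j) \<subseteq> pm.span (y j ` {1..Suc i})" using y(2)[OF r] by auto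
    have "y j s \<in> V (Suc i, j)" if s: "s \<in> {1..Suc i}" for s
    proof (cases "s = Suc i")
      case False
      then have i: "i \<noteq> 0" "(i, j) \<in> roots n" "s \<in> {1..i}" using s r by (auto simp: roots_iff)
      have "y j s \<in> V (i, j)" unfolding Suc.IH[OF i(2)] by (rule pm.span_base) (use i in blast)
      moreover have "V (i, j) \<subseteq> V (i + 1, j)" using i rootsD[OF r] by (intro mono) auto
      ultimately show ?thesis by auto
    qed (use y(1)[OF r] in simp)
    then have "pm.span (y j ` {1..Suc i}) \<subseteq> V (Suc i, j)"
      by (intro pm.span_minimal Vs(1)[OF r]) auto
    then show ?case using 1 by simp
  qed (auto simp: roots_iff)
  have rel: "\<exists>A b. y j i = (\<Sum>s=1..i. scl (A s) (y (j + 1) s)) + scl b (w (j + 1))" if r: "(i, j) \<in> roots n" for i j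
  proof -
    have ij: "1 \<le> i" "i \<le> j" "j < n" using rootsD[OF r] by auto
    have "pr (j + 1) (y j i) \<in> pm.span (y (j + 1) ` {1..i})"
    proof (cases "j + 1 = n")
      case False
      then have "(i, j + 1) \<in> roots n" using ij by (auto simp: roots_iff)
      then show ?thesis using prV[of i j] y(1)[OF r] ij False sp[of i "j + 1"] by auto
    next
      case True
      have "keys (y j i) \<subseteq> W_index n (i, j)"
        using y(1)[OF r] Vs(2)[OF r] by (auto simp: W_space_def span_w)
      have "keys (pr n (y j i)) \<subseteq> {1..i}"
      proof
        fix m assume "m \<in> keys (pr n (y j i))"
        then have m: "m \<noteq> n" "m \<in> keys (y j i)" by (auto simp: in_keys_iff split: if_splits)
        then have "m \<in> W_index n (i, j)" using \<open>keys (y j i) \<subseteq> W_index n (i, j)\<close> by blast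
        then show "m \<in> {1..i}" using True m(1) by (auto simp: W_index_def)
      qed
      moreover have "y n = w" by (simp add: y_def fun_eq_iff)
      ultimately show ?thesis using True by (simp add: span_w)
    qed
    then obtain A where A: "pr (j + 1) (y j i) = (\<Sum>s=1..i. scl (A s) (y (j + 1) s))"
      using span_image_finite[of "{1..i}"] by blast
    have "y j i = pr (j + 1) (y j i) + scl (lookup (y j i) (j + 1)) (w (j + 1))"
      by (rule poly_mapping_eqI) (simp add: lookup_add)
    then show ?thesis unfolding A by blast
  qed
  show thesis using that[OF sp _ rel] by (simp add: y_def)
qed

lemma wdet_continuous:
  fixes e :: "complex \<Rightarrow> nat \<Rightarrow> nat \<Rightarrow> complex"
  assumes "\<And>a l. continuous_on UNIV (\<lambda>t. e t a l)"
  shows "continuous_on UNIV (\<lambda>t. wdet i L (e t))"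
proof -
  have "wdet i L (e t) = (\<Sum>p | p permutes {0..<i}. of_int (sign p) * (\<Prod>a = 0..<i. e t a (sorted_list_of_set L ! p a)))" for t
  proof -
    have "wdet i L (e t) = (\<Sum>p | p permutes {0..<i}. of_int (sign p) *
        (\<Prod>a = 0..<i. mat i i (\<lambda>(a, b). e t a (sorted_list_of_set L ! b)) $$ (a, p a)))"
      unfolding wdet_def by (rule det_def') simp
    also have "\<dots> = (\<Sum>p | p permutes {0..<i}. of_int (sign p) * (\<Prod>a = 0..<i. e t a (sorted_list_of_set L ! p a)))"
      by (intro sum.cong refl arg_cong2[where f="(*)"] prod.cong) (auto simp: permutes_in_image)
    finally show ?thesis .
  qed
  then show ?thesis by (simp only:) (intro continuous_intros assms)
qed

text \<open>Let the diagonal coefficients in \<open>R_var_basis\<close> be increased by \<open>t\<close>. For all but finitely many \<open>t\<close> they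
  are nonzero; then the vectors are a triangular transform of the rows of a point of the cell, which
  is found column by column by solving triangular systems. So \<open>F\<close> vanishes at the deformed coordinates
  for almost all \<open>t\<close>, and by continuity also for \<open>t = 0\<close>.\<close>

lemma zero_on_cell_imp_vanishing:
  assumes F: "F \<in> carrier (poly_alg (X_vars n))" and hom: "multihomogeneous n F"
    and zero: "\<And>c. peval (\<lambda>x. peval c (Delta x)) F = 0"
  shows "vanishes_on_R n F"
  unfolding vanishes_on_R_def
proof (intro ballI allI impI)
  fix V u assume V: "V \<in> R_var n" and u: "\<forall>(i, j)\<in>roots n. pm.span (u (i, j) ` {..<i}) = V (i, j)"
  obtain y where y: "\<And>i j. (i, j) \<in> roots n \<Longrightarrow> V (i, j) = pm.span (y j ` {1..i})"
    "\<And>i. y n i = w i"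
    "\<And>i j. (i, j) \<in> roots n \<Longrightarrow> \<exists>A b. y j i = (\<Sum>s=1..i. scl (A s) (y (j + 1) s)) + scl b (w (j + 1))"
    by (rule R_var_basis[OF V]) (rule that; assumption)
  have "\<forall>x\<in>roots n. \<exists>Ab. y (snd x) (fst x) =
      (\<Sum>s=1..fst x. scl (fst Ab s) (y (snd x + 1) s)) + scl (snd Ab) (w (snd x + 1))"
    using y(3) by fastforce
  then have "\<exists>Ab. \<forall>x\<in>roots n. y (snd x) (fst x) =
      (\<Sum>s=1..fst x. scl (fst (Ab x) s) (y (snd x + 1) s)) + scl (snd (Ab x)) (w (snd x + 1))"
    by (rule bchoice)
  then obtain Ab where Ab: "\<forall>x\<in>roots n. y (snd x) (fst x) =
      (\<Sum>s=1..fst x. scl (fst (Ab x) s) (y (snd x + 1) s)) + scl (snd (Ab x)) (w (snd x + 1))" ..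
  define A where "A j i = fst (Ab (i, j))" for i j
  define b where "b j i = snd (Ab (i, j))" for i j
  have yA: "y j i = (\<Sum>s=1..i. scl (A j i s) (y (j + 1) s)) + scl (b j i) (w (j + 1))"
    if "(i, j) \<in> roots n" for i j
    using bspec[OF Ab that] by (simp add: A_def b_def)
  \<comment> \<open>The recursion runs over \<open>d = n - j\<close>, starting from the vectors \<open>w\<^sub>i\<close> at \<open>j = n\<close>.\<close>
  define Z where "Z t = rec_nat w (\<lambda>d z i. (\<Sum>s=1..i. scl (A (n - Suc d) i s + (if s = i then t else 0)) (z s)) +
      scl (b (n - Suc d) i) (w (n - d)))" for t
  define Y where "Y t j = Z t (n - j)" for t j
  have Y_n: "Y t n = w" for t by (simp add: Y_def Z_def)
  have Y_rec: "Y t j i = (\<Sum>s=1..i. scl (A j i s + (if s = i then t else 0)) (Y t (j + 1) s)) + scl (b j i) (w (j + 1))"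
    if "j < n" for t j i
  proof -
    have "n - j = Suc (n - (j + 1))" "n - Suc (n - (j + 1)) = j" "n - (n - (j + 1)) = j + 1" using that by auto
    then show ?thesis unfolding Y_def by (simp only: Z_def nat.rec)
  qed
  have Y_0: "j \<le> n \<Longrightarrow> \<forall>i. 1 \<le> i \<and> i \<le> j \<longrightarrow> Y 0 j i = y j i" if "1 \<le> j" for j
  proof (induction j rule: inc_induct)
    case base
    show ?case using y(2) by (simp add: Y_n)
  next
    case (step j)
    have "Y 0 j i = y j i" if "1 \<le> i" "i \<le> j" for i
    proof -
      have "(i, j) \<in> roots n" using that step by (simp add: roots_iff)
      moreover have "(\<Sum>s=1..i. scl (A j i s) (Y 0 (j + 1) s)) = (\<Sum>s=1..i. scl (A j i s) (y (j + 1) s))"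
        using step that by (intro sum.cong) auto
      ultimately show ?thesis using yA[of i j] Y_rec[of j 0 i] step by simp
    qed
    then show ?case by blast
  qed
  have Y_cont: "j \<le> n \<Longrightarrow> \<forall>i l. continuous_on UNIV (\<lambda>t. lookup (Y t j i) l)" for j
  proof (induction j rule: inc_induct)
    case (step j)
    have "continuous_on UNIV (\<lambda>t. if s = i then t else (0::complex))" for s i :: nat
      by (cases "s = i") (auto intro: continuous_intros)
    then show ?case using step
      by (auto simp: Y_rec lookup_add lookup_sum simp del: sum.cl_ivl_Suc intro!: continuous_intros)
  qed (simp add: Y_n)
  have Y_cell: "\<exists>c. \<forall>j'\<in>{j..n}. \<exists>T. (\<forall>i\<in>{1..j'}. T i i \<noteq> 0) \<and>
      (\<forall>i\<in>{1..j'}. Y t j' i = (\<Sum>s=1..i. scl (T i s) (cell_vec n c j' s)))"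
    if t: "\<And>i j. (i, j) \<in> roots n \<Longrightarrow> A j i i + t \<noteq> 0" and "j \<le> n" for t j
    using \<open>j \<le> n\<close>
  proof (induction j rule: inc_induct)
    case base
    have "w i = (\<Sum>s=1..i. scl (if s = i then 1 else 0) (w s))" if "1 \<le> i" for i
    proof -
      have "(\<Sum>s=1..i. scl (if s = i then 1 else 0) (w s)) = (\<Sum>s=1..i. if s = i then w i else 0)"
        by (rule sum.cong) auto
      then show ?thesis using that by simp
    qed
    then show ?case
      by (intro exI[of _ "\<lambda>_. 0"] ballI exI[of _ "\<lambda>i s. if s = i then 1 else 0"])
        (auto simp: Y_n cell_vec_def simp del: sum.cl_ivl_Suc)
  next
    case (step j)
    then obtain c where c: "\<forall>j'\<in>{Suc j..n}. \<exists>T. (\<forall>i\<in>{1..j'}. T i i \<noteq> 0) \<and>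
      (\<forall>i\<in>{1..j'}. Y t j' i = (\<Sum>s=1..i. scl (T i s) (cell_vec n c j' s)))" by blast
    moreover have "Suc j \<in> {Suc j..n}" using step by simp
    ultimately have "\<exists>T. (\<forall>i\<in>{1..Suc j}. T i i \<noteq> 0) \<and>
      (\<forall>i\<in>{1..Suc j}. Y t (Suc j) i = (\<Sum>s=1..i. scl (T i s) (cell_vec n c (Suc j) s)))" by (rule bspec)
    then obtain T where T: "\<And>i. i \<in> {1..Suc j} \<Longrightarrow> T i i \<noteq> 0"
      "\<And>i. i \<in> {1..Suc j} \<Longrightarrow> Y t (Suc j) i = (\<Sum>s=1..i. scl (T i s) (cell_vec n c (Suc j) s))" by blast
    define A' where "A' i s = A j i s + (if s = i then t else 0)" for i s
    define T' where "T' i r = (\<Sum>s=r..i. A' i s * T s r)" for i r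
    have diag: "\<forall>i\<in>{1..j}. T' i i \<noteq> 0"
      using T(1) t step by (auto simp: T'_def A'_def roots_iff)
    then obtain \<gamma> where g: "\<forall>i\<in>{1..j}. (\<Sum>s=1..i. T' i s * \<gamma> s) = b j i"
      using triangular_solve by blast
    \<comment> \<open>Only the column \<open>j\<close> changes, which the vectors for larger \<open>j\<close> do not involve.\<close>
    define c' where "c' = (\<lambda>(s, l). if l = j then \<gamma> s else c (s, l))"
    have same: "cell_vec n c' j' s = cell_vec n c j' s" if "Suc j \<le> j'" for j' s
      using that unfolding cell_vec_def by (intro arg_cong2[where f="(+)"] sum.cong refl) (auto simp: c'_def)
    have cj: "cell_vec n c' j s = cell_vec n c (Suc j) s + scl (\<gamma> s) (w (Suc j))" for s
      using step same[OF order_refl, of s] unfolding cell_vec_def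
      by (simp add: sum.atLeast_Suc_lessThan c'_def algebra_simps)
    have "Y t j i = (\<Sum>s=1..i. scl (T' i s) (cell_vec n c' j s))" if i: "i \<in> {1..j}" for i
    proof -
      have "Y t j i = (\<Sum>s=1..i. scl (A' i s) (Y t (Suc j) s)) + scl (b j i) (w (Suc j))"
        using Y_rec[of j t i] step by (simp add: A'_def)
      also have "(\<Sum>s=1..i. scl (A' i s) (Y t (Suc j) s)) =
          (\<Sum>s=1..i. \<Sum>r=1..s. scl (A' i s * T s r) (cell_vec n c (Suc j) r))"
        by (rule sum.cong) (use i in \<open>auto simp: T(2) pm.scale_sum_right simp del: sum.cl_ivl_Suc\<close>)
      also have "\<dots> = (\<Sum>r=1..i. \<Sum>s=r..i. scl (A' i s * T s r) (cell_vec n c (Suc j) r))"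
        unfolding sum.Sigma[OF finite_atLeastAtMost ballI[OF finite_atLeastAtMost]]
        by (rule sum.reindex_bij_witness[of _ "\<lambda>(r, s). (s, r)" "\<lambda>(s, r). (r, s)"]) auto
      also have "\<dots> = (\<Sum>r=1..i. scl (T' i r) (cell_vec n c (Suc j) r))"
        by (simp add: T'_def pm.scale_sum_left)
      also have "scl (b j i) (w (Suc j)) = (\<Sum>r=1..i. scl (T' i r) (scl (\<gamma> r) (w (Suc j))))"
        using g i by (simp add: pm.scale_sum_left[symmetric] del: sum.cl_ivl_Suc)
      finally show ?thesis by (simp add: cj pm.scale_right_distrib sum.distrib)
    qed
    then have "\<exists>T. (\<forall>i\<in>{1..j'}. T i i \<noteq> 0) \<and>
      (\<forall>i\<in>{1..j'}. Y t j' i = (\<Sum>s=1..i. scl (T i s) (cell_vec n c' j' s)))" if "j' \<in> {j..n}" for j'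
    proof (cases "j' = j")
      case True
      then show ?thesis using diag \<open>\<And>i. i \<in> {1..j} \<Longrightarrow> _\<close> by blast
    next
      case False
      then have "j' \<in> {Suc j..n}" using that by auto
      then show ?thesis using c same by simp
    qed
    then show ?case by blast
  qed
  define f where "f t = peval (plucker (\<lambda>(i, j) a. Y t j (a + 1))) F" for t
  have f_zero: "f t = 0" if t: "\<And>i j. (i, j) \<in> roots n \<Longrightarrow> A j i i + t \<noteq> 0" for t
  proof (cases "n = 0")
    case False
    then obtain c where c: "\<forall>j'\<in>{1..n}. \<exists>T. (\<forall>i\<in>{1..j'}. T i i \<noteq> 0) \<and>
      (\<forall>i\<in>{1..j'}. Y t j' i = (\<Sum>s=1..i. scl (T i s) (cell_vec n c j' s)))"
      using Y_cell[OF t, of 1] by auto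
    then have "\<forall>j'\<in>{1..n}. \<exists>T. \<forall>i\<in>{1..j'}. Y t j' i = (\<Sum>s=1..i. scl (T i s) (cell_vec n c j' s))" by blast
    then have "\<exists>T. \<forall>j'\<in>{1..n}. \<forall>i\<in>{1..j'}. Y t j' i = (\<Sum>s=1..i. scl (T j' i s) (cell_vec n c j' s))"
      by (rule bchoice)
    then obtain T where T: "\<forall>j'\<in>{1..n}. \<forall>i\<in>{1..j'}. Y t j' i = (\<Sum>s=1..i. scl (T j' i s) (cell_vec n c j' s))" ..
    show ?thesis unfolding f_def
    proof (rule peval_plucker_lincomb[OF F hom,
          where C = "\<lambda>(i, j) a b. if b \<le> a then T j (a + 1) (b + 1) else 0" and u' = "cell_basis n c"])
      fix i j a assume r: "(i, j) \<in> roots n" and a: "a < i"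
      have "Y t j (a + 1) = (\<Sum>s=1..a + 1. scl (T j (a + 1) s) (cell_vec n c j s))"
        using T rootsD[OF r] a by auto
      also have "\<dots> = (\<Sum>b\<in>{..a}. scl (T j (a + 1) (b + 1)) (cell_vec n c j (b + 1)))"
        by (rule sum.reindex_bij_witness[of _ "\<lambda>b. b + 1" "\<lambda>s. s - 1"]) auto
      also have "\<dots> = (\<Sum>b<i. if b \<le> a then scl (T j (a + 1) (b + 1)) (cell_vec n c j (b + 1)) else 0)"
        using a by (intro sum.mono_neutral_cong_left) auto
      also have "\<dots> = (\<Sum>b<i. scl (if b \<le> a then T j (a + 1) (b + 1) else 0) (cell_basis n c (i, j) b))"
        by (rule sum.cong) (auto simp: cell_basis_def)
      finally show "(case (i, j) of (i, j) \<Rightarrow> \<lambda>a. Y t j (a + 1)) a =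
          (\<Sum>b<i. scl ((case (i, j) of (i, j) \<Rightarrow> \<lambda>a b. if b \<le> a then T j (a + 1) (b + 1) else 0) a b) (cell_basis n c (i, j) b))"
        by simp
    next
      have "peval (plucker (cell_basis n c)) F = peval (\<lambda>x. peval c (Delta x)) F"
        by (rule peval_cong[OF F plucker_cell[symmetric]])
      then show "peval (plucker (cell_basis n c)) F = 0" using zero by simp
    qed
  next
    case True
    then have e: "X_vars n = {}" by (auto simp: X_vars_def roots_def)
    have "f t = peval (\<lambda>x. peval (\<lambda>_. 0) (Delta x)) F" unfolding f_def by (rule peval_cong[OF F]) (simp add: e)
    then show ?thesis using zero by simp
  qed
  have f_cont: "continuous_on UNIV f"
  proof -
    \<comment> \<open>The recursion defines \<open>Y\<close> for \<open>j \<le> n\<close>; a constant value beyond makes continuity hold for all \<open>j\<close>.\<close>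
    define Y' where "Y' t j i = (if j \<le> n then Y t j i else 0)" for t j i
    have Yc: "continuous_on UNIV (\<lambda>t. lookup (Y' t j i) l)" for j i l
      using Y_cont[of j] by (cases "j \<le> n") (auto simp: Y'_def)
    have "continuous_on UNIV (\<lambda>t. plucker (\<lambda>(i, j) a. Y' t j (a + 1)) x)" for x
    proof -
      obtain i j L where x: "x = ((i, j), L)" by (metis prod.exhaust)
      show ?thesis unfolding x plucker_wdet by (rule wdet_continuous) (simp add: Yc)
    qed
    then have "continuous_on UNIV (\<lambda>t. peval (plucker (\<lambda>(i, j) a. Y' t j (a + 1))) F)"
      unfolding peval_def by (intro continuous_intros)
    moreover have "peval (plucker (\<lambda>(i, j) a. Y' t j (a + 1))) F = f t" for t
      unfolding f_def
    proof (rule peval_cong[OF F])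
      fix x assume x: "x \<in> X_vars n"
      obtain i j L where xe: "x = ((i, j), L)" by (metis prod.exhaust)
      then have "j \<le> n" using X_varsD(1)[of i j L n] x rootsD by fastforce
      then show "plucker (\<lambda>(i, j) a. Y' t j (a + 1)) x = plucker (\<lambda>(i, j) a. Y t j (a + 1)) x"
        by (simp add: xe plucker_wdet Y'_def)
    qed
    ultimately show ?thesis by simp
  qed
  have "f 0 = 0"
  proof -
    define S where "S = (\<lambda>(i, j). - A j i i) ` roots n"
    have "closed (S - {0})" unfolding S_def by (intro finite_imp_closed) (simp add: finite_roots)
    then have "open (- (S - {0}))" by (rule open_Compl)
    moreover have "f t = 0" if "t \<in> - (S - {0})" "t \<noteq> 0" for t
    proof (rule f_zero)
      fix i j assume "(i, j) \<in> roots n"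
      then have "- A j i i \<in> S" by (force simp: S_def)
      then have "t \<noteq> - A j i i" using that by auto
      then show "A j i i + t \<noteq> 0" by (auto simp: add_eq_0_iff)
    qed
    ultimately have "eventually (\<lambda>t. f t = 0) (at 0)"
      unfolding eventually_at_topological by (intro exI[of _ "- (S - {0})"]) auto
    then have "(f \<longlongrightarrow> 0) (at 0)" by (rule tendsto_eventually)
    moreover have "(f \<longlongrightarrow> f 0) (at 0)"
      using f_cont by (simp add: continuous_on_def)
    ultimately show "f 0 = 0" using tendsto_unique[of "at (0::complex)" f "f 0" 0] by simp
  qed
  have "\<forall>x\<in>roots n \<times> UNIV. \<exists>C. snd x < fst (fst x) \<longrightarrow> u (fst x) (snd x) = (\<Sum>b<fst (fst x). scl (C b) (Y 0 (snd (fst x)) (b + 1)))"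
  proof
    fix x :: "(nat \<times> nat) \<times> nat" assume "x \<in> roots n \<times> UNIV"
    then obtain i j a where x: "x = ((i, j), a)" and r: "(i, j) \<in> roots n" by (metis mem_Times_iff prod.collapse)
    show "\<exists>C. snd x < fst (fst x) \<longrightarrow> u (fst x) (snd x) = (\<Sum>b<fst (fst x). scl (C b) (Y 0 (snd (fst x)) (b + 1)))"
    proof (cases "a < i")
      case True
      have "u (i, j) a \<in> pm.span (u (i, j) ` {..<i})" using True by (intro pm.span_base) auto
      also have "\<dots> = pm.span (y j ` {1..i})" using u y(1)[OF r] r by fastforce
      also have "y j ` {1..i} = (\<lambda>b. Y 0 j (b + 1)) ` {..<i}"
      proof -
        have "{1..i} = (\<lambda>b. b + 1) ` {..<i}" using image_Suc_lessThan[of i] by simp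
        moreover have "y j (b + 1) = Y 0 j (b + 1)" if "b < i" for b
          using Y_0[of j] rootsD[OF r] that by auto
        ultimately show ?thesis by (auto simp: image_image)
      qed
      finally show ?thesis using span_image_finite[of "{..<i}"] by (auto simp: x)
    qed (simp add: x)
  qed
  then have "\<exists>C. \<forall>x\<in>roots n \<times> UNIV. snd x < fst (fst x) \<longrightarrow> u (fst x) (snd x) = (\<Sum>b<fst (fst x). scl (C x b) (Y 0 (snd (fst x)) (b + 1)))"
    by (rule bchoice)
  then obtain C where C: "\<forall>x\<in>roots n \<times> UNIV. snd x < fst (fst x) \<longrightarrow> u (fst x) (snd x) = (\<Sum>b<fst (fst x). scl (C x b) (Y 0 (snd (fst x)) (b + 1)))" ..
  show "peval (plucker u) F = 0"
  proof (rule peval_plucker_lincomb[OF F hom, where C = "\<lambda>x a. C (x, a)" and u' = "\<lambda>(i, j) a. Y 0 j (a + 1)"])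
    fix i j a assume "(i, j) \<in> roots n" "a < i"
    then show "u (i, j) a = (\<Sum>b<i. scl (C ((i, j), a) b) ((\<lambda>(i, j) a. Y 0 j (a + 1)) (i, j) b))"
      using bspec[OF C, of "((i, j), a)"] by simp
  qed (use \<open>f 0 = 0\<close> in \<open>simp add: f_def\<close>)
qed

section \<open>Symbols of functionals on the modules \<open>M\<^sub>m\<close>\<close>

definition has_symbol ::
  "nat \<Rightarrow> 'v fmodule \<Rightarrow> 'v \<Rightarrow> ('v \<Rightarrow> complex) \<Rightarrow> (nat \<times> nat) mpoly \<Rightarrow> bool" where
  "has_symbol n V v \<phi> g \<longleftrightarrow> \<phi> \<in> dual V \<and> is_symbol n V \<phi> v g"

lemma has_symbol_lincomb:
  assumes "root_module V n" "v \<in> carrier V" "has_symbol n V v \<phi> g" "has_symbol n V v \<psi> h"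
  shows "has_symbol n V v (\<lambda>x\<in>carrier V. a * \<phi> x + b * \<psi> x) (scl a g + scl b h)"
  using assms(3,4) unfolding has_symbol_def
  by (intro conjI dual_lincomb[OF root_module_module[OF assms(1)]] is_symbol_lincomb[OF assms(1,2)]) simp_all

lemma has_symbol_zero:
  assumes "root_module V n" "v \<in> carrier V"
  shows "has_symbol n V v (\<lambda>x\<in>carrier V. 0) 0"
  unfolding has_symbol_def
  by (intro conjI dual_zero[OF root_module_module[OF assms(1)]] is_symbol_zero[OF assms])

lemma has_symbol_sum:
  assumes V: "root_module V n" "v \<in> carrier V" and I: "finite I"
    and \<phi>: "\<And>i. i \<in> I \<Longrightarrow> has_symbol n V v (\<lambda>x\<in>carrier V. \<phi> i x) (g i)"
  shows "has_symbol n V v (\<lambda>x\<in>carrier V. \<Sum>i\<in>I. \<phi> i x) (\<Sum>i\<in>I. g i)"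
  using I \<phi>
proof (induction I)
  case empty
  show ?case unfolding sum.empty by (rule has_symbol_zero[OF V])
next
  case (insert i I)
  let ?a = "\<lambda>x\<in>carrier V. \<phi> i x" and ?b = "\<lambda>x\<in>carrier V. \<Sum>i\<in>I. \<phi> i x"
  have e: "(\<lambda>x\<in>carrier V. \<Sum>i\<in>insert i I. \<phi> i x) = (\<lambda>x\<in>carrier V. 1 * ?a x + 1 * ?b x)"
    using insert.hyps by (auto simp: restrict_def)
  have s: "sum g (insert i I) = scl 1 (g i) + scl 1 (sum g I)" using insert.hyps by simp
  show ?case unfolding e s
    by (rule has_symbol_lincomb[OF V]) (use insert in blast)+
qed

lemma choice_on:
  assumes "\<And>x. x \<in> A \<Longrightarrow> \<exists>y. P x y"
  obtains f where "\<And>x. x \<in> A \<Longrightarrow> P x (f x)"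
  using assms by metis

text \<open>If the functionals in \<open>\<Psi>\<close> separate points, they span the dual space, so it suffices to know their
  symbols.\<close>

lemma dual_basis_symbols:
  assumes V: "root_module V n" and v: "v \<in> carrier V"
    and \<Psi>: "finite \<Psi>" "separates \<Psi> V"
    and S: "pm.subspace S" "\<And>\<psi>. \<psi> \<in> \<Psi> \<Longrightarrow> \<exists>g\<in>S. has_symbol n V v \<psi> g"
  obtains E \<epsilon> where "dual_basis V E \<epsilon>" "\<And>\<phi>. \<phi> \<in> dual V \<Longrightarrow> \<exists>g\<in>S. has_symbol n V v \<phi> g"
proof -
  interpret root_module V n by (rule V)
  define D where "D = {\<phi>. \<exists>g\<in>S. has_symbol n V v \<phi> g}"
  have "\<exists>E \<epsilon>. dual_basis V E \<epsilon> \<and> (\<forall>e\<in>E. \<epsilon> e \<in> D) \<and>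
      (\<forall>\<phi>\<in>dual V. \<forall>x\<in>carrier V. \<phi> x = (\<Sum>e\<in>E. \<epsilon> e x * \<phi> e))"
  proof (rule exists_dual_basis[OF module_axioms \<Psi>(1), of D])
    show "\<Psi> \<subseteq> D" using S(2) by (auto simp: D_def)
    show "D \<subseteq> dual V" by (auto simp: D_def has_symbol_def)
    show "separates \<Psi> V" by fact
    show "(\<lambda>x\<in>carrier V. 0) \<in> D"
      unfolding D_def using has_symbol_zero[OF V v] pm.subspace_0[OF S(1)] by blast
    show "(\<lambda>x\<in>carrier V. a * \<phi> x + b * \<psi> x) \<in> D" if D: "\<phi> \<in> D" "\<psi> \<in> D" for \<phi> \<psi> a b
    proof -
      obtain g h where "g \<in> S" "h \<in> S" "has_symbol n V v \<phi> g" "has_symbol n V v \<psi> h"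
        using D by (auto simp: D_def)
      moreover from this have "scl a g + scl b h \<in> S" using S(1) by (simp add: pm.subspace_add pm.subspace_scale)
      ultimately show ?thesis unfolding D_def using has_symbol_lincomb[OF V v] by blast
    qed
  next
    fix E \<epsilon> assume "dual_basis V E \<epsilon>" "\<And>e. e \<in> E \<Longrightarrow> \<epsilon> e \<in> D"
      "\<And>\<phi> x. \<phi> \<in> dual V \<Longrightarrow> x \<in> carrier V \<Longrightarrow> \<phi> x = (\<Sum>e\<in>E. \<epsilon> e x * \<phi> e)"
    then show ?thesis by blast
  qed
  then obtain E \<epsilon> where E: "dual_basis V E \<epsilon>" "\<forall>e\<in>E. \<epsilon> e \<in> D"
    "\<forall>\<phi>\<in>dual V. \<forall>x\<in>carrier V. \<phi> x = (\<Sum>e\<in>E. \<epsilon> e x * \<phi> e)" by blast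
  have ex: "\<exists>g. g \<in> S \<and> is_symbol n V (\<epsilon> e) v g" if "e \<in> E" for e
    using that E(2) by (auto simp: D_def has_symbol_def)
  obtain g where g: "\<And>e. e \<in> E \<Longrightarrow> g e \<in> S \<and> is_symbol n V (\<epsilon> e) v (g e)"
    by (rule choice_on, erule ex) (rule that; assumption)
  have "\<exists>g\<in>S. has_symbol n V v \<phi> g" if \<phi>: "\<phi> \<in> dual V" for \<phi>
  proof
    show "(\<Sum>e\<in>E. scl (\<phi> e) (g e)) \<in> S" using g S(1) by (auto intro!: pm.subspace_sum pm.subspace_scale)
    show "has_symbol n V v \<phi> (\<Sum>e\<in>E. scl (\<phi> e) (g e))"
      unfolding has_symbol_def is_symbol_def
    proof (intro conjI \<phi> ballI)
      fix ws assume ws: "ws \<in> lists (roots n)"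
      then have "\<phi> (actw V ws v) = (\<Sum>e\<in>E. \<epsilon> e (actw V ws v) * \<phi> e)"
        using E(3) \<phi> actw_closed[OF ws v] by blast
      also have "\<dots> = (\<Sum>e\<in>E. \<phi> e * lookup (dword ws (g e)) 0)"
        using g ws by (intro sum.cong) (auto simp: is_symbol_def)
      finally show "\<phi> (actw V ws v) = lookup (dword ws (\<Sum>e\<in>E. scl (\<phi> e) (g e))) 0"
        by (simp add: dword_sum dword_scl lookup_sum)
    qed
  qed
  then show ?thesis using that E(1) by blast
qed

context cyclic
begin

lemma restrict_symbol:
  assumes "\<phi> \<in> dual T" "is_symbol n T \<phi> v g"
  shows "has_symbol n C v (restrict \<phi> (carrier C)) g"
  unfolding has_symbol_def
proof
  show "restrict \<phi> (carrier C) \<in> dual C"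
    by (rule dualI[OF root_module_module[OF root_module_C]])
      (use C_sub in \<open>auto simp: dualD[OF assms(1)] subset_iff\<close>)
  show "is_symbol n C (restrict \<phi> (carrier C)) v g"
    using assms(2) root_module.actw_closed[OF root_module_C _ v_in_C] by (auto simp: is_symbol_def)
qed

end

lemma span_mult:
  assumes "p \<in> pm.span A" "q \<in> pm.span B" "\<And>a b. a \<in> A \<Longrightarrow> b \<in> B \<Longrightarrow> a * b \<in> pm.span U"
  shows "p * q \<in> pm.span (U :: 'x mpoly set)"
proof -
  have 1: "A \<subseteq> {p. p * b \<in> pm.span U}" if "b \<in> B" for b using assms(3) that by blast
  have sub: "pm.subspace {p. p * q \<in> pm.span U}" "pm.subspace {q. p * q \<in> pm.span U}" for p q
    by (auto simp: pm.subspace_def distrib_right distrib_left scl_mult_left scl_mult_right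
        pm.span_add pm.span_scale pm.span_zero)
  have "p * b \<in> pm.span U" if "b \<in> B" for b
    using pm.span_minimal[OF 1[OF that] sub(1)] assms(1) by blast
  then have "B \<subseteq> {q. p * q \<in> pm.span U}" by blast
  from pm.span_minimal[OF this sub(2)] assms(2) show ?thesis by blast
qed

text \<open>An assignment chooses a minor for each tensor factor of \<open>M\<^sub>m\<close>.\<close>

definition assignments :: "nat \<Rightarrow> (nat \<times> nat \<Rightarrow>\<^sub>0 nat) \<Rightarrow> ((nat \<times> nat) \<times> nat \<Rightarrow> nat set) set" where
  "assignments n m = {ls. \<forall>k\<in>factors m. (fst k, ls k) \<in> X_vars n}"

definition Delta_prod :: "(nat \<times> nat \<Rightarrow>\<^sub>0 nat) \<Rightarrow> ((nat \<times> nat) \<times> nat \<Rightarrow> nat set) \<Rightarrow> (nat \<times> nat) mpoly" where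
  "Delta_prod m ls = (\<Prod>k\<in>factors m. Delta (fst k, ls k))"

definition symbols :: "nat \<Rightarrow> (nat \<times> nat \<Rightarrow>\<^sub>0 nat) \<Rightarrow> (nat \<times> nat) mpoly set" where
  "symbols n m = pm.span (Delta_prod m ` assignments n m)"

lemma finite_factors: "finite (factors m)"
proof (rule finite_subset)
  show "factors m \<subseteq> (SIGMA \<alpha>:keys m. {..<lookup m \<alpha>})" by (auto simp: factors_def in_keys_iff)
qed simp

lemma factors_root: "m \<in> multidegs n \<Longrightarrow> k \<in> factors m \<Longrightarrow> fst k \<in> roots n"
  by (auto simp: factors_def multidegs_def in_keys_iff subset_iff)

lemma symbols_subspace: "pm.subspace (symbols n m)"
  by (simp add: symbols_def)

lemma symbols_closed: "symbols n m \<subseteq> carrier (S_alg n)"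
  unfolding symbols_def
proof (intro pm.span_minimal poly_alg_subspace subsetI)
  fix p assume "p \<in> Delta_prod m ` assignments n m"
  then obtain ls where l: "ls \<in> assignments n m" "p = Delta_prod m ls" by blast
  have "(\<Prod>k\<in>K. Delta (fst k, ls k)) \<in> carrier (S_alg n)" if "finite K" "K \<subseteq> factors m" for K
    using that
  proof (induction K)
    case (insert k K)
    obtain i j where ij: "fst k = (i, j)" by (cases "fst k")
    have "((i, j), ls k) \<in> X_vars n" using l insert.prems ij by (auto simp: assignments_def)
    then have "Delta (fst k, ls k) \<in> carrier (S_alg n)" unfolding ij by (rule Delta_closed)
    then show ?case using insert by (simp add: poly_alg_closed)
  qed (simp add: poly_alg_closed)
  then show "p \<in> carrier (S_alg n)" using l finite_factors by (simp add: Delta_prod_def)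
qed

text \<open>The factors of \<open>m1 + m2\<close> are those of \<open>m1\<close> followed by those of \<open>m2\<close>, shifted.\<close>

lemma symbols_mult:
  assumes "p \<in> symbols n m1" "q \<in> symbols n m2"
  shows "p * q \<in> symbols n (m1 + m2)"
  unfolding symbols_def
proof (rule span_mult[OF assms[unfolded symbols_def]])
  fix a b assume "a \<in> Delta_prod m1 ` assignments n m1" "b \<in> Delta_prod m2 ` assignments n m2"
  then obtain ls1 ls2 where l: "ls1 \<in> assignments n m1" "ls2 \<in> assignments n m2"
    "a = Delta_prod m1 ls1" "b = Delta_prod m2 ls2" by blast
  define sh where "sh = (\<lambda>(\<alpha>, r). (\<alpha>, r + lookup m1 \<alpha>))"
  define ls where "ls = (\<lambda>(\<alpha>, r). if r < lookup m1 \<alpha> then ls1 (\<alpha>, r) else ls2 (\<alpha>, r - lookup m1 \<alpha>))"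
  have inj: "inj_on sh (factors m2)" by (auto simp: inj_on_def sh_def)
  have un: "factors (m1 + m2) = factors m1 \<union> sh ` factors m2"
  proof
    show "factors (m1 + m2) \<subseteq> factors m1 \<union> sh ` factors m2"
    proof clarify
      fix i j r assume "((i, j), r) \<in> factors (m1 + m2)" "((i, j), r) \<notin> sh ` factors m2"
      moreover have "((i, j), r) = sh ((i, j), r - lookup m1 (i, j))" if "lookup m1 (i, j) \<le> r"
        using that by (simp add: sh_def)
      moreover have "((i, j), r - lookup m1 (i, j)) \<in> factors m2"
        if "lookup m1 (i, j) \<le> r" "((i, j), r) \<in> factors (m1 + m2)"
        using that by (auto simp: factors_def lookup_add)
      ultimately show "((i, j), r) \<in> factors m1" by (force simp: factors_def)
    qed
    show "factors m1 \<union> sh ` factors m2 \<subseteq> factors (m1 + m2)"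
      by (auto simp: factors_def sh_def lookup_add)
  qed
  have dis: "factors m1 \<inter> sh ` factors m2 = {}" by (auto simp: factors_def sh_def)
  have l1: "ls k = ls1 k" if "k \<in> factors m1" for k
    using that by (auto simp: factors_def ls_def)
  have l2: "ls (sh k) = ls2 k" for k by (cases k) (simp add: sh_def ls_def)
  have fsh: "fst (sh k) = fst k" for k by (cases k) (simp add: sh_def)
  have "Delta_prod (m1 + m2) ls = Delta_prod m1 ls * (\<Prod>k\<in>sh ` factors m2. Delta (fst k, ls k))"
    unfolding Delta_prod_def un by (rule prod.union_disjoint) (use dis finite_factors in auto)
  also have "(\<Prod>k\<in>sh ` factors m2. Delta (fst k, ls k)) = b"
    by (simp add: prod.reindex[OF inj] l2 fsh l(4) Delta_prod_def)
  also have "Delta_prod m1 ls = a" unfolding l(3) Delta_prod_def by (rule prod.cong) (auto simp: l1)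
  finally have "a * b = Delta_prod (m1 + m2) ls" by simp
  moreover have "ls \<in> assignments n (m1 + m2)"
    using l(1,2) l1 l2 fsh by (auto simp: assignments_def un)
  ultimately show "a * b \<in> pm.span (Delta_prod (m1 + m2) ` assignments n (m1 + m2))"
    by (simp add: pm.span_base)
qed

lemma symbols_0: "symbols n 0 = {p. \<exists>c. p = scl c 1}"
proof -
  have "factors 0 = {}" by (auto simp: factors_def)
  then have "Delta_prod 0 ` assignments n 0 = {1}" by (auto simp: Delta_prod_def assignments_def)
  then show ?thesis by (auto simp: symbols_def pm.span_singleton)
qed

lemma one_in_symbols: "1 \<in> symbols n 0"
  unfolding symbols_0 by (intro CollectI exI[of _ 1]) simp

lemma symbols_trivial:
  assumes "m \<notin> multidegs n" shows "symbols n m = {0}"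
proof -
  obtain \<alpha> where a: "\<alpha> \<in> keys m" "\<alpha> \<notin> roots n" using assms by (auto simp: multidegs_def)
  then have "(\<alpha>, 0) \<in> factors m" by (cases \<alpha>) (auto simp: factors_def in_keys_iff)
  then have "assignments n m = {}" using a by (fastforce simp: assignments_def X_vars_def)
  then show ?thesis by (simp add: symbols_def)
qed

lemma Delta_in_symbols:
  assumes "x \<in> X_vars n" shows "Delta x \<in> symbols n (single (fst x) 1)"
proof -
  have "factors (single (fst x) 1) = {(fst x, 0)}"
    by (cases x) (auto simp: factors_def lookup_single when_def split: if_splits)
  then have "Delta x = Delta_prod (single (fst x) 1) (\<lambda>_. snd x)" "(\<lambda>_. snd x) \<in> assignments n (single (fst x) 1)"
    using assms by (auto simp: Delta_prod_def assignments_def)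
  then show ?thesis unfolding symbols_def using pm.span_base by (metis imageI)
qed

definition minors :: "nat \<Rightarrow> nat \<times> nat \<Rightarrow> (nat \<times> nat) mpoly set" where
  "minors n \<alpha> = {Delta (\<alpha>, L) | L. (\<alpha>, L) \<in> X_vars n}"

abbreviation root_symbol :: "nat \<Rightarrow> nat \<times> nat \<Rightarrow> ((nat \<times> nat) mpoly set \<Rightarrow> complex) \<Rightarrow> (nat \<times> nat) mpoly \<Rightarrow> bool" where
  "root_symbol n \<alpha> \<equiv> has_symbol n (M_root n \<alpha>) \<one>\<^bsub>M_root n \<alpha>\<^esub>"

abbreviation M_symbol :: "nat \<Rightarrow> (nat \<times> nat \<Rightarrow>\<^sub>0 nat) \<Rightarrow> (M_elem \<Rightarrow> complex) \<Rightarrow> (nat \<times> nat) mpoly \<Rightarrow> bool" where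
  "M_symbol n m \<equiv> has_symbol n (M_mod n m) (v_vec n m)"

lemma fundamental_dual_basis:
  assumes "\<alpha> \<in> roots n"
  shows "root_module (M_root n \<alpha>) n" "\<one>\<^bsub>M_root n \<alpha>\<^esub> \<in> carrier (M_root n \<alpha>)"
    "\<exists>E \<epsilon>. dual_basis (M_root n \<alpha>) E \<epsilon> \<and>
      (\<forall>\<phi>\<in>dual (M_root n \<alpha>). \<exists>g\<in>pm.span (minors n \<alpha>). root_symbol n \<alpha> \<phi> g)"
    "\<And>L. (\<alpha>, L) \<in> X_vars n \<Longrightarrow> \<exists>\<phi>. root_symbol n \<alpha> \<phi> (Delta (\<alpha>, L))"
proof -
  obtain i j where a: "\<alpha> = (i, j)" by (cases \<alpha>)
  interpret fundamental n i j using assms a by unfold_locales simp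
  show 1: "root_module (M_root n \<alpha>) n" unfolding a by (rule root_module_M)
  show 2: "\<one>\<^bsub>M_root n \<alpha>\<^esub> \<in> carrier (M_root n \<alpha>)" unfolding a M_simps by (simp add: poly_alg_closed)
  have pl: "root_symbol n \<alpha> (plucker_fun L) (Delta (\<alpha>, L))" if "(\<alpha>, L) \<in> X_vars n" for L
    using plucker_fun_dual plucker_fun_symbol that unfolding a has_symbol_def by blast
  then show "\<exists>\<phi>. root_symbol n \<alpha> \<phi> (Delta (\<alpha>, L))" if "(\<alpha>, L) \<in> X_vars n" for L
    using that by blast
  show "\<exists>E \<epsilon>. dual_basis (M_root n \<alpha>) E \<epsilon> \<and>
      (\<forall>\<phi>\<in>dual (M_root n \<alpha>). \<exists>g\<in>pm.span (minors n \<alpha>). root_symbol n \<alpha> \<phi> g)"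
  proof (rule dual_basis_symbols[OF 1 2, of "plucker_fun ` {L. (\<alpha>, L) \<in> X_vars n}" "pm.span (minors n \<alpha>)"])
    show "finite (plucker_fun ` {L. (\<alpha>, L) \<in> X_vars n})" using finite_X_vars_L by simp
    show "separates (plucker_fun ` {L. (\<alpha>, L) \<in> X_vars n}) (M_root n \<alpha>)"
      unfolding a by (rule plucker_fun_separates)
    fix \<psi> assume "\<psi> \<in> plucker_fun ` {L. (\<alpha>, L) \<in> X_vars n}"
    then obtain L where "(\<alpha>, L) \<in> X_vars n" "\<psi> = plucker_fun L" by blast
    then show "\<exists>g\<in>pm.span (minors n \<alpha>). root_symbol n \<alpha> \<psi> g"
      using pl by (intro bexI[of _ "Delta (\<alpha>, L)"] pm.span_base) (auto simp: minors_def)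
  qed (simp, blast)
qed

abbreviation M_factors :: "nat \<Rightarrow> (nat \<times> nat) \<times> nat \<Rightarrow> (nat \<times> nat) mpoly set fmodule" where
  "M_factors n \<equiv> \<lambda>(\<alpha>, r). M_root n \<alpha>"

lemma prod_of_spans:
  assumes "finite K" "\<And>k. k \<in> K \<Longrightarrow> g k \<in> pm.span (minors n (fst k))"
  shows "(\<Prod>k\<in>K. g k) \<in> pm.span {\<Prod>k\<in>K. Delta (fst k, ls k) | ls. \<forall>k\<in>K. (fst k, ls k) \<in> X_vars n}"
  using assms
proof (induction K)
  case empty
  show ?case by (rule pm.span_base) simp
next
  case (insert a K)
  have "g a * (\<Prod>k\<in>K. g k) \<in> pm.span {\<Prod>k\<in>insert a K. Delta (fst k, ls k) | ls. \<forall>k\<in>insert a K. (fst k, ls k) \<in> X_vars n}"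
  proof (rule span_mult)
    show "g a \<in> pm.span (minors n (fst a))" using insert by simp
    show "prod g K \<in> pm.span {\<Prod>k\<in>K. Delta (fst k, ls k) | ls. \<forall>k\<in>K. (fst k, ls k) \<in> X_vars n}"
      using insert by simp
    fix p q assume "p \<in> minors n (fst a)"
      "q \<in> {\<Prod>k\<in>K. Delta (fst k, ls k) | ls. \<forall>k\<in>K. (fst k, ls k) \<in> X_vars n}"
    then obtain L ls where l: "(fst a, L) \<in> X_vars n" "p = Delta (fst a, L)"
      "\<forall>k\<in>K. (fst k, ls k) \<in> X_vars n" "q = (\<Prod>k\<in>K. Delta (fst k, ls k))" by (auto simp: minors_def)
    have "(\<Prod>k\<in>K. Delta (fst k, (ls(a := L)) k)) = q"
      unfolding l(4) using insert.hyps by (intro prod.cong) auto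
    then have "p * q = (\<Prod>k\<in>insert a K. Delta (fst k, (ls(a := L)) k))"
      using insert.hyps by (simp add: l(2) del: fun_upd_apply) simp
    moreover have "\<forall>k\<in>insert a K. (fst k, (ls(a := L)) k) \<in> X_vars n" using l insert.hyps by auto
    ultimately show "p * q \<in> pm.span {\<Prod>k\<in>insert a K. Delta (fst k, ls k) | ls. \<forall>k\<in>insert a K. (fst k, ls k) \<in> X_vars n}"
      by (intro pm.span_base) blast
  qed
  then show ?case using insert by simp
qed

locale M_module =
  fixes n m assumes m: "m \<in> multidegs n"
begin

sublocale TP: tensor_product "factors m" "M_factors n" n
proof (rule tensor_product.intro)
  show "finite (factors m)" by (rule finite_factors)
  fix k assume k: "k \<in> factors m"
  show "root_module (M_factors n k) n"
    using fundamental_dual_basis(1)[OF factors_root[OF m k]] by (simp add: case_prod_beta)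
qed

definition x0 :: "(nat \<times> nat) \<times> nat \<Rightarrow> (nat \<times> nat) mpoly set" where
  "x0 = restrict (\<lambda>(\<alpha>, r). \<one>\<^bsub>M_root n \<alpha>\<^esub>) (factors m)"

lemma x0: "x0 \<in> TP.X"
  unfolding x0_def
proof (rule restrict_PiE_iff[THEN iffD2], rule ballI)
  fix k assume k: "k \<in> factors m"
  show "(case k of (\<alpha>, r) \<Rightarrow> \<one>\<^bsub>M_root n \<alpha>\<^esub>) \<in> carrier (M_factors n k)"
    using fundamental_dual_basis(2)[OF factors_root[OF m k]] by (simp add: case_prod_beta)
qed

lemma v_vec: "v_vec n m = TP.pure x0"
  by (simp add: v_vec_def pure_tensor_def x0_def)

sublocale C: cyclic TP.T n "v_vec n m"
  unfolding cyclic_def cyclic_axioms_def v_vec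
  using TP.root_module_T TP.pure_in_T[OF x0] by blast

lemma M_mod: "M_mod n m = C.C"
  by (simp add: M_mod_def)

lemma root_module_M_mod: "root_module (M_mod n m) n"
  unfolding M_mod by (rule C.root_module_C)

lemma v_in_M: "v_vec n m \<in> carrier (M_mod n m)"
  unfolding M_mod by (rule C.v_in_C)

lemma product_functional:
  assumes "\<And>k. k \<in> factors m \<Longrightarrow> root_symbol n (fst k) (\<phi> k) (g k)"
  shows "M_symbol n m (restrict (tensor_functional (factors m) \<phi>) (carrier (M_mod n m))) (\<Prod>k\<in>factors m. g k)"
proof -
  have d: "\<phi> k \<in> dual (M_factors n k)" if "k \<in> factors m" for k
    using assms[OF that] by (cases k) (auto simp: has_symbol_def)
  have s: "is_symbol n (M_factors n k) (\<phi> k) (x0 k) (g k)" if "k \<in> factors m" for k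
    using assms[OF that] that by (cases k) (auto simp: x0_def has_symbol_def)
  have sub: "carrier (M_mod n m) \<subseteq> carrier TP.T" unfolding M_mod by (rule C.C_sub)
  let ?\<phi> = "restrict (tensor_functional (factors m) \<phi>) (carrier TP.T)"
  have "is_symbol n TP.T ?\<phi> (v_vec n m) (\<Prod>k\<in>factors m. g k)"
    using TP.tensor_symbol[OF d s] root_module.actw_closed[OF TP.root_module_T _ C.v]
    by (simp add: is_symbol_def v_vec)
  from C.restrict_symbol[OF TP.tensor_functional_dual[OF d] this]
  have "M_symbol n m (restrict ?\<phi> (carrier (M_mod n m))) (\<Prod>k\<in>factors m. g k)" by (simp add: M_mod)
  also have "restrict ?\<phi> (carrier (M_mod n m)) = restrict (tensor_functional (factors m) \<phi>) (carrier (M_mod n m))"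
    using sub by (auto simp: restrict_def fun_eq_iff)
  finally show ?thesis .
qed

text \<open>Products of functionals from dual bases of the factors separate the points of the tensor product, hence
  of the submodule \<open>M\<^sub>m\<close>.\<close>

lemma M_dual_basis:
  "\<exists>E \<epsilon>. dual_basis (M_mod n m) E \<epsilon> \<and> (\<forall>\<phi>\<in>dual (M_mod n m). \<exists>g\<in>symbols n m. M_symbol n m \<phi> g)"
proof -
  have ex: "\<exists>E\<epsilon>. dual_basis (M_root n (fst k)) (fst E\<epsilon>) (snd E\<epsilon>) \<and>
      (\<forall>\<phi>\<in>dual (M_root n (fst k)). \<exists>g\<in>pm.span (minors n (fst k)). root_symbol n (fst k) \<phi> g)"
    if "k \<in> factors m" for k
    using fundamental_dual_basis(3)[OF factors_root[OF m that]] by simp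
  obtain E\<epsilon> where
    E\<epsilon>: "\<And>k. k \<in> factors m \<Longrightarrow> dual_basis (M_root n (fst k)) (fst (E\<epsilon> k)) (snd (E\<epsilon> k)) \<and>
      (\<forall>\<phi>\<in>dual (M_root n (fst k)). \<exists>g\<in>pm.span (minors n (fst k)). root_symbol n (fst k) \<phi> g)"
    by (rule choice_on, erule ex) (rule that; assumption)
  define E where "E k = fst (E\<epsilon> k)" for k
  define \<epsilon> where "\<epsilon> k = snd (E\<epsilon> k)" for k
  have db: "dual_basis (M_root n (fst k)) (E k) (\<epsilon> k)"
    and sy: "\<phi> \<in> dual (M_root n (fst k)) \<Longrightarrow> \<exists>g. g \<in> pm.span (minors n (fst k)) \<and> root_symbol n (fst k) \<phi> g"
    if "k \<in> factors m" for k \<phi>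
    using E\<epsilon>[OF that] by (auto simp: E_def \<epsilon>_def)
  let ?tf = "\<lambda>\<rho>. tensor_functional (factors m) (\<lambda>k. \<epsilon> k (\<rho> k))"
  let ?\<Psi> = "(\<lambda>\<rho>. restrict (?tf \<rho>) (carrier (M_mod n m))) ` (\<Pi>\<^sub>E k\<in>factors m. E k)"
  have sep: "separates ?\<Psi> (M_mod n m)"
  proof -
    have "separates ((\<lambda>\<rho>. restrict (?tf \<rho>) (carrier TP.T)) ` (\<Pi>\<^sub>E k\<in>factors m. E k)) TP.T"
      by (rule TP.tensor_separates) (use db in \<open>auto simp: case_prod_beta\<close>)
    moreover have "carrier (M_mod n m) \<subseteq> carrier TP.T" unfolding M_mod by (rule C.C_sub)
    ultimately show ?thesis unfolding separates_def by (simp add: subset_iff)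
  qed
  have psi: "\<exists>g\<in>symbols n m. M_symbol n m (restrict (?tf \<rho>) (carrier (M_mod n m))) g"
    if \<rho>: "\<rho> \<in> (\<Pi>\<^sub>E k\<in>factors m. E k)" for \<rho>
  proof -
    have ex: "\<exists>g. g \<in> pm.span (minors n (fst k)) \<and> root_symbol n (fst k) (\<epsilon> k (\<rho> k)) g"
      if k: "k \<in> factors m" for k
    proof (rule sy[OF k])
      show "\<epsilon> k (\<rho> k) \<in> dual (M_root n (fst k))" using db[OF k] k \<rho> by (auto simp: dual_basis_def)
    qed
    obtain g where g: "\<And>k. k \<in> factors m \<Longrightarrow>
        g k \<in> pm.span (minors n (fst k)) \<and> root_symbol n (fst k) (\<epsilon> k (\<rho> k)) (g k)"
      by (rule choice_on, erule ex) (rule that; assumption)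
    have "(\<Prod>k\<in>factors m. g k) \<in> pm.span {\<Prod>k\<in>factors m. Delta (fst k, ls k) | ls. \<forall>k\<in>factors m. (fst k, ls k) \<in> X_vars n}"
      using g finite_factors by (intro prod_of_spans) auto
    also have "{\<Prod>k\<in>factors m. Delta (fst k, ls k) | ls. \<forall>k\<in>factors m. (fst k, ls k) \<in> X_vars n} = Delta_prod m ` assignments n m"
      by (auto simp: Delta_prod_def assignments_def)
    finally have "(\<Prod>k\<in>factors m. g k) \<in> symbols n m" by (simp add: symbols_def)
    moreover have "M_symbol n m (restrict (?tf \<rho>) (carrier (M_mod n m))) (\<Prod>k\<in>factors m. g k)"
      using g by (intro product_functional) blast
    ultimately show ?thesis by blast
  qed
  show ?thesis
  proof (rule dual_basis_symbols[OF root_module_M_mod v_in_M _ sep symbols_subspace])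
    show "finite ?\<Psi>"
      using finite_factors db by (intro finite_imageI finite_PiE) (auto simp: dual_basis_def)
    fix \<psi> assume "\<psi> \<in> ?\<Psi>"
    then show "\<exists>g\<in>symbols n m. M_symbol n m \<psi> g" using psi by blast
  next
    fix E' \<epsilon>' assume "dual_basis (M_mod n m) E' \<epsilon>'"
      "\<And>\<phi>. \<phi> \<in> dual (M_mod n m) \<Longrightarrow> \<exists>g\<in>symbols n m. M_symbol n m \<phi> g"
    then show ?thesis by blast
  qed
qed

text \<open>Conversely each product of minors comes from a product of Pluecker functionals.\<close>

lemma symbol_exists:
  assumes "g \<in> symbols n m"
  shows "\<exists>\<phi>. M_symbol n m \<phi> g"
  using assms unfolding symbols_def
proof (induction g rule: pm.span_induct_alt)
  case base
  show ?case using has_symbol_zero[OF root_module_M_mod v_in_M] by blast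
next
  case (step c x y)
  then obtain ls where l: "ls \<in> assignments n m" "x = Delta_prod m ls" by blast
  have ex: "\<exists>\<phi>. root_symbol n (fst k) \<phi> (Delta (fst k, ls k))" if "k \<in> factors m" for k
    using fundamental_dual_basis(4)[OF factors_root[OF m that]] l that by (simp add: assignments_def)
  obtain \<phi> where
    \<phi>: "\<And>k. k \<in> factors m \<Longrightarrow> root_symbol n (fst k) (\<phi> k) (Delta (fst k, ls k))" by (rule choice_on, erule ex) (rule that; assumption)
  have "M_symbol n m (restrict (tensor_functional (factors m) \<phi>) (carrier (M_mod n m))) x"
    unfolding l(2) Delta_prod_def by (rule product_functional[OF \<phi>])
  moreover from step obtain \<psi> where "M_symbol n m \<psi> y" by blast
  ultimately show ?case
    using has_symbol_lincomb[OF root_module_M_mod v_in_M, of _ x \<psi> y c 1] unfolding pm.scale_one by blast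
qed

lemma symbol_of_functional: "\<phi> \<in> dual (M_mod n m) \<Longrightarrow> \<exists>g\<in>symbols n m. M_symbol n m \<phi> g"
  using M_dual_basis by blast

lemma functional_determined: "M_symbol n m \<phi> g \<Longrightarrow> M_symbol n m \<psi> g \<Longrightarrow> \<phi> = \<psi>"
  using C.symbol_determines unfolding M_mod has_symbol_def by blast

end

section \<open>The multiplication\<close>

text \<open>The embedding exists by \<open>exists_cyclic_hom\<close>: a product of functionals on the two modules has a product
  of minors as symbol, and by \<open>symbol_exists\<close> some functional on \<open>M\<^bsub>m1 + m2\<^esub>\<close> has the same symbol. As the
  embedding is equivariant, pulling back along it does not change symbols.\<close>

lemma M_mult_symbol:
  assumes m1: "m1 \<in> multidegs n" and m2: "m2 \<in> multidegs n" and m: "m1 + m2 \<in> multidegs n"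
    and \<phi>1: "M_symbol n m1 \<phi>1 g1" and \<phi>2: "M_symbol n m2 \<phi>2 g2"
  shows "M_symbol n (m1 + m2) (\<lambda>x\<in>carrier (M_mod n (m1 + m2)).
    tensor_functional UNIV (case_bool \<phi>2 \<phi>1) (M_embedding n m1 m2 x)) (g1 * g2)" (is "M_symbol _ _ ?\<phi> _")
proof -
  interpret M1: M_module n m1 by unfold_locales (fact m1)
  interpret M2: M_module n m2 by unfold_locales (fact m2)
  interpret M: M_module n "m1 + m2" by unfold_locales (fact m)
  define V where "V = case_bool (M_mod n m2) (M_mod n m1)"
  define x where "x = case_bool (v_vec n m2) (v_vec n m1)"
  interpret B: tensor_product "UNIV :: bool set" V n
    by (rule tensor_product.intro) (auto simp: V_def M1.root_module_M_mod M2.root_module_M_mod split: bool.split)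
  have x: "x \<in> B.X"
    by (auto simp: x_def V_def M1.v_in_M M2.v_in_M split: bool.split)
  obtain E1 \<epsilon>1 where E1: "dual_basis (M_mod n m1) E1 \<epsilon>1" using M1.M_dual_basis by blast
  obtain E2 \<epsilon>2 where E2: "dual_basis (M_mod n m2) E2 \<epsilon>2" using M2.M_dual_basis by blast
  define E where "E = case_bool E2 E1"
  define \<epsilon> where "\<epsilon> = case_bool \<epsilon>2 \<epsilon>1"
  have db: "dual_basis (V k) (E k) (\<epsilon> k)" for k
    using E1 E2 by (simp add: V_def E_def \<epsilon>_def split: bool.split)
  let ?\<Psi> = "(\<lambda>\<rho>. restrict (tensor_functional UNIV (\<lambda>k. \<epsilon> k (\<rho> k))) (carrier B.T)) ` (\<Pi>\<^sub>E k\<in>UNIV. E k)"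
  have vT: "B.pure x \<in> carrier B.T" by (rule B.pure_in_T[OF x])
  have prod_symbol: "is_symbol n B.T (restrict (tensor_functional UNIV \<psi>) (carrier B.T)) (B.pure x) (h1 * h2)"
    if d: "\<And>k. \<psi> k \<in> dual (V k)" and s1: "is_symbol n (M_mod n m1) (\<psi> False) (v_vec n m1) h1"
      and s2: "is_symbol n (M_mod n m2) (\<psi> True) (v_vec n m2) h2" for \<psi> h1 h2
  proof -
    have "is_symbol n (V k) (\<psi> k) (x k) (case_bool h2 h1 k)" for k
      using s1 s2 by (cases k) (auto simp: V_def x_def)
    then have "is_symbol n B.T (tensor_functional UNIV \<psi>) (B.pure x) (\<Prod>k\<in>UNIV. case_bool h2 h1 k)"
      using d by (intro B.tensor_symbol)
    moreover have "(\<Prod>k\<in>UNIV. case_bool h2 h1 k) = h1 * h2" by (simp add: UNIV_bool)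
    ultimately show ?thesis
      using root_module.actw_closed[OF B.root_module_T _ vT] by (simp add: is_symbol_def)
  qed
  have "\<exists>!g. g \<in> linear_maps M.C.C B.T \<and>
      (\<forall>\<beta>\<in>roots n. \<forall>y\<in>carrier M.C.C. g (act M.C.C \<beta> y) = act B.T \<beta> (g y)) \<and> g (v_vec n (m1 + m2)) = B.pure x"
  proof (rule M.C.exists_cyclic_hom[OF B.root_module_T vT])
    show "separates ?\<Psi> B.T" by (rule B.tensor_separates) (rule db)
    have d: "\<epsilon> k (\<rho> k) \<in> dual (V k)" if "\<rho> \<in> (\<Pi>\<^sub>E k\<in>UNIV. E k)" for \<rho> k
      using db[of k] that by (auto simp: dual_basis_def PiE_iff)
    show "?\<Psi> \<subseteq> dual B.T"
    proof (rule image_subsetI)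
      fix \<rho> assume "\<rho> \<in> (\<Pi>\<^sub>E k\<in>UNIV. E k)"
      then show "restrict (tensor_functional UNIV (\<lambda>k. \<epsilon> k (\<rho> k))) (carrier B.T) \<in> dual B.T"
        by (intro B.tensor_functional_dual d)
    qed
    fix \<psi> assume "\<psi> \<in> ?\<Psi>"
    then obtain \<rho> where \<rho>: "\<rho> \<in> (\<Pi>\<^sub>E k\<in>UNIV. E k)"
      "\<psi> = restrict (tensor_functional UNIV (\<lambda>k. \<epsilon> k (\<rho> k))) (carrier B.T)" by blast
    have "\<epsilon> False (\<rho> False) \<in> dual (M_mod n m1)" "\<epsilon> True (\<rho> True) \<in> dual (M_mod n m2)"
      using d[OF \<rho>(1), of False] d[OF \<rho>(1), of True] by (simp_all add: V_def)
    then obtain h1 h2 where h: "h1 \<in> symbols n m1" "M_symbol n m1 (\<epsilon> False (\<rho> False)) h1"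
      "h2 \<in> symbols n m2" "M_symbol n m2 (\<epsilon> True (\<rho> True)) h2"
      using M1.symbol_of_functional M2.symbol_of_functional by metis
    have "is_symbol n B.T \<psi> (B.pure x) (h1 * h2)"
      unfolding \<rho>(2) using d[OF \<rho>(1)] h(2,4) by (intro prod_symbol) (simp_all add: has_symbol_def)
    moreover obtain \<phi>' where "M_symbol n (m1 + m2) \<phi>' (h1 * h2)"
      using M.symbol_exists[OF symbols_mult[OF h(1,3)]] by blast
    ultimately show "\<exists>\<phi>\<in>dual M.C.C. \<exists>g. is_symbol n M.C.C \<phi> (v_vec n (m1 + m2)) g \<and> is_symbol n B.T \<psi> (B.pure x) g"
      unfolding M.M_mod has_symbol_def by blast
  qed
  moreover have "pure_tensor UNIV V (case_bool (v_vec n m2) (v_vec n m1)) = B.pure x"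
    using B.pure_tensor[OF x] by (simp add: x_def)
  ultimately have "\<exists>!g. g \<in> linear_maps (M_mod n (m1 + m2)) B.T \<and>
      (\<forall>\<beta>\<in>roots n. \<forall>y\<in>carrier (M_mod n (m1 + m2)). g (act (M_mod n (m1 + m2)) \<beta> y) = act B.T \<beta> (g y)) \<and>
      g (v_vec n (m1 + m2)) = pure_tensor UNIV V (case_bool (v_vec n m2) (v_vec n m1))"
    unfolding M.M_mod by simp
  from theI'[OF this] have emb: "M_embedding n m1 m2 \<in> linear_maps (M_mod n (m1 + m2)) B.T"
    "\<And>\<beta> y. \<beta> \<in> roots n \<Longrightarrow> y \<in> carrier (M_mod n (m1 + m2)) \<Longrightarrow>
      M_embedding n m1 m2 (act (M_mod n (m1 + m2)) \<beta> y) = act B.T \<beta> (M_embedding n m1 m2 y)"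
    "M_embedding n m1 m2 (v_vec n (m1 + m2)) = B.pure x"
    using \<open>pure_tensor UNIV V _ = B.pure x\<close> unfolding M_embedding_def V_def Let_def by auto
  note embD = linear_mapsD[OF emb(1)]
  have d: "case_bool \<phi>2 \<phi>1 k \<in> dual (V k)" for k
    using \<phi>1 \<phi>2 by (cases k) (auto simp: V_def has_symbol_def)
  define t where "t = restrict (tensor_functional UNIV (case_bool \<phi>2 \<phi>1)) (carrier B.T)"
  have t: "t \<in> dual B.T" unfolding t_def by (rule B.tensor_functional_dual) (rule d)
  have tsym: "is_symbol n B.T t (B.pure x) (g1 * g2)"
    unfolding t_def using \<phi>1 \<phi>2 by (intro prod_symbol d) (auto simp: has_symbol_def)
  have \<phi>: "?\<phi> = restrict (\<lambda>y. t (M_embedding n m1 m2 y)) (carrier (M_mod n (m1 + m2)))"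
    using embD(1) by (auto simp: t_def restrict_def fun_eq_iff)
  have w: "M_embedding n m1 m2 (actw (M_mod n (m1 + m2)) ws y) = actw B.T ws (M_embedding n m1 m2 y)"
    if "ws \<in> lists (roots n)" "y \<in> carrier (M_mod n (m1 + m2))" for ws y
    using that root_module.act_closed[OF M.root_module_M_mod]
    by (induction ws arbitrary: y) (simp_all add: emb(2))
  show ?thesis
    unfolding \<phi> has_symbol_def is_symbol_def
  proof (intro conjI ballI dualI[OF root_module_module[OF M.root_module_M_mod]])
    fix ws assume ws: "ws \<in> lists (roots n)"
    then show "restrict (\<lambda>y. t (M_embedding n m1 m2 y)) (carrier (M_mod n (m1 + m2)))
        (actw (M_mod n (m1 + m2)) ws (v_vec n (m1 + m2))) = lookup (dword ws (g1 * g2)) 0"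
      using root_module.actw_closed[OF M.root_module_M_mod ws M.v_in_M] w[OF ws M.v_in_M] emb(3) tsym
      by (simp add: is_symbol_def)
  qed (simp_all add: embD dualD[OF t])
qed

section \<open>The graded evaluation\<close>

text \<open>Polynomials in the variables \<open>z\<^sub>\<alpha>\<close> with coefficients in \<open>S(\<nn>\<^sup>-)\<close> keep track of the multidegree.\<close>

type_synonym graded = "(nat \<times> nat \<Rightarrow>\<^sub>0 nat) \<Rightarrow>\<^sub>0 (nat \<times> nat) mpoly"

definition gconst :: "complex \<Rightarrow> graded" where
  "gconst a = single 0 (single 0 a)"

definition Ev :: "X_var mpoly \<Rightarrow> graded" where
  "Ev = insertion gconst (\<lambda>x. single (single (fst x) 1) (Delta x))"

lemma gconst_hom: "comm_ring_hom gconst"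
  by unfold_locales (simp_all add: gconst_def single_add mult_single)

lemma Ev_hom: "comm_ring_hom Ev"
  unfolding Ev_def by (rule insertion_hom[OF gconst_hom])

interpretation Ev: comm_ring_hom Ev
  by (rule Ev_hom)

lemma Ev_pvar: "Ev (pvar x) = single (single (fst x) 1) (Delta x)"
  by (simp add: Ev_def insertion_pvar[OF gconst_hom])

lemma lookup_single_mult:
  "lookup (single a d * f) (a + b) = d * lookup f b"
  for f :: graded
proof (induction f rule: pm_induct)
  case (single t c)
  show ?case by (simp add: mult_single lookup_single when_def)
qed (simp add: distrib_left lookup_add)

lemma lookup_Ev_scl: "lookup (Ev (scl c F)) m = scl c (lookup (Ev F) m)"
proof -
  have "Ev (scl c F) = gconst c * Ev F" by (simp add: Ev_def insertion_scl[OF gconst_hom])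
  then show ?thesis
    using lookup_single_mult[of 0 "single 0 c" "Ev F" m] by (simp add: gconst_def scl_eq_mult)
qed

lemma Ev_in_symbols:
  assumes "F \<in> carrier (poly_alg (X_vars n))"
  shows "lookup (Ev F) m \<in> symbols n m"
  using assms
proof (induction F arbitrary: m rule: mpoly_induct)
  case one
  show ?case using one_in_symbols by (simp add: lookup_one when_def pm.subspace_0[OF symbols_subspace])
next
  case (pvar x q)
  have e: "Ev (pvar x * q) = single (single (fst x) 1) (Delta x) * Ev q" by (simp add: Ev.hom_mult Ev_pvar)
  show ?case
  proof (cases "m \<in> keys (Ev (pvar x * q))")
    case True
    then obtain b where b: "m = single (fst x) 1 + b"
      using keys_mult[of "single (single (fst x) 1) (Delta x)" "Ev q"] unfolding e by (auto split: if_splits)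
    show ?thesis unfolding e b lookup_single_mult
      using pvar by (intro symbols_mult Delta_in_symbols)
  qed (simp add: in_keys_iff pm.subspace_0[OF symbols_subspace])
next
  case (add q r)
  then show ?case by (simp add: Ev.hom_add lookup_add pm.subspace_add[OF symbols_subspace])
next
  case (scl c q)
  then show ?case by (simp add: lookup_Ev_scl pm.subspace_scale[OF symbols_subspace])
qed

text \<open>The substitution maps the monomial of an assignment to the product of its minors, in degree \<open>m\<close>.\<close>

lemma symbols_lift:
  assumes "g \<in> symbols n m"
  shows "\<exists>F\<in>carrier (poly_alg (X_vars n)). Ev F = single m g"
  using assms unfolding symbols_def
proof (induction g rule: pm.span_induct_alt)
  case base
  show ?case by (intro bexI[of _ 0]) (simp_all add: poly_alg_closed)
next
  case (step c x y)
  then obtain ls where l: "ls \<in> assignments n m" "x = Delta_prod m ls" by blast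
  have P: "Ev (\<Prod>k\<in>K. pvar (fst k, ls k)) = single (\<Sum>k\<in>K. single (fst k) 1) (\<Prod>k\<in>K. Delta (fst k, ls k)) \<and>
      (\<Prod>k\<in>K. pvar (fst k, ls k)) \<in> carrier (poly_alg (X_vars n))" if "finite K" "K \<subseteq> factors m" for K
    using that
  proof (induction K)
    case (insert k K)
    then have "(fst k, ls k) \<in> X_vars n" using l by (auto simp: assignments_def)
    then show ?case using insert by (simp add: Ev.hom_mult Ev_pvar mult_single poly_alg_closed)
  qed (simp add: poly_alg_closed)
  have "(\<Sum>k\<in>factors m. single (fst k) 1) = m"
  proof (rule poly_mapping_eqI)
    fix \<alpha>
    have "lookup (\<Sum>k\<in>factors m. single (fst k) (1::nat)) \<alpha> = (\<Sum>k\<in>factors m. if fst k = \<alpha> then 1 else (0::nat))"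
      by (simp add: lookup_sum lookup_single when_def del: One_nat_def)
    also have "\<dots> = card {k \<in> factors m. fst k = \<alpha>}"
      using finite_factors by (simp add: sum.If_cases Int_def)
    also have "{k \<in> factors m. fst k = \<alpha>} = {\<alpha>} \<times> {..<lookup m \<alpha>}"
      by (auto simp: factors_def)
    finally show "lookup (\<Sum>k\<in>factors m. single (fst k) 1) \<alpha> = lookup m \<alpha>" by simp
  qed
  then obtain G where G: "G \<in> carrier (poly_alg (X_vars n))" "Ev G = single m x"
    using P[OF finite_factors order_refl] by (auto simp: l(2) Delta_prod_def)
  from step obtain H where H: "H \<in> carrier (poly_alg (X_vars n))" "Ev H = single m y" by blast
  have "Ev (scl c G + H) = single m (scl c x + y)"
    by (rule poly_mapping_eqI) (simp add: Ev.hom_add lookup_add lookup_Ev_scl G H lookup_single when_def)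
  then show ?case using G H by (intro bexI[of _ "scl c G + H"]) (simp_all add: poly_alg_closed)
qed

subsection \<open>The kernel is the ideal of the variety\<close>

definition mdeg :: "(X_var \<Rightarrow>\<^sub>0 nat) \<Rightarrow> (nat \<times> nat \<Rightarrow>\<^sub>0 nat)" where
  "mdeg t = (\<Sum>x\<in>keys t. single (fst x) (lookup t x))"

lemma lookup_mdeg:
  assumes "keys t \<subseteq> X_vars n"
  shows "lookup (mdeg t) \<alpha> = (\<Sum>L | (\<alpha>, L) \<in> X_vars n. lookup t (\<alpha>, L))"
proof -
  have "lookup (mdeg t) \<alpha> = (\<Sum>x\<in>keys t. if fst x = \<alpha> then lookup t x else 0)"
    by (simp add: mdeg_def lookup_sum lookup_single when_def)
  also have "\<dots> = (\<Sum>x\<in>X_vars n. if fst x = \<alpha> then lookup t x else 0)"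
    using assms finite_X_vars by (intro sum.mono_neutral_left) (auto simp: in_keys_iff)
  also have "\<dots> = (\<Sum>x\<in>{x \<in> X_vars n. fst x = \<alpha>}. lookup t x)"
    using finite_X_vars by (simp add: sum.If_cases Int_def)
  also have "\<dots> = (\<Sum>L | (\<alpha>, L) \<in> X_vars n. lookup t (\<alpha>, L))"
    by (rule sum.reindex_bij_witness[of _ "\<lambda>L. (\<alpha>, L)" snd]) auto
  finally show ?thesis .
qed

text \<open>The substitution of the minors without the bookkeeping of degrees.\<close>

definition ev :: "X_var mpoly \<Rightarrow> (nat \<times> nat) mpoly" where
  "ev = insertion (single 0) Delta"

lemma single_0_hom: "comm_ring_hom (single 0 :: complex \<Rightarrow> (nat \<times> nat) mpoly)"
  by unfold_locales (simp_all add: single_add mult_single)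

lemma Ev_single: "Ev (single t c) = single (mdeg t) (ev (single t c))"
proof -
  have pw: "single (single a (1::nat)) d ^ k = single (single a k) (d ^ k)"
    for a :: "nat \<times> nat" and d :: "(nat \<times> nat) mpoly" and k
    by (induction k) (simp_all add: mult_single flip: single_add)
  have "(\<Prod>x\<in>K. single (single (fst x) 1) (Delta x) ^ lookup t x) =
      single (\<Sum>x\<in>K. single (fst x) (lookup t x)) (\<Prod>x\<in>K. Delta x ^ lookup t x)" if "finite K" for K
    using that
  proof (induction K)
    case (insert x K)
    then show ?case by (simp add: pw mult_single del: One_nat_def)
  qed simp
  then show ?thesis
    by (simp add: Ev_def ev_def insertion_single[OF gconst_hom] insertion_single[OF single_0_hom] gconst_def
        mult_single mdeg_def)
qed

lemma sum_singles: "F = (\<Sum>t\<in>keys F. single t (lookup F t))"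
  for F :: "'b \<Rightarrow>\<^sub>0 'c::comm_monoid_add"
proof (rule poly_mapping_eqI)
  fix s
  have "(\<Sum>t\<in>keys F. lookup (single t (lookup F t)) s) = (\<Sum>t\<in>keys F. if t = s then lookup F s else 0)"
    by (rule sum.cong) (auto simp: lookup_single when_def)
  then show "lookup F s = lookup (\<Sum>t\<in>keys F. single t (lookup F t)) s"
    by (simp add: lookup_sum in_keys_iff)
qed

lemma Ev_homogeneous:
  assumes "\<And>t. t \<in> keys F \<Longrightarrow> mdeg t = m"
  shows "Ev F = single m (ev F)"
proof -
  interpret ev: comm_ring_hom ev unfolding ev_def by (rule insertion_hom[OF single_0_hom])
  have "Ev F = (\<Sum>t\<in>keys F. single m (ev (single t (lookup F t))))"
    by (subst sum_singles[of F]) (simp add: Ev.hom_sum Ev_single assms)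
  also have "\<dots> = single m (\<Sum>t\<in>keys F. ev (single t (lookup F t)))"
  proof -
    have "(\<Sum>t\<in>K. single m (f t)) = single m (\<Sum>t\<in>K. f t)" for K and f :: "_ \<Rightarrow> (nat \<times> nat) mpoly"
      by (induction K rule: infinite_finite_induct) (simp_all add: single_add)
    then show ?thesis .
  qed
  also have "(\<Sum>t\<in>keys F. ev (single t (lookup F t))) = ev F"
    by (subst (3) sum_singles[of F]) (simp add: ev.hom_sum)
  finally show ?thesis .
qed

lemma peval_ev: "peval c (ev F) = peval (\<lambda>x. peval c (Delta x)) F"
proof -
  have "F \<in> carrier (poly_alg UNIV)" by (simp add: carrier_poly_alg)
  then show ?thesis
  proof (induction F rule: mpoly_induct)
    case one
    interpret ev: comm_ring_hom ev unfolding ev_def by (rule insertion_hom[OF single_0_hom])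
    show ?case by simp
  qed (simp_all add: ev_def insertion_add[OF single_0_hom] insertion_mult[OF single_0_hom]
      insertion_pvar[OF single_0_hom] insertion_scl[OF single_0_hom] flip: scl_eq_mult)
qed

lemma multihomogeneous_iff:
  assumes F: "F \<in> carrier (poly_alg (X_vars n))"
  shows "multihomogeneous n F \<longleftrightarrow> (\<exists>m. \<forall>t\<in>keys F. mdeg t = m)"
proof
  have k: "keys t \<subseteq> X_vars n" if "t \<in> keys F" for t using F that by (simp add: carrier_poly_alg)
  assume "multihomogeneous n F"
  then obtain d where d: "\<forall>t\<in>keys F. \<forall>\<alpha>\<in>roots n. (\<Sum>L | (\<alpha>, L) \<in> X_vars n. lookup t (\<alpha>, L)) = d \<alpha>"
    by (auto simp: multihomogeneous_def)
  have "mdeg t = mdeg s" if "t \<in> keys F" "s \<in> keys F" for s t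
  proof (rule poly_mapping_eqI)
    fix \<alpha>
    show "lookup (mdeg t) \<alpha> = lookup (mdeg s) \<alpha>"
    proof (cases "\<alpha> \<in> roots n")
      case True
      then show ?thesis using d that by (simp add: lookup_mdeg[OF k])
    next
      case False
      then have "{L. (\<alpha>, L) \<in> X_vars n} = {}" by (auto simp: X_vars_def)
      then show ?thesis using that by (simp only: lookup_mdeg[OF k]) simp
    qed
  qed
  then show "\<exists>m. \<forall>t\<in>keys F. mdeg t = m" by metis
next
  assume "\<exists>m. \<forall>t\<in>keys F. mdeg t = m"
  then obtain m where "\<forall>t\<in>keys F. mdeg t = m" ..
  moreover have "keys t \<subseteq> X_vars n" if "t \<in> keys F" for t using F that by (simp add: carrier_poly_alg)
  ultimately show "multihomogeneous n F"
    unfolding multihomogeneous_def by (intro exI[of _ "lookup m"]) (auto simp flip: lookup_mdeg)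
qed

text \<open>Vanishing on \<open>R\<^sub>n\<close> is vanishing on the cell, by density, and the substitution of the minors is
  evaluation at the generic point of the cell.\<close>

lemma homogeneous_vanishes_iff:
  assumes F: "F \<in> carrier (poly_alg (X_vars n))" and hom: "multihomogeneous n F"
  shows "vanishes_on_R n F \<longleftrightarrow> Ev F = 0"
proof -
  obtain m where m: "\<And>t. t \<in> keys F \<Longrightarrow> mdeg t = m"
    using hom multihomogeneous_iff[OF F] by blast
  have "vanishes_on_R n F \<longleftrightarrow> (\<forall>c. peval c (ev F) = 0)"
    using vanishing_imp_zero_on_cell[OF F] zero_on_cell_imp_vanishing[OF F hom] by (auto simp: peval_ev)
  also have "\<dots> \<longleftrightarrow> ev F = 0" using peval_eq_0_imp_zero by auto
  also have "\<dots> \<longleftrightarrow> Ev F = 0"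
  proof -
    have "Ev F = single m (ev F)" by (rule Ev_homogeneous) (rule m)
    moreover have "single m p = 0 \<longleftrightarrow> p = 0" for p :: "(nat \<times> nat) mpoly"
      using lookup_single_eq[of m p] by (auto simp del: lookup_single_eq)
    ultimately show ?thesis by simp
  qed
  finally show ?thesis .
qed

definition component :: "(nat \<times> nat \<Rightarrow>\<^sub>0 nat) \<Rightarrow> X_var mpoly \<Rightarrow> X_var mpoly" where
  "component m F = (\<Sum>t | t \<in> keys F \<and> mdeg t = m. single t (lookup F t))"

lemma lookup_component: "lookup (component m F) t = (if mdeg t = m then lookup F t else 0)"
proof -
  have "lookup (component m F) t = (\<Sum>s | s \<in> keys F \<and> mdeg s = m. if s = t then lookup F t else 0)"
    unfolding component_def lookup_sum by (rule sum.cong) (auto simp: lookup_single when_def)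
  also have "\<dots> = (if mdeg t = m then lookup F t else 0)" by (auto simp: in_keys_iff)
  finally show ?thesis .
qed

text \<open>The kernel is a graded ideal, so it is generated by its homogeneous elements.\<close>

lemma I_R_eq_kernel: "I_R n = {F \<in> carrier (poly_alg (X_vars n)). Ev F = 0}"
proof
  let ?A = "poly_alg (X_vars n)"
  let ?G = "{F \<in> carrier ?A. multihomogeneous n F \<and> vanishes_on_R n F}"
  interpret cring ?A by (rule cring_poly_alg)
  have "ideal {F \<in> carrier ?A. Ev F = 0} ?A"
  proof (rule poly_alg_idealI)
    show "pm.subspace {F \<in> carrier ?A. Ev F = 0}"
    proof -
      have "Ev (scl c F) = 0" if "Ev F = 0" for c F
        using that by (intro poly_mapping_eqI) (simp add: lookup_Ev_scl)
      then show ?thesis by (auto simp: pm.subspace_def poly_alg_closed Ev.hom_add)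
    qed
  qed (auto simp: poly_alg_closed Ev.hom_mult)
  then show "I_R n \<subseteq> {F \<in> carrier ?A. Ev F = 0}"
    unfolding I_R_def by (rule genideal_minimal) (use homogeneous_vanishes_iff in blast)
  have I: "ideal (I_R n) ?A" unfolding I_R_def by (rule genideal_ideal) blast
  show "{F \<in> carrier ?A. Ev F = 0} \<subseteq> I_R n"
  proof
    fix F assume "F \<in> {F \<in> carrier ?A. Ev F = 0}"
    then have F: "F \<in> carrier ?A" "Ev F = 0" by auto
    have comp: "component m F \<in> I_R n" for m
    proof -
      have keys: "t \<in> keys F \<and> mdeg t = m" if "t \<in> keys (component m F)" for t
        using that by (auto simp: in_keys_iff lookup_component split: if_splits)
      then have c: "component m F \<in> carrier ?A" using F(1) by (auto simp: carrier_poly_alg)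
      have hom: "multihomogeneous n (component m F)" using keys multihomogeneous_iff[OF c] by blast
      have "lookup (Ev F) m = lookup (Ev (component m F)) m"
      proof -
        have "F = component m F + (F - component m F)" by simp
        then have "Ev F = Ev (component m F) + Ev (F - component m F)" using Ev.hom_add by metis
        moreover have "lookup (Ev (F - component m F)) m = 0"
        proof -
          let ?D = "F - component m F"
          have "lookup (Ev ?D) m = (\<Sum>t\<in>keys ?D. lookup (single (mdeg t) (ev (single t (lookup ?D t)))) m)"
            by (subst sum_singles[of ?D]) (simp only: Ev.hom_sum Ev_single lookup_sum)
          also have "\<dots> = 0"
            by (intro sum.neutral ballI) (auto simp: in_keys_iff lookup_minus lookup_component lookup_single when_def)
          finally show ?thesis .
        qed
        ultimately show ?thesis by (simp add: lookup_add)
      qed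
      then have "ev (component m F) = 0" using F(2) Ev_homogeneous[of "component m F" m] keys by simp
      then have "Ev (component m F) = 0" using Ev_homogeneous[of "component m F" m] keys by simp
      then have "component m F \<in> ?G" using c hom homogeneous_vanishes_iff[OF c hom] by blast
      then show ?thesis unfolding I_R_def using genideal_self[of ?G] by blast
    qed
    have "F = (\<Sum>m\<in>mdeg ` keys F. component m F)"
    proof (rule poly_mapping_eqI)
      fix t
      have "lookup (\<Sum>m\<in>mdeg ` keys F. component m F) t = (\<Sum>m\<in>mdeg ` keys F. if m = mdeg t then lookup F t else 0)"
        unfolding lookup_sum by (rule sum.cong) (auto simp: lookup_component)
      also have "\<dots> = lookup F t" by (auto simp: in_keys_iff)
      finally show "lookup F t = lookup (\<Sum>m\<in>mdeg ` keys F. component m F) t" by simp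
    qed
    also have "\<dots> \<in> I_R n" by (intro pm.subspace_sum poly_alg_idealD(1)[OF I] comp)
    finally show "F \<in> I_R n" .
  qed
qed

section \<open>The isomorphism\<close>

lemma multidegs_add: "m1 + m2 \<in> multidegs n \<longleftrightarrow> m1 \<in> multidegs n \<and> m2 \<in> multidegs n"
  by (auto simp: multidegs_def subset_iff in_keys_iff lookup_add)

lemma finite_decompositions: "finite {(m1, m2). m1 + m2 = (m :: nat \<times> nat \<Rightarrow>\<^sub>0 nat)}"
proof -
  have "finite {m1. \<exists>m2. m1 + m2 = m}"
  proof (rule finite_imageD)
    show "finite ((\<lambda>m1. restrict (lookup m1) (keys m)) ` {m1. \<exists>m2. m1 + m2 = m})"
    proof (rule finite_subset)
      show "(\<lambda>m1. restrict (lookup m1) (keys m)) ` {m1. \<exists>m2. m1 + m2 = m} \<subseteq> (\<Pi>\<^sub>E x\<in>keys m. {..lookup m x})"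
        by (auto simp: lookup_add)
    qed (simp add: finite_PiE)
    show "inj_on (\<lambda>m1. restrict (lookup m1) (keys m)) {m1. \<exists>m2. m1 + m2 = m}"
    proof (rule inj_onI, rule poly_mapping_eqI)
      fix a b x assume ab: "a \<in> {m1. \<exists>m2. m1 + m2 = m}" "b \<in> {m1. \<exists>m2. m1 + m2 = m}"
        "restrict (lookup a) (keys m) = restrict (lookup b) (keys m)"
      show "lookup a x = lookup b x"
      proof (cases "x \<in> keys m")
        case True
        then show ?thesis using fun_cong[OF ab(3), of x] by simp
      next
        case False
        then have m0: "lookup m x = 0" by (simp add: in_keys_iff)
        from ab(1,2) obtain a' b' where "a + a' = m" "b + b' = m" by blast
        then have "lookup a x + lookup a' x = 0" "lookup b x + lookup b' x = 0"
          using m0 by (metis lookup_add)+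
        then show ?thesis by simp
      qed
    qed
  qed
  then show ?thesis
    by (rule finite_surj[of _ _ "\<lambda>m1. (m1, m - m1)"]) auto
qed

lemma lookup_graded_mult:
  "lookup (f * g) m = (\<Sum>(m1, m2) | m1 + m2 = m. lookup f m1 * lookup g m2)"
  for f g :: graded
proof (induction f rule: pm_induct)
  case (single s a)
  show ?case
  proof (induction g rule: pm_induct)
    case (single t b)
    have "(\<Sum>(m1, m2) | m1 + m2 = m. lookup (single s a) m1 * lookup (single t b) m2) =
        (\<Sum>x\<in>{(m1, m2). m1 + m2 = m}. if x = (s, t) then a * b else 0)"
      by (rule sum.cong) (auto simp: lookup_single when_def split: if_splits)
    then show ?case using finite_decompositions by (simp add: mult_single lookup_single when_def)
  qed (simp add: distrib_left lookup_add sum.distrib case_prod_beta)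
qed (simp add: distrib_right lookup_add sum.distrib case_prod_beta)

text \<open>An element of \<open>\<Oplus>\<^sub>m M\<^sub>m\<^sup>*\<close> corresponds to a graded polynomial if its components have the
  components of the polynomial as symbols.\<close>

definition corresponds :: "nat \<Rightarrow> ((nat \<times> nat \<Rightarrow>\<^sub>0 nat) \<Rightarrow> M_elem \<Rightarrow> complex) \<Rightarrow> graded \<Rightarrow> bool" where
  "corresponds n \<Phi> f \<longleftrightarrow> \<Phi> \<in> extensional (multidegs n) \<and> (\<forall>m\<in>multidegs n. M_symbol n m (\<Phi> m) (lookup f m))"

lemma correspondsD: "corresponds n \<Phi> f \<Longrightarrow> m \<in> multidegs n \<Longrightarrow> M_symbol n m (\<Phi> m) (lookup f m)"
  by (simp add: corresponds_def)

lemma corresponds_unique: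
  assumes "corresponds n \<Phi> f" "corresponds n \<Psi> f"
  shows "\<Phi> = \<Psi>"
proof (rule extensionalityI)
  show "\<Phi> \<in> extensional (multidegs n)" "\<Psi> \<in> extensional (multidegs n)"
    using assms by (auto simp: corresponds_def)
  fix m assume m: "m \<in> multidegs n"
  then interpret M_module n m by unfold_locales
  show "\<Phi> m = \<Psi> m"
    using functional_determined correspondsD[OF assms(1) m] correspondsD[OF assms(2) m] by blast
qed

lemma corresponds_carrier:
  assumes "corresponds n \<Phi> f"
  shows "\<Phi> \<in> carrier (M_dual_alg n)"
proof -
  have "\<Phi> m x = 0" if mx: "m \<in> multidegs n" "m \<notin> keys f" "x \<in> carrier (M_mod n m)" for m x
  proof -
    interpret M_module n m using mx by unfold_locales
    have "\<Phi> m = (\<lambda>x\<in>carrier (M_mod n m). 0)"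
      using correspondsD[OF assms mx(1)] mx(2) has_symbol_zero[OF root_module_M_mod v_in_M]
      by (intro functional_determined[of _ 0]) (auto simp: in_keys_iff)
    then show ?thesis using mx by simp
  qed
  then have "{m \<in> multidegs n. \<exists>x\<in>carrier (M_mod n m). \<Phi> m x \<noteq> 0} \<subseteq> keys f" by blast
  then show ?thesis
    using assms finite_subset[OF _ finite_keys]
    by (auto simp: M_dual_alg_def corresponds_def PiE_iff has_symbol_def)
qed

lemma corresponds_add:
  assumes "corresponds n \<Phi> f" "corresponds n \<Psi> g"
  shows "corresponds n (\<Phi> \<oplus>\<^bsub>M_dual_alg n\<^esub> \<Psi>) (f + g)"
  unfolding corresponds_def
proof (intro conjI ballI)
  fix m assume m: "m \<in> multidegs n"
  then interpret M_module n m by unfold_locales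
  have "(\<Phi> \<oplus>\<^bsub>M_dual_alg n\<^esub> \<Psi>) m = (\<lambda>x\<in>carrier (M_mod n m). 1 * \<Phi> m x + 1 * \<Psi> m x)"
    using m by (simp add: M_dual_alg_def restrict_def)
  then show "M_symbol n m ((\<Phi> \<oplus>\<^bsub>M_dual_alg n\<^esub> \<Psi>) m) (lookup (f + g) m)"
    using has_symbol_lincomb[OF root_module_M_mod v_in_M correspondsD[OF assms(1) m] correspondsD[OF assms(2) m], of 1 1]
    by (simp only: pm.scale_one lookup_add)
qed (simp add: M_dual_alg_def)

lemma corresponds_smult:
  assumes "corresponds n \<Phi> f" "\<And>m. lookup g m = scl c (lookup f m)"
  shows "corresponds n (c \<odot>\<^bsub>M_dual_alg n\<^esub> \<Phi>) g"
  unfolding corresponds_def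
proof (intro conjI ballI)
  fix m assume m: "m \<in> multidegs n"
  then interpret M_module n m by unfold_locales
  note \<Phi> = correspondsD[OF assms(1) m]
  have "(c \<odot>\<^bsub>M_dual_alg n\<^esub> \<Phi>) m = (\<lambda>x\<in>carrier (M_mod n m). c * \<Phi> m x + 0 * \<Phi> m x)"
    using m by (simp add: M_dual_alg_def restrict_def)
  then show "M_symbol n m ((c \<odot>\<^bsub>M_dual_alg n\<^esub> \<Phi>) m) (lookup g m)"
    using has_symbol_lincomb[OF root_module_M_mod v_in_M \<Phi> \<Phi>, of c 0]
    by (simp only: pm.scale_zero_left assms(2) add_0_right)
qed (simp add: M_dual_alg_def)

lemma corresponds_mult:
  assumes "corresponds n \<Phi> f" "corresponds n \<Psi> g"
  shows "corresponds n (\<Phi> \<otimes>\<^bsub>M_dual_alg n\<^esub> \<Psi>) (f * g)"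
  unfolding corresponds_def
proof (intro conjI ballI)
  fix m assume m: "m \<in> multidegs n"
  then interpret M_module n m by unfold_locales
  let ?I = "{(m1, m2). m1 + m2 = m}"
  let ?\<phi> = "\<lambda>p x. tensor_functional UNIV (case_bool (\<Psi> (snd p)) (\<Phi> (fst p))) (M_embedding n (fst p) (snd p) x)"
  have I: "{(m1, m2). m1 \<in> multidegs n \<and> m2 \<in> multidegs n \<and> m1 + m2 = m} = ?I"
    using m multidegs_add by auto
  have e: "(\<Phi> \<otimes>\<^bsub>M_dual_alg n\<^esub> \<Psi>) m = (\<lambda>x\<in>carrier (M_mod n m). \<Sum>p\<in>?I. ?\<phi> p x)"
    using m by (simp add: M_dual_alg_def I case_prod_beta)
  have p: "M_symbol n m (\<lambda>x\<in>carrier (M_mod n m). ?\<phi> p x) (lookup f (fst p) * lookup g (snd p))"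
    if "p \<in> ?I" for p
  proof -
    obtain m1 m2 where mm: "p = (m1, m2)" "m = m1 + m2" using \<open>p \<in> ?I\<close> by auto
    then have md: "m1 \<in> multidegs n" "m2 \<in> multidegs n" "m1 + m2 \<in> multidegs n" using m multidegs_add by auto
    show ?thesis
      using M_mult_symbol[OF md correspondsD[OF assms(1) md(1)] correspondsD[OF assms(2) md(2)]] by (simp add: mm)
  qed
  have "lookup (f * g) m = (\<Sum>p\<in>?I. lookup f (fst p) * lookup g (snd p))"
    by (simp add: lookup_graded_mult case_prod_beta)
  then show "M_symbol n m ((\<Phi> \<otimes>\<^bsub>M_dual_alg n\<^esub> \<Psi>) m) (lookup (f * g) m)"
    unfolding e using has_symbol_sum[OF root_module_M_mod v_in_M finite_decompositions p] by simp
qed (simp add: M_dual_alg_def)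

text \<open>The unit is described as the functional on \<open>M\<^sub>0\<close> with value \<open>1\<close> at \<open>v\<^sub>0\<close>; the symbols for \<open>M\<^sub>0\<close> being constants,
  it is the one with symbol \<open>1\<close>.\<close>

lemma corresponds_one: "corresponds n \<one>\<^bsub>M_dual_alg n\<^esub> 1"
  unfolding corresponds_def
proof (intro conjI ballI)
  fix m assume m: "m \<in> multidegs n"
  then interpret M_module n m by unfold_locales
  show "M_symbol n m (\<one>\<^bsub>M_dual_alg n\<^esub> m) (lookup 1 m)"
  proof (cases "m = 0")
    case True
    obtain \<phi> where \<phi>: "M_symbol n m \<phi> 1"
      using symbol_exists[of 1] one_in_symbols True by auto
    have at_v: "\<psi> (v_vec n m) = lookup g 0" if "M_symbol n m \<psi> g" for \<psi> g
      using that is_symbol_const[of n "M_mod n m" \<psi> "v_vec n m" g] by (simp add: has_symbol_def)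
    have "(THE \<phi>. \<phi> \<in> dual (M_mod n 0) \<and> \<phi> (v_vec n 0) = 1) = \<phi>"
    proof (rule the_equality)
      show "\<phi> \<in> dual (M_mod n 0) \<and> \<phi> (v_vec n 0) = 1"
        using \<phi> at_v[OF \<phi>] True by (simp add: has_symbol_def)
      fix \<psi> assume \<psi>: "\<psi> \<in> dual (M_mod n 0) \<and> \<psi> (v_vec n 0) = 1"
      then obtain g where g: "g \<in> symbols n 0" "M_symbol n m \<psi> g"
        using symbol_of_functional[of \<psi>] True by auto
      then obtain c where "g = scl c 1" by (auto simp: symbols_0)
      moreover have "lookup g 0 = 1" using at_v[OF g(2)] \<psi> True by simp
      ultimately have "g = 1" by simp
      then show "\<psi> = \<phi>" using functional_determined g(2) \<phi> by blast
    qed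
    then show ?thesis using m True \<phi> by (simp add: M_dual_alg_def)
  next
    case False
    then show ?thesis
      using m has_symbol_zero[OF root_module_M_mod v_in_M] by (simp add: M_dual_alg_def lookup_one)
  qed
qed (simp add: M_dual_alg_def)

lemma corresponds_exists:
  assumes "F \<in> carrier (poly_alg (X_vars n))"
  shows "\<exists>\<Phi>. corresponds n \<Phi> (Ev F)"
proof -
  have ex: "\<exists>\<phi>. M_symbol n m \<phi> (lookup (Ev F) m)" if "m \<in> multidegs n" for m
    using M_module.symbol_exists[OF M_module.intro[OF that] Ev_in_symbols[OF assms]] .
  obtain \<Phi> where "\<And>m. m \<in> multidegs n \<Longrightarrow> M_symbol n m (\<Phi> m) (lookup (Ev F) m)"
    by (rule choice_on, erule ex) (rule that; assumption)
  then have "corresponds n (restrict \<Phi> (multidegs n)) (Ev F)" by (simp add: corresponds_def)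
  then show ?thesis by blast
qed

lemma corresponds_inj:
  assumes "corresponds n \<Phi> (Ev F)" "corresponds n \<Phi> (Ev G)"
    "F \<in> carrier (poly_alg (X_vars n))" "G \<in> carrier (poly_alg (X_vars n))"
  shows "Ev F = Ev G"
proof (rule poly_mapping_eqI)
  fix m
  show "lookup (Ev F) m = lookup (Ev G) m"
  proof (cases "m \<in> multidegs n")
    case True
    show ?thesis
      using correspondsD[OF assms(1) True] correspondsD[OF assms(2) True]
        Ev_in_symbols[OF assms(3)] Ev_in_symbols[OF assms(4)] symbols_closed
      unfolding has_symbol_def by (intro is_symbol_unique[of n _ "\<Phi> m"]) blast+
  next
    case False
    then show ?thesis
      using Ev_in_symbols[OF assms(3), of m] Ev_in_symbols[OF assms(4), of m] symbols_trivial by auto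
  qed
qed

lemma corresponds_surj:
  assumes "\<Phi> \<in> carrier (M_dual_alg n)"
  shows "\<exists>F\<in>carrier (poly_alg (X_vars n)). corresponds n \<Phi> (Ev F)"
proof -
  define S where "S = {m \<in> multidegs n. \<exists>x\<in>carrier (M_mod n m). \<Phi> m x \<noteq> 0}"
  have \<Phi>: "\<Phi> \<in> (\<Pi>\<^sub>E m\<in>multidegs n. dual (M_mod n m))" and S: "finite S"
    using assms by (auto simp: M_dual_alg_def S_def)
  have ex: "\<exists>F. F \<in> carrier (poly_alg (X_vars n)) \<and> (\<exists>g. Ev F = single m g \<and> M_symbol n m (\<Phi> m) g)"
    if "m \<in> S" for m
  proof -
    have m: "m \<in> multidegs n" using that by (simp add: S_def)
    interpret M_module n m using m by unfold_locales
    have "\<Phi> m \<in> dual (M_mod n m)" using \<Phi> m by auto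
    then show ?thesis using symbol_of_functional symbols_lift by blast
  qed
  obtain F where F: "\<And>m. m \<in> S \<Longrightarrow> F m \<in> carrier (poly_alg (X_vars n)) \<and>
      (\<exists>g. Ev (F m) = single m g \<and> M_symbol n m (\<Phi> m) g)"
    by (rule choice_on, erule ex) (rule that; assumption)
  have l: "lookup (Ev (\<Sum>m\<in>S. F m)) m = (if m \<in> S then lookup (Ev (F m)) m else 0)" for m
  proof -
    have "lookup (Ev (\<Sum>m\<in>S. F m)) m = (\<Sum>k\<in>S. if k = m then lookup (Ev (F m)) m else 0)"
      unfolding Ev.hom_sum lookup_sum
    proof (rule sum.cong[OF refl])
      fix k assume "k \<in> S"
      then obtain g where "Ev (F k) = single k g" using F by blast
      then show "lookup (Ev (F k)) m = (if k = m then lookup (Ev (F m)) m else 0)"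
        by (auto simp: lookup_single when_def)
    qed
    then show ?thesis using S by simp
  qed
  have "corresponds n \<Phi> (Ev (\<Sum>m\<in>S. F m))"
    unfolding corresponds_def
  proof (intro conjI ballI)
    show "\<Phi> \<in> extensional (multidegs n)" using \<Phi> by (simp add: PiE_iff)
    fix m assume m: "m \<in> multidegs n"
    interpret M_module n m using m by unfold_locales
    show "M_symbol n m (\<Phi> m) (lookup (Ev (\<Sum>m\<in>S. F m)) m)"
    proof (cases "m \<in> S")
      case True
      then show ?thesis using F[OF True] by (auto simp: l)
    next
      case False
      then have "\<Phi> m = (\<lambda>x\<in>carrier (M_mod n m). 0)"
        using \<Phi> m by (intro dual_eqI[OF _ dual_zero[OF root_module_module[OF root_module_M_mod]]]) (auto simp: S_def)
      then show ?thesis using False has_symbol_zero[OF root_module_M_mod v_in_M] by (simp add: l)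
    qed
  qed
  moreover have "(\<Sum>m\<in>S. F m) \<in> carrier (poly_alg (X_vars n))"
    using F by (intro pm.subspace_sum poly_alg_subspace) auto
  ultimately show ?thesis by blast
qed

theorem theorem0p1:
  fixes n :: nat
  assumes "n \<ge> 2"
  shows "\<exists>h \<in> ring_iso (Q_alg n) (M_dual_alg n).
           \<forall>c. \<forall>x\<in>carrier (Q_alg n). h (c \<odot>\<^bsub>Q_alg n\<^esub> x) = c \<odot>\<^bsub>M_dual_alg n\<^esub> h x"
proof -
  let ?A = "poly_alg (X_vars n)" and ?B = "M_dual_alg n"
  interpret A: cring ?A by (rule cring_poly_alg)
  have I: "ideal (I_R n) ?A" unfolding I_R_def by (rule A.genideal_ideal) blast
  interpret Q: pm_quot ?A "I_R n"
    by unfold_locales (simp_all add: poly_alg_subspace poly_alg_idealD(1,2)[OF I])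
  have Q_ops: "carrier (Q_alg n) = Q.cls ` carrier ?A"
    "Q.cls F \<oplus>\<^bsub>Q_alg n\<^esub> Q.cls G = Q.cls (F + G)" "c \<odot>\<^bsub>Q_alg n\<^esub> Q.cls F = Q.cls (scl c F)"
    "\<one>\<^bsub>Q_alg n\<^esub> = Q.cls 1" for F G c
    by (simp_all add: Q_alg_def Q.quot_carrier Q.quot_add Q.quot_smult) (simp add: quot_def)
  have Q_mult: "Q.cls F \<otimes>\<^bsub>Q_alg n\<^esub> Q.cls G = Q.cls (F * G)" if "F \<in> carrier ?A" "G \<in> carrier ?A" for F G
    using ideal.rcoset_mult_add[OF I that] by (simp add: Q_alg_def quot_def)
  have eq_iff: "Q.cls F = Q.cls G \<longleftrightarrow> Ev F = Ev G" if "F \<in> carrier ?A" "G \<in> carrier ?A" for F G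
  proof -
    have "F - G \<in> carrier ?A" using that by (intro pm.subspace_diff poly_alg_subspace)
    moreover have "Ev (F - G) = Ev F - Ev G" using Ev.hom_add[of "F - G" G] by (simp add: algebra_simps)
    ultimately show ?thesis unfolding Q.cls_eq by (simp add: I_R_eq_kernel)
  qed
  define h where "h X = (THE \<Phi>. \<exists>F\<in>carrier ?A. X = Q.cls F \<and> corresponds n \<Phi> (Ev F))" for X
  have h: "corresponds n (h (Q.cls F)) (Ev F)" if F: "F \<in> carrier ?A" for F
  proof -
    obtain \<Phi> where \<Phi>: "corresponds n \<Phi> (Ev F)" using corresponds_exists[OF F] by blast
    have "h (Q.cls F) = \<Phi>"
      unfolding h_def
    proof (rule the_equality)
      show "\<exists>G\<in>carrier ?A. Q.cls F = Q.cls G \<and> corresponds n \<Phi> (Ev G)" using F \<Phi> by blast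
      fix \<Psi> assume "\<exists>G\<in>carrier ?A. Q.cls F = Q.cls G \<and> corresponds n \<Psi> (Ev G)"
      then show "\<Psi> = \<Phi>" using eq_iff[OF F] \<Phi> corresponds_unique by metis
    qed
    then show ?thesis using \<Phi> by simp
  qed
  have h_eq: "h (Q.cls F) = \<Phi>" if "F \<in> carrier ?A" "corresponds n \<Phi> (Ev F)" for F \<Phi>
    using corresponds_unique[OF h[OF that(1)] that(2)] .
  have "h \<in> ring_iso (Q_alg n) ?B"
  proof (rule ring_iso_memI)
    fix x assume "x \<in> carrier (Q_alg n)"
    then show "h x \<in> carrier ?B" using corresponds_carrier[OF h] by (auto simp: Q_ops)
  next
    fix x y assume "x \<in> carrier (Q_alg n)" "y \<in> carrier (Q_alg n)"
    then obtain F G where FG: "F \<in> carrier ?A" "G \<in> carrier ?A" "x = Q.cls F" "y = Q.cls G"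
      by (auto simp: Q_ops)
    have "corresponds n (h x \<otimes>\<^bsub>?B\<^esub> h y) (Ev (F * G))"
      using corresponds_mult[OF h[OF FG(1)] h[OF FG(2)]] by (simp add: Ev.hom_mult FG)
    then show "h (x \<otimes>\<^bsub>Q_alg n\<^esub> y) = h x \<otimes>\<^bsub>?B\<^esub> h y"
      using FG h_eq poly_alg_closed(4)[OF FG(1,2)] by (simp add: Q_mult)
    have "corresponds n (h x \<oplus>\<^bsub>?B\<^esub> h y) (Ev (F + G))"
      using corresponds_add[OF h[OF FG(1)] h[OF FG(2)]] by (simp add: Ev.hom_add FG)
    then show "h (x \<oplus>\<^bsub>Q_alg n\<^esub> y) = h x \<oplus>\<^bsub>?B\<^esub> h y"
      using FG h_eq poly_alg_closed(3)[OF FG(1,2)] by (simp add: Q_ops)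
  next
    show "h \<one>\<^bsub>Q_alg n\<^esub> = \<one>\<^bsub>?B\<^esub>"
      using h_eq[OF poly_alg_closed(2)] corresponds_one by (simp add: Q_ops)
    show "bij_betw h (carrier (Q_alg n)) (carrier ?B)"
      unfolding bij_betw_def
    proof
      show "inj_on h (carrier (Q_alg n))"
      proof (rule inj_onI)
        fix x y assume "x \<in> carrier (Q_alg n)" "y \<in> carrier (Q_alg n)" and xy: "h x = h y"
        then obtain F G where FG: "F \<in> carrier ?A" "G \<in> carrier ?A" "x = Q.cls F" "y = Q.cls G"
          by (auto simp: Q_ops)
        have "Ev F = Ev G"
          using corresponds_inj[OF h[OF FG(1)] _ FG(1,2)] h[OF FG(2)] xy FG by simp
        then show "x = y" using eq_iff FG by simp
      qed
      show "h ` carrier (Q_alg n) = carrier ?B"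
      proof
        show "h ` carrier (Q_alg n) \<subseteq> carrier ?B" using corresponds_carrier[OF h] by (auto simp: Q_ops)
        show "carrier ?B \<subseteq> h ` carrier (Q_alg n)"
        proof
          fix \<Phi> assume "\<Phi> \<in> carrier ?B"
          then obtain F where "F \<in> carrier ?A" "corresponds n \<Phi> (Ev F)" using corresponds_surj by blast
          then show "\<Phi> \<in> h ` carrier (Q_alg n)" using h_eq by (force simp: Q_ops)
        qed
      qed
    qed
  qed
  moreover have "h (c \<odot>\<^bsub>Q_alg n\<^esub> x) = c \<odot>\<^bsub>?B\<^esub> h x" if "x \<in> carrier (Q_alg n)" for c x
  proof -
    obtain F where F: "F \<in> carrier ?A" "x = Q.cls F" using \<open>x \<in> carrier (Q_alg n)\<close> by (auto simp: Q_ops)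
    have "corresponds n (c \<odot>\<^bsub>?B\<^esub> h x) (Ev (scl c F))"
      using corresponds_smult[OF h[OF F(1)]] by (simp add: F lookup_Ev_scl)
    then show ?thesis using F h_eq poly_alg_closed(5)[OF F(1)] by (simp add: Q_ops)
  qed
  ultimately show ?thesis by blast
qed

end
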